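(* Let $m\ge1$ and let $$F(z,u_1,\dots,u_m)=M(z)\prod_{\ell=1}^mG_\ell\big(u_\ell H_\ell(z)\big)$$ be a multivariate extended composition scheme that is critical and pure (as defined in the context). Let $\mathbf X_n=(X_{n,1},\dots,X_{n,m})$ be the random vector with $$\mathbb P\{X_{n,1}=k_1,\dots,X_{n,m}=k_m\}=\frac{[z^nu_1^{k_1}\cdots u_m^{k_m}]F(z,u_1,\dots,u_m)}{[z^n]F(z,1,\dots,1)}.$$ Then for all integers $s_1,\dots,s_m\ge0$ the joint moments satisfy, as $n\to\infty$, $$\mathbb E(X_{n,1}^{s_1}\cdots X_{n,m}^{s_m})\sim\mu_{s_1,\dots,s_m}\prod_{\ell=1}^mn^{s_\ell\lambda_{H_\ell}}\kappa_\ell^{s_\ell},\qquad\kappa_\ell=\frac{\tau_{H_\ell}}{-c_{H_\ell}},$$ $$\mu_{s_1,\dots,s_m}=\frac{\Gamma\big(-\sum_{\ell=1}^m\lambda_{G_\ell}\lambda_{H_\ell}-\lambda_M\big)}{\Gamma\big(\sum_{\ell=1}^ms_\ell\lambda_{H_\ell}-\sum_{\ell=1}^m\lambda_{G_\ell}\lambda_{H_\ell}-\lambda_M\big)}\prod_{\ell=1}^m\frac{\Gamma(s_\ell-\lambda_{G_\ell})}{\Gamma(-\lambda_{G_\ell})}.$$ Consequently, $$\left(\frac{X_{n,1}}{\kappa_1n^{\lambda_{H_1}}},\dots,\frac{X_{n,m}}{\kappa_mn^{\lambda_{H_m}}}\right)\to\mathbf X$$ in distribution and with convergence of all joint moments,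 where $\mathbf X$ is determined by its joint moment sequence $\mu_{s_1,\dots,s_m}$. Moreover, $$\mathbf X=(X_1,\dots,X_m)\overset d=\big(V_1W_1^{\lambda_{H_1}},\dots,V_mW_m^{\lambda_{H_m}}\big),$$ where $\mathbf W=(W_1,\dots,W_m,W_{m+1})$ has the Dirichlet distribution $\mathrm{Dir}(-\lambda_{G_1}\lambda_{H_1},\dots,-\lambda_{G_m}\lambda_{H_m},-\lambda_M)$, and $V_1,\dots,V_m$ are independent, independent of $\mathbf W$, with $V_\ell\sim\mathrm{ML}(\lambda_{H_\ell},-\lambda_{G_\ell}\lambda_{H_\ell})$ the two-parameter Mittag-Leffler distribution.
   Context: All series $G_\ell,H_\ell,M$ have nonnegative coefficients and are analytic at $0$, with $H_\ell(0)=0$, $M\not\equiv0$. Each of the $G_\ell$, $H_\ell$ (generic name $f$) has a finite radius of convergence $\rho_f$, $z=\rho_f$ is its only singularity on $|z|\le\rho_f$, it is analytic in a domain $\{|z|<\rho_f+\varepsilon,\ |\arg(z-\rho_f)|>\theta\}$ for some $\varepsilon>0$, $0<\theta<\pi/2$, and there, as $z\to\rho_f$, $f(z)=P_f(1-z/\rho_f)+c_f(1-z/\rho_f)^{\lambda_f}(1+o(1))$ with $c_f\neq0$, where $P_f=0$ if the singular exponent $\lambda_f$ is negative and $P_f$ is the constant $\tau_f=f(\rho_f)$ if $0<\lambda_f<1$. $M$ has radius of convergence $\rho_M$. Critical: all $H_\ell$ have the same radius of convergence $\rho_H$, $\tau_{H_\ell}=H_\ell(\rho_H)=\rho_{G_\ell}$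 for all $\ell$, and $\rho_M\ge\rho_H$. Pure: $0<\lambda_{H_\ell}<1$ and $\lambda_{G_\ell}<0$ for all $1\le\ell\le m$; and either $\rho_M=\rho_H$, $z=\rho_H$ is the only singularity of $M$ on $|z|\le\rho_H$, $M$ is analytic in a domain $\{|z|<\rho_H+\varepsilon,\ |\arg(z-\rho_H)|>\theta\}$ for some $\varepsilon>0$, $0<\theta<\pi/2$, and there, as $z\to\rho_H$, $M(z)=c_M(1-z/\rho_H)^{\lambda_M}(1+o(1))$ with $c_M\neq0$ and singular exponent $\lambda_M<0$, or $M$ is analytic at $\rho_H$ (i.e. $\rho_M>\rho_H$), in which case $\lambda_M:=0$ in all formulas (and a Dirichlet law with last parameter $0$ means $W_{m+1}=0$ and $(W_1,\dots,W_m)$ Dirichlet with the remaining parameters). $\mathrm{ML}(\alpha,\beta)$, $\alpha\in(0,1)$, $\beta>-\alpha$: the law on $(0,\infty)$ determined by the moments $\frac{\Gamma(s+\beta/\alpha+1)\Gamma(\beta+1)}{\Gamma(\alpha s+\beta+1)\Gamma(\beta/\alpha+1)}$. *)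

theory Defs
  imports
    "HOL-Probability.Probability"
    "HOL-Library.Landau_Symbols"
    "HOL-Library.Poly_Mapping"
begin

section \<open>The extended composition scheme\<close>

definition map_coeffs :: "('a \<Rightarrow> 'b) \<Rightarrow> 'a fps \<Rightarrow> 'b fps" where
  "map_coeffs h f = Abs_fps (\<lambda>n. h (fps_nth f n))"

text \<open>
  The series \<open>M(z) \<Prod>\<^sub>l G\<^sub>l(u\<^sub>l H\<^sub>l(z))\<close> in \<open>z\<close>, for values \<open>u\<^sub>l\<close> in a commutative
  semiring into which the real coefficients are embedded by \<open>\<iota>\<close>.
\<close>
definition composition_scheme ::
    "(real \<Rightarrow> 'a::comm_semiring_1) \<Rightarrow> real fps \<Rightarrow> ('m::finite \<Rightarrow> real fps) \<Rightarrow> ('m \<Rightarrow> real fps)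
      \<Rightarrow> ('m \<Rightarrow> 'a) \<Rightarrow> 'a fps" where
  "composition_scheme \<iota> M G H u =
     map_coeffs \<iota> M *
     (\<Prod>l\<in>UNIV. fps_compose (map_coeffs \<iota> (G l)) (fps_const (u l) * map_coeffs \<iota> (H l)))"

text \<open>
  \<open>('m \<Rightarrow>\<^sub>0 nat) \<Rightarrow>\<^sub>0 real\<close> is the ring of real polynomials in variables indexed by \<open>'m\<close>. Every
  coefficient of \<open>z\<^sup>n\<close> in \<open>F(z,u)\<close> is such a polynomial, because \<open>H\<^sub>l(0) = 0\<close>.
\<close>
definition scheme_coeff ::
    "real fps \<Rightarrow> ('m::finite \<Rightarrow> real fps) \<Rightarrow> ('m \<Rightarrow> real fps) \<Rightarrow> nat \<Rightarrow> ('m \<Rightarrow> nat) \<Rightarrow> real" where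
  "scheme_coeff M G H n k =
     Poly_Mapping.lookup
       (fps_nth (composition_scheme (Poly_Mapping.single 0) M G H
                   (\<lambda>l. Poly_Mapping.single (Poly_Mapping.single l 1) 1
                          :: ('m \<Rightarrow>\<^sub>0 nat) \<Rightarrow>\<^sub>0 real)) n)
       (Poly_Mapping.Abs_poly_mapping k)"

definition scheme_total ::
    "real fps \<Rightarrow> ('m::finite \<Rightarrow> real fps) \<Rightarrow> ('m \<Rightarrow> real fps) \<Rightarrow> nat \<Rightarrow> real" where
  "scheme_total M G H n = fps_nth (composition_scheme (\<lambda>c. c) M G H (\<lambda>_. 1)) n"

section \<open>Singular behaviour of the series\<close>

definition delta_domain :: "real \<Rightarrow> real \<Rightarrow> real \<Rightarrow> complex set" where
  "delta_domain \<rho> \<epsilon> \<theta> =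
     {z. norm z < \<rho> + \<epsilon> \<and> \<bar>Arg (z - complex_of_real \<rho>)\<bar> > \<theta>}"

text \<open>
  \<open>singular_at f \<rho> lam c\<close>: the series \<open>f\<close> has finite radius of convergence \<open>\<rho>\<close>, continues
  analytically (as \<open>\<phi>\<close>) to a domain \<open>delta_domain \<rho> \<epsilon> \<theta>\<close>, and there
  \<open>f(z) = P + c (1 - z/\<rho>)\<^bsup>lam\<^esup> (1 + o(1))\<close> as \<open>z\<close> tends to \<open>\<rho>\<close>, with \<open>P = 0\<close> if \<open>lam < 0\<close> and
  \<open>P = f(\<rho>)\<close> if \<open>0 < lam < 1\<close>; no other exponent is used. As \<open>\<theta> < \<pi>/2\<close>, the domain contains
  every point of the closed disc \<open>\<bar>z\<bar> \<le> \<rho>\<close> except \<open>\<rho>\<close>, so \<open>\<rho>\<close> is the only singularity there (it is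
  one, since \<open>\<rho>\<close> is the radius of convergence). Since \<open>Arg 0 = 0\<close>, the point \<open>\<rho>\<close> is not in the
  domain. The constant \<open>c\<close> is real because \<open>f\<close> has real coefficients.
\<close>
definition singular_at :: "real fps \<Rightarrow> real \<Rightarrow> real \<Rightarrow> real \<Rightarrow> bool" where
  "singular_at f \<rho> lam c \<longleftrightarrow>
     0 < \<rho> \<and> fps_conv_radius f = ereal \<rho> \<and> c \<noteq> 0 \<and>
     (\<exists>\<epsilon> \<theta> \<phi>. 0 < \<epsilon> \<and> 0 < \<theta> \<and> \<theta> < pi / 2 \<and>
        \<phi> analytic_on delta_domain \<rho> \<epsilon> \<theta> \<and>
        (\<forall>z. norm z < \<rho> \<longrightarrow> \<phi> z = eval_fps (map_coeffs complex_of_real f) z) \<and>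
        (\<lambda>z. \<phi> z - complex_of_real (if lam < 0 then 0 else eval_fps f \<rho>))
          \<sim>[at (complex_of_real \<rho>) within delta_domain \<rho> \<epsilon> \<theta>]
        (\<lambda>z. complex_of_real c * (1 - z / complex_of_real \<rho>) powr complex_of_real lam))"

section \<open>Laws\<close>

definition mittag_leffler :: "real \<Rightarrow> real \<Rightarrow> real measure \<Rightarrow> bool" where
  "mittag_leffler \<alpha> \<beta> N \<longleftrightarrow>
     prob_space N \<and> sets N = sets borel \<and> (AE x in N. 0 < x) \<and>
     (\<forall>s::nat. integrable N (\<lambda>x. x ^ s) \<and>
        (\<integral>x. x ^ s \<partial>N) =
          Gamma (real s + \<beta> / \<alpha> + 1) * Gamma (\<beta> + 1) /
          (Gamma (\<alpha> * real s + \<beta> + 1) * Gamma (\<beta> / \<alpha> + 1)))"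

text \<open>
  \<open>W\<close> is Dirichlet distributed with parameters \<open>a\<^sub>i \<ge> 0\<close>, not all zero: coordinates with parameter
  \<open>0\<close> vanish, the coordinates sum to \<open>1\<close>, and after one coordinate \<open>j\<close> with positive parameter
  is eliminated, the others have the usual density with respect to Lebesgue measure. By symmetry
  the choice of \<open>j\<close> is immaterial. If only \<open>a\<^sub>j\<close> is positive, then \<open>W\<^sub>j = 1\<close>.
\<close>
definition dirichlet :: "'w measure \<Rightarrow> ('k::finite \<Rightarrow> real) \<Rightarrow> ('w \<Rightarrow> real ^ 'k) \<Rightarrow> bool" where
  "dirichlet \<Omega> a W \<longleftrightarrow>
     W \<in> borel_measurable \<Omega> \<and>
     (\<forall>i. a i \<ge> 0) \<and>
     (\<forall>i. a i = 0 \<longrightarrow> (AE \<omega> in \<Omega>. W \<omega> $ i = 0)) \<and>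
     (AE \<omega> in \<Omega>. (\<Sum>i\<in>UNIV. W \<omega> $ i) = 1) \<and>
     (\<exists>j. a j > 0 \<and>
        (let I = {i. a i > 0}; J = I - {j} in
          distributed \<Omega> (PiM J (\<lambda>_. lborel)) (\<lambda>\<omega>. \<lambda>i\<in>J. W \<omega> $ i)
            (\<lambda>x. if (\<forall>i\<in>J. 0 < x i) \<and> (\<Sum>i\<in>J. x i) < 1
                 then ennreal (Gamma (\<Sum>i\<in>I. a i) / (\<Prod>i\<in>I. Gamma (a i)) *
                        (\<Prod>i\<in>J. x i powr (a i - 1)) * (1 - (\<Sum>i\<in>J. x i)) powr (a j - 1))
                 else 0)))"

text \<open>
  Convergence in distribution on a topological space (the library notion \<open>weak_conv_m\<close> covers the real
  line only).
\<close>
definition converges_in_law ::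
    "(nat \<Rightarrow> 'a::topological_space measure) \<Rightarrow> 'a measure \<Rightarrow> bool" where
  "converges_in_law P Q \<longleftrightarrow>
     (\<forall>f::'a \<Rightarrow> real. continuous_on UNIV f \<longrightarrow> bounded (range f) \<longrightarrow>
        (\<lambda>n. \<integral>x. f x \<partial>P n) \<longlonglongrightarrow> (\<integral>x. f x \<partial>Q))"

definition has_moments :: "(real ^ 'm::finite) measure \<Rightarrow> (('m \<Rightarrow> nat) \<Rightarrow> real) \<Rightarrow> bool" where
  "has_moments P \<mu> \<longleftrightarrow>
     prob_space P \<and> sets P = sets borel \<and>
     (\<forall>s. integrable P (\<lambda>x. \<Prod>l\<in>UNIV. (x $ l) ^ s l) \<and>
          (\<integral>x. (\<Prod>l\<in>UNIV. (x $ l) ^ s l) \<partial>P) = \<mu> s)"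

section \<open>The limit\<close>

definition limit_moment ::
    "('m::finite \<Rightarrow> real) \<Rightarrow> ('m \<Rightarrow> real) \<Rightarrow> real \<Rightarrow> ('m \<Rightarrow> nat) \<Rightarrow> real" where
  "limit_moment lamG lamH lamM s =
     Gamma (- (\<Sum>l\<in>UNIV. lamG l * lamH l) - lamM) /
     Gamma ((\<Sum>l\<in>UNIV. real (s l) * lamH l) - (\<Sum>l\<in>UNIV. lamG l * lamH l) - lamM) *
     (\<Prod>l\<in>UNIV. Gamma (real (s l) - lamG l) / Gamma (- lamG l))"

text \<open>
  The index type \<open>'m option\<close> of \<open>W\<close> has \<open>m + 1\<close> elements; \<open>None\<close> is the last index \<open>m + 1\<close>.
  Independence of \<open>V\<close> and \<open>W\<close> is stated for the generated \<open>\<sigma>\<close>-algebras, as \<open>indep_var\<close> requires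
  random variables with values in the same type.
\<close>
definition limit_variables ::
    "('m::finite \<Rightarrow> real) \<Rightarrow> ('m \<Rightarrow> real) \<Rightarrow> real \<Rightarrow>
     'w measure \<Rightarrow> ('w \<Rightarrow> real ^ 'm) \<Rightarrow> ('w \<Rightarrow> real ^ ('m option)) \<Rightarrow> bool" where
  "limit_variables lamG lamH lamM \<Omega> V W \<longleftrightarrow>
     prob_space \<Omega> \<and>
     dirichlet \<Omega> (\<lambda>i. case i of None \<Rightarrow> - lamM | Some l \<Rightarrow> - lamG l * lamH l) W \<and>
     V \<in> borel_measurable \<Omega> \<and>
     (\<forall>l. mittag_leffler (lamH l) (- lamG l * lamH l) (distr \<Omega> borel (\<lambda>\<omega>. V \<omega> $ l))) \<and>
     prob_space.indep_vars \<Omega> (\<lambda>_. borel) (\<lambda>l \<omega>. V \<omega> $ l) UNIV \<and>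
     prob_space.indep_set \<Omega> (sets (vimage_algebra (space \<Omega>) V borel))
                          (sets (vimage_algebra (space \<Omega>) W borel))"

definition limit_law ::
    "('m::finite \<Rightarrow> real) \<Rightarrow> 'w measure \<Rightarrow> ('w \<Rightarrow> real ^ 'm) \<Rightarrow> ('w \<Rightarrow> real ^ ('m option)) \<Rightarrow>
     (real ^ 'm) measure" where
  "limit_law lamH \<Omega> V W =
     distr \<Omega> borel (\<lambda>\<omega>. \<chi> l. V \<omega> $ l * (W \<omega> $ Some l) powr lamH l)"

end

theory Submission
  imports Defs "HOL-Complex_Analysis.Complex_Analysis" "HOL-Real_Asymp.Real_Asymp"
begin

text \<open>
  Multiplying the \<open>k\<close>-th coefficient of \<open>G\<^sub>l\<close> by \<open>k\<^sup>s\<close>, that is, applying \<open>(z d/dz)\<^sup>s\<close> to \<open>G\<^sub>l\<close>, turns the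
  numerator of a joint moment into the coefficient of a scheme of the same kind, in which the singular
  exponent \<open>\<lambda>\<close> of \<open>G\<^sub>l\<close> is replaced by \<open>\<lambda> - s\<close>. So the moments follow from the asymptotics
  \<open>[z\<^sup>n] F \<sim> C \<rho>\<^bsup>-n\<^esup> n\<^bsup>-L-1\<^esup> / \<Gamma>(-L)\<close> of a single coefficient. For this transfer it suffices to know \<open>F\<close> and
  \<open>F'\<close> inside the disc of convergence.

  Convergence in law follows from convergence of the moments through the Laplace transform, as the
  limit moments grow at most like \<open>s!\<close> divided by a Gamma factor. The Mittag-Leffler law exists because it
  is the limit law of a scheme with \<open>m = 1\<close> and \<open>M = 1\<close>, and the moments of \<open>V\<^sub>l W\<^sub>l\<^bsup>\<lambda>\<^esup>\<close> are those of the limit.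
\<close>

section \<open>Singularities of power series\<close>

text \<open>The obstacle on the analytic side is the rest of the circle. Elsewhere on
  \<open>\<bar>z\<bar> = \<rho>\<close> an \<open>H l\<close> could reach the value
  \<open>\<tau> l\<close>, where \<open>G l\<close> is singular, and then a second point would
  contribute. That \<open>\<rho>\<close> is the only singularity of \<open>H l\<close> and that its
  exponent is below \<open>1\<close> exclude this.

  The parts of the limit moments have separate origins. Repeated \<open>z d/dz\<close> on a power of
  exponent \<open>lamG l\<close> gives the rising factorials
  \<open>Gamma (s - lamG) / Gamma (- lamG)\<close>; the lowered exponents change the Gamma factor of
  the transfer and give the powers of \<open>n\<close>; the leading term of
  \<open>1 - H l / \<tau> l\<close> gives \<open>\<kappa> l\<close>.

  On the side of the limit, write \<open>a = - lamG l * lamH l\<close> and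
  \<open>r = s l * lamH l\<close>. The moment of \<open>V l\<close> contains
  \<open>Gamma a / Gamma (a + r)\<close>, and coordinate \<open>l\<close> of the mixed Dirichlet
  moment contains the reciprocal. After cancellation only the rising factorials and the Gamma
  quotient of the parameter sums remain. This is why the parameters of the two laws are
  coupled.\<close>

text \<open>
  The opening of this domain at \<open>\<rho>\<close> is strictly larger than a half plane, so every point \<open>z\<close> of the
  disc near \<open>\<rho>\<close> is the centre of a ball of radius proportional to \<open>\<bar>z - \<rho>\<bar>\<close>. So the Cauchy
  estimates pass asymptotic expansions on to derivatives.
\<close>

definition cone_domain :: "real \<Rightarrow> real \<Rightarrow> real \<Rightarrow> complex set" where
  "cone_domain \<rho> \<epsilon> \<sigma> =
     {z. norm z < \<rho> + \<epsilon> \<and> Re (z - of_real \<rho>) < \<sigma> * norm (z - of_real \<rho>)}"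

lemma open_cone_domain: "open (cone_domain \<rho> \<epsilon> \<sigma>)"
  unfolding cone_domain_def by (intro open_Collect_conj open_Collect_less continuous_intros)

lemma cone_domain_mono: "\<sigma> \<le> \<sigma>' \<Longrightarrow> cone_domain \<rho> \<epsilon> \<sigma> \<subseteq> cone_domain \<rho> \<epsilon> \<sigma>'"
  unfolding cone_domain_def using mult_right_mono[of \<sigma> \<sigma>'] by (fastforce intro: less_le_trans)

text \<open>For \<open>u \<noteq> 0\<close> the cone condition reads
  \<open>cos (Arg u) < cos \<theta>\<close>, and the cosine decreases on \<open>[0, pi]\<close>. The
  vertex is excluded automatically, since \<open>0 < 0\<close> fails. Replacing \<open>Arg\<close>
  by a continuous inequality makes openness immediate.\<close>

lemma cone_domain_subset_delta_domain:
  assumes "0 < \<theta>" "\<theta> < pi"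
  shows "cone_domain \<rho> \<epsilon> (cos \<theta>) \<subseteq> delta_domain \<rho> \<epsilon> \<theta>"
proof
  fix z assume z: "z \<in> cone_domain \<rho> \<epsilon> (cos \<theta>)"
  define u where "u = z - of_real \<rho>"
  have u: "Re u < cos \<theta> * norm u" "norm z < \<rho> + \<epsilon>" using z by (auto simp: cone_domain_def u_def)
  have "u \<noteq> 0" using u by auto
  have "cos (Arg u) = Re u / norm u"
    using cis_Arg[OF \<open>u \<noteq> 0\<close>] by (metis Re_sgn cis.sel(1))
  also have "\<dots> < cos \<theta>" using u \<open>u \<noteq> 0\<close> by (simp add: divide_simps)
  finally have "cos \<bar>Arg u\<bar> < cos \<theta>" by (simp add: abs_if)
  then have "\<bar>Arg u\<bar> > \<theta>"
    using cos_monotone_0_pi_le[of "\<bar>Arg u\<bar>" \<theta>] assms by force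
  then show "z \<in> delta_domain \<rho> \<epsilon> \<theta>" using u by (auto simp: delta_domain_def u_def)
qed

lemma closed_disc_subset_cone_domain:
  assumes "0 < \<epsilon>" "0 < \<sigma>" "0 < \<rho>" "norm z \<le> \<rho>" "z \<noteq> of_real \<rho>"
  shows "z \<in> cone_domain \<rho> \<epsilon> \<sigma>"
proof -
  have "Re z \<le> \<rho>" using complex_Re_le_cmod[of z] assms by linarith
  moreover have "norm (z - of_real \<rho>) > 0" using assms by simp
  ultimately show ?thesis unfolding cone_domain_def using assms
    by (auto intro!: le_less_trans[of "Re z - \<rho>" 0])
qed

text \<open>The bad points form the real ray \<open>z \<ge> \<rho>\<close>, on which real part and
  modulus of \<open>z - \<rho>\<close> agree, and this contradicts \<open>\<sigma> < 1\<close>.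
  Hence principal powers of \<open>1 - z / \<rho>\<close> are holomorphic on the cone.\<close>

lemma cone_domain_slit:
  assumes "z \<in> cone_domain \<rho> \<epsilon> \<sigma>" "\<sigma> < 1" "0 < \<rho>"
  shows "1 - z / of_real \<rho> \<notin> \<real>\<^sub>\<le>\<^sub>0"
proof
  assume "1 - z / of_real \<rho> \<in> \<real>\<^sub>\<le>\<^sub>0"
  then obtain x where x: "x \<le> 0" "1 - z / of_real \<rho> = of_real x"
    by (metis nonpos_Reals_cases)
  have "z - of_real \<rho> = of_real (- x * \<rho>)" using x(2) assms(3)
    by (simp add: field_simps)
  moreover have "- x * \<rho> \<ge> 0" using x assms by (simp add: mult_nonpos_nonneg)
  ultimately have "Re (z - of_real \<rho>) = norm (z - of_real \<rho>)" by (simp only: norm_of_real Re_complex_of_real)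
  moreover have "norm (z - of_real \<rho>) < \<sigma> * norm (z - of_real \<rho>)"
    using assms calculation unfolding cone_domain_def by simp
  ultimately show False using assms
    by (smt (verit) mult_left_le_one_le mult_less_cancel_right1 norm_ge_zero)
qed

definition cone_sing :: "real fps \<Rightarrow> real \<Rightarrow> real \<Rightarrow> real \<Rightarrow> real \<Rightarrow> bool" where
  "cone_sing f \<rho> P lam c \<longleftrightarrow> 0 < \<rho> \<and> ereal \<rho> \<le> fps_conv_radius f \<and>
     (\<exists>\<epsilon> \<sigma> \<phi>. 0 < \<epsilon> \<and> 0 < \<sigma> \<and> \<sigma> < 1 \<and> \<phi> holomorphic_on cone_domain \<rho> \<epsilon> \<sigma> \<and>
        (\<forall>z\<in>ball 0 \<rho>. \<phi> z = eval_fps (map_coeffs complex_of_real f) z) \<and>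
        ((\<lambda>z. (\<phi> z - of_real P) * (1 - z / of_real \<rho>) powr of_real (- lam)) \<longlongrightarrow> of_real c)
          (at (of_real \<rho>) within cone_domain \<rho> \<epsilon> \<sigma>))"

lemma singular_at_imp_cone_sing:
  assumes "singular_at f \<rho> lam c"
  shows "cone_sing f \<rho> (if lam < 0 then 0 else eval_fps f \<rho>) lam c"
proof -
  define P where "P = (if lam < 0 then 0 else eval_fps f \<rho>)"
  obtain \<epsilon> \<theta> \<phi> where *: "0 < \<epsilon>" "0 < \<theta>" "\<theta> < pi / 2" "\<phi> analytic_on delta_domain \<rho> \<epsilon> \<theta>"
    "\<forall>z. norm z < \<rho> \<longrightarrow> \<phi> z = eval_fps (map_coeffs complex_of_real f) z"
    "(\<lambda>z. \<phi> z - complex_of_real P)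
          \<sim>[at (complex_of_real \<rho>) within delta_domain \<rho> \<epsilon> \<theta>]
        (\<lambda>z. complex_of_real c * (1 - z / complex_of_real \<rho>) powr complex_of_real lam)"
    and \<rho>: "0 < \<rho>" "fps_conv_radius f = ereal \<rho>" "c \<noteq> 0"
    using assms unfolding singular_at_def P_def by blast
  define K where "K = cone_domain \<rho> \<epsilon> (cos \<theta>)"
  have \<sigma>: "0 < cos \<theta>" "cos \<theta> < 1" using * cos_gt_zero[of \<theta>] cos_monotone_0_pi[of 0 \<theta>] by auto
  have K: "K \<subseteq> delta_domain \<rho> \<epsilon> \<theta>"
    unfolding K_def using cone_domain_subset_delta_domain * by (simp add: pi_gt_zero)
  let ?y = "\<lambda>z. 1 - z / complex_of_real \<rho>"
  let ?g = "\<lambda>z. complex_of_real c * ?y z powr complex_of_real lam"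
  \<comment> \<open>Asymptotic equivalence is defined by a quotient with the convention
    \<open>0 / 0 = 1\<close>. The comparison function has no zero on the cone, so the convention
    disappears below.\<close>
  have "((\<lambda>z. (if \<phi> z - of_real P = 0 \<and> ?g z = 0 then 1 else (\<phi> z - of_real P) / ?g z) * of_real c)
       \<longlongrightarrow> 1 * of_real c) (at (of_real \<rho>) within K)"
    by (intro tendsto_mult tendsto_const tendsto_mono[OF at_le[OF K]])
       (use *(6) in \<open>simp add: asymp_equiv_def\<close>)
  moreover have "\<forall>\<^sub>F z in at (of_real \<rho>) within K.
      (if \<phi> z - of_real P = 0 \<and> ?g z = 0 then 1 else (\<phi> z - of_real P) / ?g z) * of_real c
       = (\<phi> z - of_real P) * ?y z powr of_real (- lam)"
    unfolding eventually_at_filter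
  proof (rule always_eventually, safe)
    fix z assume "z \<in> K"
    then have "?y z \<noteq> 0" using cone_domain_slit[of z \<rho> \<epsilon> "cos \<theta>"] \<sigma> \<rho> unfolding K_def by force
    then show "(if \<phi> z - of_real P = 0 \<and> ?g z = 0 then 1 else (\<phi> z - of_real P) / ?g z) * of_real c
       = (\<phi> z - of_real P) * ?y z powr of_real (- lam)"
      using \<rho> by (simp add: powr_minus divide_simps)
  qed
  ultimately have "((\<lambda>z. (\<phi> z - of_real P) * ?y z powr of_real (- lam)) \<longlongrightarrow> of_real c) (at (of_real \<rho>) within K)"
    using filterlim_cong by fastforce
  moreover have "\<phi> holomorphic_on K" using *(4) K analytic_imp_holomorphic holomorphic_on_subset by blast
  ultimately show ?thesis unfolding cone_sing_def P_def[symmetric]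
    using * \<rho> \<sigma> unfolding K_def
    by (intro conjI exI[of _ \<epsilon>] exI[of _ "cos \<theta>"] exI[of _ \<phi>]) auto
qed

text \<open>After subtraction of the main term the rest is \<open>o(\<bar>y\<bar> powr lam)\<close>
  with \<open>y = 1 - z / \<rho>\<close>. Cauchy's inequality on a ball of radius proportional to
  \<open>\<bar>z - \<rho>\<bar>\<close> costs one factor \<open>\<bar>y\<bar>\<close>. Halving
  \<open>\<sigma>\<close> leaves room for these balls inside the original cone.\<close>

lemma deriv_tendsto_cone:
  fixes \<phi> :: "complex \<Rightarrow> complex"
  assumes \<rho>: "0 < \<rho>" and \<epsilon>: "0 < \<epsilon>" and \<sigma>: "0 < \<sigma>" "\<sigma> < 1"
    and hol: "\<phi> holomorphic_on cone_domain \<rho> \<epsilon> \<sigma>"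
    and lim: "((\<lambda>z. (\<phi> z - P) * (1 - z / of_real \<rho>) powr of_real (- lam)) \<longlongrightarrow> c)
          (at (of_real \<rho>) within cone_domain \<rho> \<epsilon> \<sigma>)"
  shows "((\<lambda>z. deriv \<phi> z * (1 - z / of_real \<rho>) powr of_real (1 - lam)) \<longlongrightarrow> - of_real lam * c / of_real \<rho>)
          (at (of_real \<rho>) within cone_domain \<rho> \<epsilon> (\<sigma> / 2))"
proof -
  define K where "K = cone_domain \<rho> \<epsilon> \<sigma>"
  define K' where "K' = cone_domain \<rho> \<epsilon> (\<sigma> / 2)"
  define y where "y z = 1 - z / complex_of_real \<rho>" for z
  define \<psi> where "\<psi> z = \<phi> z - P - c * y z powr of_real lam" for z
  \<comment> \<open>The ball of radius \<open>\<eta> * u\<close>,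
    \<open>u = \<bar>z - \<rho>\<bar>\<close>, stays in the cone if
    \<open>\<sigma> / 2 + \<eta> \<le> \<sigma> * (1 - \<eta>)\<close>; the value
    \<open>\<sigma> / 8\<close> satisfies this because \<open>\<sigma> < 1\<close>.\<close>
  define \<eta> where "\<eta> = \<sigma> / 8"
  have \<eta>: "0 < \<eta>" "\<eta> < 1" using \<sigma> by (auto simp: \<eta>_def)
  \<comment> \<open>On that ball \<open>\<bar>y\<bar>\<close> changes by a factor between
    \<open>1 - \<eta>\<close> and \<open>1 + \<eta>\<close>; the sum covers both signs of
    \<open>lam\<close>.\<close>
  define B where "B = (1 - \<eta>) powr lam + (1 + \<eta>) powr lam"
  have B: "B > 0" unfolding B_def using \<eta> by (intro add_pos_pos) auto
  have KK: "K' \<subseteq> K" unfolding K_def K'_def by (rule cone_domain_mono) (use \<sigma> in auto)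
  have opK: "open K" unfolding K_def by (rule open_cone_domain)
  have slit: "y z \<notin> \<real>\<^sub>\<le>\<^sub>0" if "z \<in> K" for z
    using cone_domain_slit[of z \<rho> \<epsilon> \<sigma>] that \<sigma> \<rho> by (auto simp: K_def y_def)
  have y0: "y z \<noteq> 0" if "z \<in> K" for z using slit[OF that] by auto
  have normy: "norm (z - of_real \<rho>) = \<rho> * norm (y z)" for z
  proof -
    have "z - of_real \<rho> = - of_real \<rho> * y z" using \<rho> by (simp add: y_def field_simps)
    then show ?thesis using \<rho> by (simp add: norm_mult)
  qed
  have yd: "((\<lambda>z. y z powr of_real lam) has_field_derivative - (of_real lam * y z powr of_real (lam - 1)) / of_real \<rho>) (at z)"
    if "z \<in> K" for z
    unfolding y_def using slit[OF that] \<rho>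
    by (auto intro!: derivative_eq_intros simp: y_def)
  have hol\<psi>: "\<psi> holomorphic_on K"
    unfolding \<psi>_def y_def using hol slit \<rho> unfolding K_def y_def
    by (intro holomorphic_intros) auto
  have d\<psi>: "deriv \<psi> z = deriv \<phi> z + c * of_real lam * y z powr of_real (lam - 1) / of_real \<rho>" if "z \<in> K" for z
  proof (rule DERIV_imp_deriv)
    have "(\<phi> has_field_derivative deriv \<phi> z) (at z)"
      using hol that opK K_def holomorphic_derivI by blast
    then show "(\<psi> has_field_derivative deriv \<phi> z + c * of_real lam * y z powr of_real (lam - 1) / of_real \<rho>) (at z)"
      unfolding \<psi>_def
      by (rule DERIV_diff[OF DERIV_diff[OF _ DERIV_const] DERIV_cmult[OF yd[OF that]], THEN DERIV_cong])
        (simp_all add: mult.assoc)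
  qed
  have lim0: "((\<lambda>z. \<psi> z * y z powr of_real (- lam)) \<longlongrightarrow> 0) (at (of_real \<rho>) within K)"
  proof -
    have "((\<lambda>z. (\<phi> z - P) * y z powr of_real (- lam) - c) \<longlongrightarrow> c - c) (at (of_real \<rho>) within K)"
      using lim unfolding K_def y_def by (intro tendsto_intros)
    moreover have "\<forall>\<^sub>F z in at (of_real \<rho>) within K.
       (\<phi> z - P) * y z powr of_real (- lam) - c = \<psi> z * y z powr of_real (- lam)"
      unfolding eventually_at_filter
      by (rule always_eventually) (use y0 in \<open>auto simp: \<psi>_def powr_minus field_simps\<close>)
    ultimately show ?thesis using filterlim_cong by fastforce
  qed
  have "((\<lambda>z. deriv \<psi> z * y z powr of_real (1 - lam)) \<longlongrightarrow> 0) (at (of_real \<rho>) within K')"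
  proof (rule tendstoI)
    fix e :: real assume e: "0 < e"
    \<comment> \<open>Chosen so that the Cauchy estimate below gives exactly
      \<open>e / 2\<close>.\<close>
    define e' where "e' = e * \<eta> * \<rho> / (2 * B)"
    have e': "e' > 0" using e \<eta> \<rho> B by (simp add: e'_def)
    obtain d where d: "d > 0" "\<And>w. w \<in> K \<Longrightarrow> w \<noteq> of_real \<rho> \<Longrightarrow> dist w (of_real \<rho>) < d \<Longrightarrow>
        norm (\<psi> w * y w powr of_real (- lam)) < e'"
      using tendstoD[OF lim0 e'] unfolding eventually_at by (auto simp: dist_norm)
    have bd: "norm (\<psi> w) \<le> e' * norm (y w) powr lam" if "w \<in> K" "norm (w - of_real \<rho>) < d" for w
    proof -
      have "w \<noteq> of_real \<rho>" using y0[OF that(1)] \<rho> by (auto simp: y_def)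
      then have "norm (\<psi> w) * norm (y w) powr (- lam) < e'"
        using d(2)[OF that(1)] that by (simp add: dist_norm norm_mult norm_powr_real_powr')
      then show ?thesis using y0[OF that(1)] by (simp add: powr_minus divide_simps)
    qed
    \<comment> \<open>\<open>d / 2\<close> keeps the ball in the range where the limit is effective,
      \<open>\<epsilon> / 4\<close> keeps it below the radius
      \<open>\<rho> + \<epsilon>\<close>.\<close>
    define d' where "d' = min (d / 2) (min \<rho> (\<epsilon> / 4))"
    have "d' > 0" using d \<epsilon> \<rho> by (auto simp: d'_def)
    moreover have "dist (deriv \<psi> z * y z powr of_real (1 - lam)) 0 < e"
      if z: "z \<in> K'" "z \<noteq> of_real \<rho>" "dist z (of_real \<rho>) < d'" for z
    proof -
      have zK: "z \<in> K" using z KK by auto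
      define u where "u = norm (z - of_real \<rho>)"
      have u: "u > 0" "u < d'" using z by (auto simp: u_def dist_norm)
      have zc: "Re (z - of_real \<rho>) < \<sigma> / 2 * u" using z(1) unfolding K'_def cone_domain_def u_def by simp
      have w: "w \<in> K \<and> norm (w - of_real \<rho>) \<le> (1 + \<eta>) * u \<and> norm (w - of_real \<rho>) \<ge> (1 - \<eta>) * u"
        if "norm (z - w) \<le> \<eta> * u" for w
      proof -
        have a: "norm (w - of_real \<rho>) \<ge> u - \<eta> * u" "norm (w - of_real \<rho>) \<le> u + \<eta> * u"
          unfolding u_def using that norm_triangle_ineq2[of "z - of_real \<rho>" "z - w"]
            norm_triangle_ineq[of "z - of_real \<rho>" "w - z"] unfolding u_def
          by (auto simp: norm_minus_commute)
        have "Re (w - of_real \<rho>) \<le> Re (z - of_real \<rho>) + \<eta> * u"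
          using that abs_Re_le_cmod[of "z - w"] by auto
        also have "\<dots> < \<sigma> / 2 * u + \<eta> * u" using zc by simp
        also have "\<dots> \<le> \<sigma> * (u - \<eta> * u)"
        proof -
          have "\<sigma> / 2 + \<eta> \<le> \<sigma> * (1 - \<eta>)"
            unfolding \<eta>_def using mult_strict_left_mono[OF \<sigma>(2) \<sigma>(1)] \<sigma> by (simp add: field_simps power2_eq_square)
          then have "(\<sigma> / 2 + \<eta>) * u \<le> \<sigma> * (1 - \<eta>) * u" using u by (intro mult_right_mono) auto
          then show ?thesis by (simp add: algebra_simps)
        qed
        also have "\<dots> \<le> \<sigma> * norm (w - of_real \<rho>)" using a \<sigma> by simp
        finally have 1: "Re (w - of_real \<rho>) < \<sigma> * norm (w - of_real \<rho>)" .
        have "norm w \<le> norm (w - of_real \<rho>) + norm (complex_of_real \<rho>)"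
          by (metis diff_add_cancel norm_triangle_ineq)
        also have "\<dots> \<le> u + \<eta> * u + \<rho>" using a \<rho> by simp
        also have "\<dots> \<le> 2 * u + \<rho>" using \<eta> u by simp
        also have "\<dots> < \<rho> + \<epsilon>" using u \<epsilon> unfolding d'_def by auto
        finally show ?thesis using 1 a unfolding K_def cone_domain_def by (simp add: algebra_simps)
      qed
      have "norm ((deriv ^^ 1) \<psi> z) \<le> fact 1 * (e' * (B * norm (y z) powr lam)) / (\<eta> * u) ^ 1"
      proof (rule Cauchy_inequality)
        have sub: "cball z (\<eta> * u) \<subseteq> K" using w by (auto simp: dist_norm)
        then show "\<psi> holomorphic_on ball z (\<eta> * u)"
          using hol\<psi> holomorphic_on_subset ball_subset_cball by blast
        show "continuous_on (cball z (\<eta> * u)) \<psi>"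
          using hol\<psi> sub holomorphic_on_imp_continuous_on continuous_on_subset by blast
        show "0 < \<eta> * u" using \<eta> u by simp
        fix w assume "norm (z - w) = \<eta> * u"
        note w = w[OF eq_refl[OF this]]
        have "norm (w - of_real \<rho>) < d"
        proof -
          have "(1 + \<eta>) * u \<le> 2 * u" using \<eta> u by (intro mult_right_mono) auto
          with w have "norm (w - of_real \<rho>) \<le> 2 * u" by linarith
          then show ?thesis using u unfolding d'_def by simp
        qed
        then have "norm (\<psi> w) \<le> e' * norm (y w) powr lam" using bd w by auto
        also have "norm (y w) powr lam \<le> B * norm (y z) powr lam"
        proof -
          have lo: "(1 - \<eta>) * norm (y z) \<le> norm (y w)" and hi: "norm (y w) \<le> (1 + \<eta>) * norm (y z)"
            using w \<rho> unfolding u_def normy mult.left_commute[of _ \<rho>] by simp_all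
          have yz: "norm (y z) > 0" using y0[OF zK] by simp
          show ?thesis
          proof (cases "lam \<ge> 0")
            case True
            then have "norm (y w) powr lam \<le> ((1 + \<eta>) * norm (y z)) powr lam"
              using hi by (intro powr_mono2) auto
            also have "\<dots> = (1 + \<eta>) powr lam * norm (y z) powr lam" using \<eta> by (simp add: powr_mult)
            also have "\<dots> \<le> B * norm (y z) powr lam" unfolding B_def by (intro mult_right_mono) auto
            finally show ?thesis .
          next
            case False
            then have "norm (y w) powr lam \<le> ((1 - \<eta>) * norm (y z)) powr lam"
              using lo yz \<eta> by (intro powr_mono2') auto
            also have "\<dots> = (1 - \<eta>) powr lam * norm (y z) powr lam" using \<eta> by (simp add: powr_mult)
            also have "\<dots> \<le> B * norm (y z) powr lam" unfolding B_def by (intro mult_right_mono) auto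
            finally show ?thesis .
          qed
        qed
        finally show "norm (\<psi> w) \<le> e' * (B * norm (y z) powr lam)" using e' by simp
      qed
      then have "norm (deriv \<psi> z) \<le> e' * B * norm (y z) powr lam / (\<eta> * (\<rho> * norm (y z)))"
        unfolding u_def normy by (simp add: mult.assoc)
      also have "\<dots> = e / 2 * (norm (y z) powr (lam - 1))"
        unfolding e'_def using B \<eta> \<rho> y0[OF zK] by (simp add: powr_diff field_simps)
      finally have "norm (deriv \<psi> z) * norm (y z) powr (1 - lam) \<le>
          e / 2 * (norm (y z) powr (lam - 1)) * norm (y z) powr (1 - lam)"
        by (intro mult_right_mono) auto
      also have "\<dots> = e / 2" using y0[OF zK] by (simp add: powr_diff field_simps)
      finally show ?thesis using e by (simp add: norm_mult norm_powr_real_powr' del: of_real_diff)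
    qed
    ultimately show "\<forall>\<^sub>F z in at (of_real \<rho>) within K'. dist (deriv \<psi> z * y z powr of_real (1 - lam)) 0 < e"
      unfolding eventually_at by blast
  qed
  then have "((\<lambda>z. deriv \<psi> z * y z powr of_real (1 - lam) - c * of_real lam / of_real \<rho>)
      \<longlongrightarrow> 0 - c * of_real lam / of_real \<rho>) (at (of_real \<rho>) within K')"
    by (intro tendsto_intros)
  moreover have "\<forall>\<^sub>F z in at (of_real \<rho>) within K'.
     deriv \<psi> z * y z powr of_real (1 - lam) - c * of_real lam / of_real \<rho> = deriv \<phi> z * y z powr of_real (1 - lam)"
    unfolding eventually_at_filter
  proof (rule always_eventually, safe)
    fix z assume "z \<in> K'"
    then have zK: "z \<in> K" using KK by auto
    have "y z powr of_real (lam - 1) * y z powr of_real (1 - lam) = 1"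
      using y0[OF zK] by (simp flip: powr_add)
    then show "deriv \<psi> z * y z powr of_real (1 - lam) - c * of_real lam / of_real \<rho> = deriv \<phi> z * y z powr of_real (1 - lam)"
      unfolding d\<psi>[OF zK] by (simp add: algebra_simps del: of_real_diff)
  qed
  ultimately have "((\<lambda>z. deriv \<phi> z * y z powr of_real (1 - lam)) \<longlongrightarrow> 0 - c * of_real lam / of_real \<rho>) (at (of_real \<rho>) within K')"
    using filterlim_cong by fastforce
  then show ?thesis unfolding K'_def y_def by (simp add: mult.commute)
qed

lemma map_coeffs_nth [simp]: "fps_nth (map_coeffs h f) n = h (fps_nth f n)"
  by (simp add: map_coeffs_def)

lemma fps_conv_radius_map_coeffs [simp]:
  "fps_conv_radius (map_coeffs complex_of_real f) = fps_conv_radius f"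
  by (simp add: fps_conv_radius_def conv_radius_def)

text \<open>Differentiation kills \<open>P\<close>, and the factor \<open>z\<close>, which tends to
  \<open>\<rho>\<close>, cancels the \<open>1 / \<rho>\<close> from the inner derivative of
  \<open>1 - z / \<rho>\<close>.\<close>

lemma cone_sing_theta:
  assumes "cone_sing f \<rho> P lam c"
  shows "cone_sing (fps_X * fps_deriv f) \<rho> 0 (lam - 1) (- lam * c)"
proof -
  obtain \<epsilon> \<sigma> \<phi> where *: "0 < \<epsilon>" "0 < \<sigma>" "\<sigma> < 1" "\<phi> holomorphic_on cone_domain \<rho> \<epsilon> \<sigma>"
    "\<And>z. z\<in>ball 0 \<rho> \<Longrightarrow> \<phi> z = eval_fps (map_coeffs complex_of_real f) z"
    "((\<lambda>z. (\<phi> z - of_real P) * (1 - z / of_real \<rho>) powr of_real (- lam)) \<longlongrightarrow> of_real c)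
          (at (of_real \<rho>) within cone_domain \<rho> \<epsilon> \<sigma>)" and \<rho>: "0 < \<rho>" "ereal \<rho> \<le> fps_conv_radius f"
    using assms unfolding cone_sing_def by blast
  define K' where "K' = cone_domain \<rho> \<epsilon> (\<sigma> / 2)"
  have "K' \<subseteq> cone_domain \<rho> \<epsilon> \<sigma>" unfolding K'_def by (rule cone_domain_mono) (use * in auto)
  then have hol: "\<phi> holomorphic_on K'" using *(4) holomorphic_on_subset by blast
  have "((\<lambda>z. z * (deriv \<phi> z * (1 - z / of_real \<rho>) powr of_real (1 - lam))) \<longlongrightarrow>
       of_real \<rho> * (- of_real lam * of_real c / of_real \<rho>)) (at (of_real \<rho>) within K')"
    unfolding K'_def by (intro tendsto_mult tendsto_ident_at deriv_tendsto_cone[OF \<rho>(1) *(1-4,6)])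
  then have 1: "((\<lambda>z. (z * deriv \<phi> z - of_real 0) * (1 - z / of_real \<rho>) powr of_real (- (lam - 1))) \<longlongrightarrow>
       of_real (- lam * c)) (at (of_real \<rho>) within K')"
    using \<rho> by (simp add: mult.assoc)
  have 2: "(\<lambda>z. z * deriv \<phi> z) holomorphic_on K'"
    by (intro holomorphic_intros hol) (auto simp: K'_def open_cone_domain)
  have le: "ereal \<rho> \<le> fps_conv_radius (fps_deriv f)" using \<rho> fps_conv_radius_deriv[of f] by simp
  then have 3: "ereal \<rho> \<le> fps_conv_radius (fps_X * fps_deriv f)"
    using fps_conv_radius_mult[of fps_X "fps_deriv f"] by (simp add: order_trans)
  have 4: "z * deriv \<phi> z = eval_fps (map_coeffs complex_of_real (fps_X * fps_deriv f)) z" if z: "z \<in> ball 0 \<rho>" for z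
  proof -
    let ?f = "map_coeffs complex_of_real f"
    have "ereal (norm z) < ereal \<rho>" using z by simp
    then have r: "ereal (norm z) < fps_conv_radius ?f" using less_le_trans[OF _ \<rho>(2)] by simp
    have "deriv \<phi> z = deriv (eval_fps ?f) z"
    proof (rule deriv_cong_ev)
      show "\<forall>\<^sub>F x in nhds z. \<phi> x = eval_fps ?f x"
        using * z by (intro eventually_nhds_in_open[THEN eventually_mono, of "ball 0 \<rho>"]) auto
    qed simp
    also have "\<dots> = eval_fps (fps_deriv ?f) z" by (rule eval_fps_deriv[OF r, symmetric])
    finally have "z * deriv \<phi> z = eval_fps fps_X z * eval_fps (fps_deriv ?f) z" by simp
    also have "\<dots> = eval_fps (fps_X * fps_deriv ?f) z"
      by (rule eval_fps_mult[symmetric]) (use r fps_conv_radius_deriv[of ?f] in \<open>auto intro: less_le_trans\<close>)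
    also have "fps_X * fps_deriv ?f = map_coeffs complex_of_real (fps_X * fps_deriv f)"
      by (rule fps_ext) auto
    finally show ?thesis .
  qed
  show ?thesis unfolding cone_sing_def
    using \<rho> 1 2 3 4 * unfolding K'_def
    by (intro conjI exI[of _ \<epsilon>] exI[of _ "\<sigma>/2"] exI[of _ "\<lambda>z. z * deriv \<phi> z"]) auto
qed

text \<open>
  For \<open>F = M \<Prod>\<^sub>l G\<^sub>l \<circ> H\<^sub>l\<close> this avoids any control of a continuation beyond the disc of convergence.
\<close>
definition disc_sing :: "(complex \<Rightarrow> complex) \<Rightarrow> real \<Rightarrow> real \<Rightarrow> complex \<Rightarrow> bool" where
  "disc_sing F \<rho> lam C \<longleftrightarrow> 0 < \<rho> \<and> F holomorphic_on ball 0 \<rho> \<and>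
     ((\<lambda>z. F z * (1 - z / of_real \<rho>) powr of_real (- lam)) \<longlongrightarrow> C)
       (at (of_real \<rho>) within ball 0 \<rho>) \<and>
     ((\<lambda>z. deriv F z * (1 - z / of_real \<rho>) powr of_real (1 - lam)) \<longlongrightarrow> - of_real lam * C / of_real \<rho>)
       (at (of_real \<rho>) within ball 0 \<rho>) \<and>
     (\<forall>\<delta>>0. bounded (F ` (ball 0 \<rho> - ball (of_real \<rho>) \<delta>)) \<and>
            bounded (deriv F ` (ball 0 \<rho> - ball (of_real \<rho>) \<delta>)))"

section \<open>Calculus of expansions inside the disc of convergence\<close>

lemma disc_Re_pos:
  assumes "z \<in> ball 0 \<rho>"
  shows "Re (1 - z / of_real \<rho>) > 0"
proof -
  have "norm z < \<rho>" using assms by simp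
  then have "Re z < \<rho>" using complex_Re_le_cmod[of z] by linarith
  moreover have "0 < \<rho>" using \<open>norm z < \<rho>\<close> norm_ge_zero[of z] by linarith
  ultimately show ?thesis by simp
qed

lemma disc_nonzero: "z \<in> ball 0 \<rho> \<Longrightarrow> 1 - z / complex_of_real \<rho> \<noteq> 0"
  using disc_Re_pos[of z \<rho>] by force

text \<open>Without a neighbourhood of \<open>\<rho>\<close> the closed disc is a compact subset of
  the cone. Including the boundary circle gives bounds that are uniform up to
  \<open>\<bar>z\<bar> = \<rho>\<close>.\<close>

lemma bounded_off_singularity:
  assumes "\<Phi> holomorphic_on cone_domain \<rho> \<epsilon> \<sigma>" "0 < \<rho>" "0 < \<epsilon>" "0 < \<sigma>" "0 < \<delta>"
  shows "compact (\<Phi> ` (cball 0 \<rho> - ball (of_real \<rho>) \<delta>))"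
proof (rule compact_continuous_image)
  have "cball 0 \<rho> - ball (of_real \<rho>) \<delta> \<subseteq> cone_domain \<rho> \<epsilon> \<sigma>"
    using assms by (auto intro!: closed_disc_subset_cone_domain)
  then show "continuous_on (cball 0 \<rho> - ball (of_real \<rho>) \<delta>) \<Phi>"
    using assms(1) holomorphic_on_imp_continuous_on continuous_on_subset by blast
  show "compact (cball 0 \<rho> - ball (complex_of_real \<rho>) \<delta>)"
    by (intro compact_diff) auto
qed

text \<open>The expansions are restricted to the disc, while \<open>\<phi>\<close> is kept: its
  values on the rest of the circle enter the compactness arguments and
  \<open>continuation_neq\<close>.\<close>

lemma cone_sing_continuation:
  assumes "cone_sing f \<rho> P lam c"
  defines "F \<equiv> eval_fps (map_coeffs complex_of_real f)"
  obtains \<epsilon> \<sigma> \<phi> where "0 < \<epsilon>" "0 < \<sigma>" "\<sigma> < 1" "0 < \<rho>" "F holomorphic_on ball 0 \<rho>"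
    "\<phi> holomorphic_on cone_domain \<rho> \<epsilon> \<sigma>"
    "\<And>z. z \<in> ball 0 \<rho> \<Longrightarrow> \<phi> z = F z" "\<And>z. z \<in> ball 0 \<rho> \<Longrightarrow> deriv \<phi> z = deriv F z"
    "((\<lambda>z. (F z - of_real P) * (1 - z / of_real \<rho>) powr of_real (- lam)) \<longlongrightarrow> of_real c)
          (at (of_real \<rho>) within ball 0 \<rho>)"
    "((\<lambda>z. deriv F z * (1 - z / of_real \<rho>) powr of_real (1 - lam)) \<longlongrightarrow> - of_real lam * of_real c / of_real \<rho>)
       (at (of_real \<rho>) within ball 0 \<rho>)"
proof -
  obtain \<epsilon> \<sigma> \<phi> where *: "0 < \<epsilon>" "0 < \<sigma>" "\<sigma> < 1" "\<phi> holomorphic_on cone_domain \<rho> \<epsilon> \<sigma>"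
    "\<And>z. z\<in>ball 0 \<rho> \<Longrightarrow> \<phi> z = F z"
    "((\<lambda>z. (\<phi> z - of_real P) * (1 - z / of_real \<rho>) powr of_real (- lam)) \<longlongrightarrow> of_real c)
          (at (of_real \<rho>) within cone_domain \<rho> \<epsilon> \<sigma>)" and \<rho>: "0 < \<rho>" "ereal \<rho> \<le> fps_conv_radius f"
    using assms unfolding cone_sing_def by blast
  have sub: "ball 0 \<rho> \<subseteq> cone_domain \<rho> \<epsilon> s" if "0 < s" for s
    using * \<rho> that by (auto intro!: closed_disc_subset_cone_domain)
  have d: "deriv \<phi> z = deriv F z" if z: "z \<in> ball 0 \<rho>" for z
  proof (rule deriv_cong_ev)
    show "\<forall>\<^sub>F x in nhds z. \<phi> x = F x"
      using * z by (intro eventually_nhds_in_open[THEN eventually_mono, of "ball 0 \<rho>"]) auto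
  qed simp
  have "F holomorphic_on ball 0 \<rho>"
    using holomorphic_on_subset[OF *(4) sub[OF *(2)]] * holomorphic_transform by blast
  moreover have "((\<lambda>z. (F z - of_real P) * (1 - z / of_real \<rho>) powr of_real (- lam)) \<longlongrightarrow> of_real c)
          (at (of_real \<rho>) within ball 0 \<rho>)"
    using tendsto_mono[OF at_le[OF sub[OF *(2)]] *(6)]
    by (rule Lim_transform_eventually) (auto simp: eventually_at_filter *(5))
  moreover have "0 < \<sigma> / 2" using * by simp
  then have "((\<lambda>z. deriv F z * (1 - z / of_real \<rho>) powr of_real (1 - lam)) \<longlongrightarrow> - of_real lam * of_real c / of_real \<rho>)
       (at (of_real \<rho>) within ball 0 \<rho>)"
    by (rule Lim_transform_eventually[OF tendsto_mono[OF at_le[OF sub] deriv_tendsto_cone[OF \<rho>(1) *(1-4,6)]]]) (auto simp: eventually_at_filter d)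
  ultimately show ?thesis using * \<rho> d that by blast
qed

lemma disc_sing_cone_sing:
  assumes "cone_sing f \<rho> 0 lam c"
  shows "disc_sing (eval_fps (map_coeffs complex_of_real f)) \<rho> lam (of_real c)"
proof -
  define F where "F = eval_fps (map_coeffs complex_of_real f)"
  obtain \<epsilon> \<sigma> \<phi> where *: "0 < \<epsilon>" "0 < \<sigma>" "\<sigma> < 1" "0 < \<rho>" "F holomorphic_on ball 0 \<rho>"
    "\<phi> holomorphic_on cone_domain \<rho> \<epsilon> \<sigma>"
    "\<And>z. z \<in> ball 0 \<rho> \<Longrightarrow> \<phi> z = F z" "\<And>z. z \<in> ball 0 \<rho> \<Longrightarrow> deriv \<phi> z = deriv F z"
    "((\<lambda>z. (F z - of_real 0) * (1 - z / of_real \<rho>) powr of_real (- lam)) \<longlongrightarrow> of_real c)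
          (at (of_real \<rho>) within ball 0 \<rho>)"
    "((\<lambda>z. deriv F z * (1 - z / of_real \<rho>) powr of_real (1 - lam)) \<longlongrightarrow> - of_real lam * of_real c / of_real \<rho>)
       (at (of_real \<rho>) within ball 0 \<rho>)"
    using cone_sing_continuation[OF assms] unfolding F_def by blast
  have hol': "deriv \<phi> holomorphic_on cone_domain \<rho> \<epsilon> \<sigma>"
    using * open_cone_domain holomorphic_deriv by blast
  have "bounded (F ` (ball 0 \<rho> - ball (of_real \<rho>) \<delta>)) \<and>
            bounded (deriv F ` (ball 0 \<rho> - ball (of_real \<rho>) \<delta>))" if "\<delta> > 0" for \<delta>
  proof -
    have "F ` (ball 0 \<rho> - ball (of_real \<rho>) \<delta>) \<subseteq> \<phi> ` (cball 0 \<rho> - ball (of_real \<rho>) \<delta>)"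
      using *(7) by (force simp: image_iff)
    moreover have "deriv F ` (ball 0 \<rho> - ball (of_real \<rho>) \<delta>) \<subseteq> deriv \<phi> ` (cball 0 \<rho> - ball (of_real \<rho>) \<delta>)"
      using *(8) by (force simp: image_iff)
    ultimately show ?thesis
      using bounded_subset[OF compact_imp_bounded[OF bounded_off_singularity[OF *(6) *(4,1,2) that]]]
        bounded_subset[OF compact_imp_bounded[OF bounded_off_singularity[OF hol' *(4,1,2) that]]]
      by simp
  qed
  moreover have "((\<lambda>z. F z * (1 - z / of_real \<rho>) powr of_real (- lam)) \<longlongrightarrow> of_real c)
          (at (of_real \<rho>) within ball 0 \<rho>)"
    using *(9) unfolding of_real_0 diff_zero .
  ultimately show ?thesis using *(4,5,10) unfolding disc_sing_def F_def by blast
qed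

lemma bounded_image_mult:
  fixes f g :: "'b \<Rightarrow> 'a::real_normed_algebra"
  assumes "bounded (f ` S)" "bounded (g ` S)"
  shows "bounded ((\<lambda>x. f x * g x) ` S)"
proof -
  obtain a b where "\<And>x. x \<in> S \<Longrightarrow> norm (f x) \<le> a" "\<And>x. x \<in> S \<Longrightarrow> norm (g x) \<le> b"
    using assms unfolding bounded_iff by auto
  then have "norm (f x * g x) \<le> a * b" if "x \<in> S" for x
    using that by (intro order_trans[OF norm_mult_ineq] mult_mono) (auto intro: order_trans[OF norm_ge_zero])
  then show ?thesis unfolding bounded_iff by auto
qed

lemma disc_sing_1: "0 < \<rho> \<Longrightarrow> disc_sing (\<lambda>_. 1) \<rho> 0 1"
  unfolding disc_sing_def
proof (intro conjI allI impI)
  show "((\<lambda>z. 1 * (1 - z / complex_of_real \<rho>) powr complex_of_real (- 0)) \<longlongrightarrow> 1) (at (of_real \<rho>) within ball 0 \<rho>)"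
    by (rule Lim_transform_eventually[OF tendsto_const])
      (auto simp: eventually_at_filter dest: disc_nonzero[of _ \<rho>, simplified])
qed (auto simp: bounded_iff)

text \<open>By the Leibniz rule the leading terms of the derivative add up to
  \<open>- (a + b) * C * D / \<rho>\<close>. The powers split without branch problems, as both
  factors refer to the same base \<open>1 - z / \<rho>\<close>.\<close>

lemma disc_sing_mult:
  assumes "disc_sing F \<rho> a C" "disc_sing G \<rho> b D"
  shows "disc_sing (\<lambda>z. F z * G z) \<rho> (a + b) (C * D)"
proof -
  let ?y = "\<lambda>z. 1 - z / complex_of_real \<rho>"
  have F: "0 < \<rho>" "F holomorphic_on ball 0 \<rho>"
     "((\<lambda>z. F z * ?y z powr of_real (- a)) \<longlongrightarrow> C) (at (of_real \<rho>) within ball 0 \<rho>)"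
     "((\<lambda>z. deriv F z * ?y z powr of_real (1 - a)) \<longlongrightarrow> - of_real a * C / of_real \<rho>)
       (at (of_real \<rho>) within ball 0 \<rho>)"
     "\<And>\<delta>. \<delta>>0 \<Longrightarrow> bounded (F ` (ball 0 \<rho> - ball (of_real \<rho>) \<delta>))"
     "\<And>\<delta>. \<delta>>0 \<Longrightarrow> bounded (deriv F ` (ball 0 \<rho> - ball (of_real \<rho>) \<delta>))"
    and G: "G holomorphic_on ball 0 \<rho>"
     "((\<lambda>z. G z * ?y z powr of_real (- b)) \<longlongrightarrow> D) (at (of_real \<rho>) within ball 0 \<rho>)"
     "((\<lambda>z. deriv G z * ?y z powr of_real (1 - b)) \<longlongrightarrow> - of_real b * D / of_real \<rho>)
       (at (of_real \<rho>) within ball 0 \<rho>)"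
     "\<And>\<delta>. \<delta>>0 \<Longrightarrow> bounded (G ` (ball 0 \<rho> - ball (of_real \<rho>) \<delta>))"
     "\<And>\<delta>. \<delta>>0 \<Longrightarrow> bounded (deriv G ` (ball 0 \<rho> - ball (of_real \<rho>) \<delta>))"
    using assms unfolding disc_sing_def by auto
  have d: "deriv (\<lambda>z. F z * G z) z = F z * deriv G z + deriv F z * G z" if "z \<in> ball 0 \<rho>" for z
    using that F(2) G(1) by (intro deriv_mult) (auto intro!: holomorphic_on_imp_differentiable_at[of _ "ball 0 \<rho>"])
  have pw: "y powr of_real (- (a + b)) = y powr of_real (- a) * y powr of_real (- b)"
    "y powr of_real (1 - (a + b)) = y powr of_real (- a) * y powr of_real (1 - b)"
    "y powr of_real (1 - (a + b)) = y powr of_real (1 - a) * y powr of_real (- b)" for y :: complex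
    by (simp_all add: powr_add[symmetric] algebra_simps)
  have 1: "((\<lambda>z. F z * G z * ?y z powr of_real (- (a + b))) \<longlongrightarrow> C * D) (at (of_real \<rho>) within ball 0 \<rho>)"
    using tendsto_mult[OF F(3) G(2)] unfolding pw by (simp add: mult_ac)
  have "((\<lambda>z. (F z * ?y z powr of_real (- a)) * (deriv G z * ?y z powr of_real (1 - b)) +
      (deriv F z * ?y z powr of_real (1 - a)) * (G z * ?y z powr of_real (- b)))
     \<longlongrightarrow> C * (- of_real b * D / of_real \<rho>) + (- of_real a * C / of_real \<rho>) * D) (at (of_real \<rho>) within ball 0 \<rho>)"
    by (intro tendsto_add tendsto_mult F G)
  then have 2: "((\<lambda>z. deriv (\<lambda>z. F z * G z) z * ?y z powr of_real (1 - (a + b)))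
     \<longlongrightarrow> C * (- of_real b * D / of_real \<rho>) + (- of_real a * C / of_real \<rho>) * D) (at (of_real \<rho>) within ball 0 \<rho>)"
  proof (rule Lim_transform_eventually)
    have "(F z * ?y z powr of_real (- a)) * (deriv G z * ?y z powr of_real (1 - b)) +
      (deriv F z * ?y z powr of_real (1 - a)) * (G z * ?y z powr of_real (- b)) =
      deriv (\<lambda>z. F z * G z) z * ?y z powr of_real (1 - (a + b))" if "z \<in> ball 0 \<rho>" for z
      unfolding d[OF that] distrib_right
      by (subst pw(2), subst pw(3)) (simp only: mult_ac)
    then show "\<forall>\<^sub>F z in at (of_real \<rho>) within ball 0 \<rho>. (F z * ?y z powr of_real (- a)) * (deriv G z * ?y z powr of_real (1 - b)) +
      (deriv F z * ?y z powr of_real (1 - a)) * (G z * ?y z powr of_real (- b)) =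
      deriv (\<lambda>z. F z * G z) z * ?y z powr of_real (1 - (a + b))"
      unfolding eventually_at_filter by (intro always_eventually) blast
  qed
  have 3: "C * (- of_real b * D / of_real \<rho>) + (- of_real a * C / of_real \<rho>) * D = - of_real (a + b) * (C * D) / of_real \<rho>"
    using F(1) by (simp add: field_simps)
  have 4: "bounded (deriv (\<lambda>z. F z * G z) ` (ball 0 \<rho> - ball (of_real \<rho>) \<delta>))" if "\<delta> > 0" for \<delta>
  proof -
    have "bounded ((\<lambda>z. F z * deriv G z + deriv F z * G z) ` (ball 0 \<rho> - ball (of_real \<rho>) \<delta>))"
      by (intro bounded_plus_comp bounded_image_mult F G that)
    then show ?thesis by (rule bounded_subset) (use d in \<open>auto simp: image_iff\<close>)
  qed
  show ?thesis unfolding disc_sing_def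
    using F(1) 1 2 4 bounded_image_mult[OF F(5) G(4)] unfolding 3
    by (intro conjI allI impI holomorphic_on_mult F G) auto
qed

lemma disc_sing_prod:
  assumes "finite S" "0 < \<rho>" "\<And>l. l \<in> S \<Longrightarrow> disc_sing (F l) \<rho> (a l) (C l)"
  shows "disc_sing (\<lambda>z. \<Prod>l\<in>S. F l z) \<rho> (\<Sum>l\<in>S. a l) (\<Prod>l\<in>S. C l)"
  using assms(1,3) by (induction S) (auto intro!: disc_sing_1 assms(2) disc_sing_mult)

lemma eval_fps_map_of_real:
  assumes "ereal \<bar>x\<bar> < fps_conv_radius f"
  shows "eval_fps (map_coeffs complex_of_real f) (of_real x) = of_real (eval_fps f x)"
proof -
  have "(\<lambda>n. fps_nth f n * x ^ n) sums eval_fps f x"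
    using assms by (intro sums_eval_fps) auto
  then have "(\<lambda>n. complex_of_real (fps_nth f n * x ^ n)) sums of_real (eval_fps f x)"
    by (rule sums_of_real)
  then show ?thesis unfolding eval_fps_def by (simp add: sums_iff)
qed

text \<open>This is the case of \<open>M\<close> analytic at \<open>\<rho>\<close>, expressed as
  exponent \<open>0\<close> with the value at \<open>\<rho>\<close> as constant. The derivative
  condition has limit \<open>0\<close>, because \<open>F'\<close> is bounded there and is multiplied
  by \<open>1 - z / \<rho>\<close>.\<close>

lemma disc_sing_analytic:
  assumes "0 < \<rho>" "ereal \<rho> < fps_conv_radius f"
  shows "disc_sing (eval_fps (map_coeffs complex_of_real f)) \<rho> 0 (of_real (eval_fps f \<rho>))"
proof -
  define F where "F = eval_fps (map_coeffs complex_of_real f)"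
  define S where "S = eball (0::complex) (fps_conv_radius f)"
  have S: "open S" "cball 0 \<rho> \<subseteq> S" "complex_of_real \<rho> \<in> S"
    unfolding S_def using assms by (auto simp: le_less_trans[of "ereal _" "ereal \<rho>"])
  have hol: "F holomorphic_on S" unfolding F_def S_def
    by (intro holomorphic_intros) auto
  have hol': "deriv F holomorphic_on S" using holomorphic_deriv hol S by blast
  have bd: "bounded (f ` (ball 0 \<rho> - ball (of_real \<rho>) \<delta>))" if "f holomorphic_on S" for f \<delta>
  proof -
    have "bounded (f ` cball 0 \<rho>)"
      using that S by (intro compact_imp_bounded compact_continuous_image)
        (auto intro!: holomorphic_on_imp_continuous_on[OF holomorphic_on_subset])
    then show ?thesis by (rule bounded_subset) auto
  qed
  have lim: "(f \<longlongrightarrow> f \<rho>) (at (of_real \<rho>) within ball 0 \<rho>)" if "f holomorphic_on S" for f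
    using that S holomorphic_on_imp_continuous_on[of f S]
    by (meson continuous_on_eq_continuous_at continuous_at_imp_continuous_at_within continuous_within)
  have 1: "((\<lambda>z. F z * (1 - z / of_real \<rho>) powr of_real (- 0)) \<longlongrightarrow> F \<rho>) (at (of_real \<rho>) within ball 0 \<rho>)"
    using lim[OF hol] by (rule Lim_transform_eventually)
      (auto simp: eventually_at_filter dest: disc_nonzero[of _ \<rho>, simplified])
  have "((\<lambda>z. deriv F z * (1 - z / of_real \<rho>)) \<longlongrightarrow> deriv F \<rho> * (1 - of_real \<rho> / of_real \<rho>)) (at (of_real \<rho>) within ball 0 \<rho>)"
    using assms by (intro tendsto_intros lim[OF hol']) auto
  then have 2: "((\<lambda>z. deriv F z * (1 - z / of_real \<rho>) powr of_real (1 - 0)) \<longlongrightarrow> 0) (at (of_real \<rho>) within ball 0 \<rho>)"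
    using assms by simp
  have 3: "F \<rho> = of_real (eval_fps f \<rho>)"
    unfolding F_def using assms by (intro eval_fps_map_of_real) auto
  have "F holomorphic_on ball 0 \<rho>" using S(2) by (intro holomorphic_on_subset[OF hol]) auto
  then show ?thesis unfolding disc_sing_def F_def[symmetric] using assms 1 2 3 bd[OF hol] bd[OF hol']
    by auto
qed

text \<open>Both arguments are below \<open>pi / 2\<close> in absolute value and
  \<open>l \<le> 1\<close>, so the argument of the product stays in \<open>(-pi, pi)\<close> and the
  principal logarithms add. In the disc this applies to \<open>1 - z / \<rho>\<close> and
  \<open>1 - H z / \<tau>\<close>, which have positive real part.\<close>

lemma powr_mult_powr_right_half_plane:
  fixes x y :: complex
  assumes "Re x > 0" "Re y > 0" "0 < l" "l \<le> 1"
  shows "(x * y powr of_real (- l)) powr of_real p = x powr of_real p * y powr of_real (- (l * p))"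
proof -
  have [simp]: "x \<noteq> 0" "y \<noteq> 0" using assms by auto
  define w where "w = Ln x - of_real l * Ln y"
  have "\<bar>Im (Ln x)\<bar> < pi / 2" "\<bar>Im (Ln y)\<bar> < pi / 2" using assms Re_Ln_pos_lt[of x] Re_Ln_pos_lt[of y] by auto
  moreover have "l * \<bar>Im (Ln y)\<bar> \<le> 1 * \<bar>Im (Ln y)\<bar>" using assms by (intro mult_right_mono) auto
  moreover have "\<bar>l * Im (Ln y)\<bar> = l * \<bar>Im (Ln y)\<bar>" using assms by (simp add: abs_mult)
  ultimately have "- pi < Im w" "Im w \<le> pi" unfolding w_def by auto
  then have "Ln (exp w) = w" by simp
  moreover have "x * y powr of_real (- l) = exp w"
    by (simp add: w_def powr_def exp_diff exp_minus field_simps)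
  ultimately show ?thesis
    by (simp add: powr_def) (simp add: w_def right_diff_distrib exp_diff exp_minus divide_inverse mult_ac)
qed

lemma filterlim_radius:
  assumes "0 < \<rho>"
  shows "filterlim (\<lambda>t. complex_of_real (t * \<rho>)) (at (of_real \<rho>) within ball 0 \<rho>) (at_left 1)"
  unfolding filterlim_at
proof
  have "((\<lambda>t. complex_of_real (t * \<rho>)) \<longlongrightarrow> complex_of_real (1 * \<rho>)) (at_left 1)"
    by (intro tendsto_intros)
  then show "((\<lambda>t. complex_of_real (t * \<rho>)) \<longlongrightarrow> of_real \<rho>) (at_left 1)" by simp
  have "\<forall>\<^sub>F t in at_left (1::real). t \<in> {0<..<1}"
    by (intro eventually_at_leftI[of 0]) auto
  then show "\<forall>\<^sub>F t in at_left 1. complex_of_real (t * \<rho>) \<in> ball 0 \<rho> \<and> complex_of_real (t * \<rho>) \<noteq> of_real \<rho>"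
  proof eventually_elim
    case (elim t)
    then have "complex_of_real (t * \<rho>) \<noteq> of_real \<rho>" using assms unfolding of_real_eq_iff by simp
    then show ?case using elim assms by (simp add: norm_mult)
  qed
qed

lemma powr_tendsto_0_disc:
  assumes "0 < \<rho>" "0 < lam"
  shows "((\<lambda>z. (1 - z / of_real \<rho>) powr complex_of_real lam) \<longlongrightarrow> 0) (at (of_real \<rho>) within S)"
proof -
  have "((\<lambda>z. norm (1 - z / of_real \<rho>)) \<longlongrightarrow> norm (1 - of_real \<rho> / complex_of_real \<rho>)) (at (of_real \<rho>) within S)"
    using assms by (intro tendsto_intros) auto
  then have "((\<lambda>z. norm (1 - z / complex_of_real \<rho>)) \<longlongrightarrow> 0) (at (of_real \<rho>) within S)" using assms by simp
  then have "((\<lambda>z. norm (1 - z / complex_of_real \<rho>) powr lam) \<longlongrightarrow> 0) (at (of_real \<rho>) within S)"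
    by (intro tendsto_zero_powrI[where b=lam] tendsto_const assms) auto
  moreover have "norm ((1 - z / complex_of_real \<rho>) powr complex_of_real lam) = norm (1 - z / complex_of_real \<rho>) powr lam" for z
    by (cases "z = of_real \<rho>") (use assms in \<open>auto simp: norm_powr_real_powr'\<close>)
  ultimately show ?thesis by (subst tendsto_norm_zero_iff[symmetric]) simp
qed

section \<open>Composition\<close>

locale inner_series =
  fixes h :: "real fps" and \<rho> \<tau> lam c :: real
  assumes sing: "cone_sing h \<rho> \<tau> lam c" and lam: "0 < lam" "lam < 1" and c: "c \<noteq> 0"
    and nonneg: "\<And>n. 0 \<le> fps_nth h n"
begin

definition "H = eval_fps (map_coeffs complex_of_real h)"

lemma \<rho>_pos: "0 < \<rho>" using sing unfolding cone_sing_def by simp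

lemma conv_radius: "ereal \<rho> \<le> fps_conv_radius h" using sing unfolding cone_sing_def by simp

lemma H_sums: "norm z < \<rho> \<Longrightarrow> (\<lambda>n. complex_of_real (fps_nth h n) * z ^ n) sums H z"
  using sums_eval_fps[of z "map_coeffs complex_of_real h"] conv_radius
    less_le_trans[OF _ conv_radius, of "ereal (norm z)"]
  by (simp add: H_def)

lemma h_sums: "\<bar>x\<bar> < \<rho> \<Longrightarrow> (\<lambda>n. fps_nth h n * x ^ n) sums eval_fps h x"
  using sums_eval_fps[of x h] less_le_trans[OF _ conv_radius, of "ereal \<bar>x\<bar>"] by simp

lemma H_of_real: "\<bar>x\<bar> < \<rho> \<Longrightarrow> H (of_real x) = of_real (eval_fps h x)"
  using eval_fps_map_of_real[of x h] less_le_trans[OF _ conv_radius, of "ereal \<bar>x\<bar>"]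
  by (simp add: H_def)

lemma h_mono: "0 \<le> x \<Longrightarrow> x \<le> y \<Longrightarrow> y < \<rho> \<Longrightarrow> eval_fps h x \<le> eval_fps h y"
  by (rule sums_le[OF _ h_sums h_sums]) (auto intro!: mult_left_mono power_mono nonneg)

lemma norm_H_le: "norm z < \<rho> \<Longrightarrow> norm (H z) \<le> eval_fps h (norm z)"
proof -
  assume z: "norm z < \<rho>"
  have s: "(\<lambda>n. fps_nth h n * norm z ^ n) sums eval_fps h (norm z)" using h_sums z by simp
  have "norm (suminf (\<lambda>n. complex_of_real (fps_nth h n) * z ^ n)) \<le> suminf (\<lambda>n. fps_nth h n * norm z ^ n)"
    using s by (intro norm_suminf_le) (auto simp: sums_iff norm_mult norm_power nonneg)
  then show ?thesis using H_sums[OF z] s by (simp add: sums_iff)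
qed

lemma H_continuation:
  obtains \<epsilon> \<sigma> \<phi> where "0 < \<epsilon>" "0 < \<sigma>" "\<sigma> < 1" "H holomorphic_on ball 0 \<rho>"
    "\<phi> holomorphic_on cone_domain \<rho> \<epsilon> \<sigma>"
    "\<And>z. z \<in> ball 0 \<rho> \<Longrightarrow> \<phi> z = H z" "\<And>z. z \<in> ball 0 \<rho> \<Longrightarrow> deriv \<phi> z = deriv H z"
    "((\<lambda>z. (H z - of_real \<tau>) * (1 - z / of_real \<rho>) powr of_real (- lam)) \<longlongrightarrow> of_real c)
          (at (of_real \<rho>) within ball 0 \<rho>)"
    "((\<lambda>z. deriv H z * (1 - z / of_real \<rho>) powr of_real (1 - lam)) \<longlongrightarrow> - of_real lam * of_real c / of_real \<rho>)
       (at (of_real \<rho>) within ball 0 \<rho>)"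
  by (rule cone_sing_continuation[OF sing, folded H_def]) (rule that; assumption)

lemma H_tendsto: "(H \<longlongrightarrow> of_real \<tau>) (at (of_real \<rho>) within ball 0 \<rho>)"
proof -
  let ?y = "\<lambda>z. 1 - z / complex_of_real \<rho>"
  have "((\<lambda>z. (H z - of_real \<tau>) * ?y z powr of_real (- lam)) \<longlongrightarrow> of_real c) (at (of_real \<rho>) within ball 0 \<rho>)"
    by (rule H_continuation)
  then have "((\<lambda>z. (H z - of_real \<tau>) * ?y z powr of_real (- lam) * ?y z powr of_real lam + of_real \<tau>)
     \<longlongrightarrow> of_real c * 0 + of_real \<tau>) (at (of_real \<rho>) within ball 0 \<rho>)"
    by (intro tendsto_intros powr_tendsto_0_disc \<rho>_pos lam)
  moreover have "(H z - of_real \<tau>) * ?y z powr of_real (- lam) * ?y z powr of_real lam + of_real \<tau> = H z"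
    if "z \<in> ball 0 \<rho>" for z
    using disc_nonzero[OF that] by (simp add: powr_minus field_simps)
  ultimately show ?thesis
    by (rule_tac Lim_transform_eventually) (auto simp: eventually_at_filter)
qed

lemma h_tendsto: "((\<lambda>t. eval_fps h (t * \<rho>)) \<longlongrightarrow> \<tau>) (at_left 1)"
proof -
  have "((\<lambda>t. H (of_real (t * \<rho>))) \<longlongrightarrow> of_real \<tau>) (at_left 1)"
    by (rule filterlim_compose[OF H_tendsto filterlim_radius[OF \<rho>_pos]])
  then have "((\<lambda>t. Re (H (of_real (t * \<rho>)))) \<longlongrightarrow> Re (of_real \<tau>)) (at_left 1)" by (rule tendsto_Re)
  then show ?thesis unfolding Re_complex_of_real
  proof (rule Lim_transform_eventually)
    have "\<forall>\<^sub>F t in at_left (1::real). t \<in> {0<..<1}" by (intro eventually_at_leftI[of 0]) auto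
    then show "\<forall>\<^sub>F t in at_left 1. Re (H (of_real (t * \<rho>))) = eval_fps h (t * \<rho>)"
      by eventually_elim (subst H_of_real, use \<rho>_pos in \<open>auto simp: abs_mult\<close>)
  qed
qed

lemma h_le: "0 \<le> x \<Longrightarrow> x < \<rho> \<Longrightarrow> eval_fps h x \<le> \<tau>"
proof -
  assume x: "0 \<le> x" "x < \<rho>"
  have "\<forall>\<^sub>F t in at_left (1::real). t \<in> {x/\<rho><..<1}"
    using x \<rho>_pos by (intro eventually_at_leftI[of "x/\<rho>"]) auto
  then have "\<forall>\<^sub>F t in at_left 1. eval_fps h x \<le> eval_fps h (t * \<rho>)"
    by eventually_elim (rule h_mono, use x \<rho>_pos in \<open>auto simp: field_simps\<close>)
  then show ?thesis by (intro tendsto_lowerbound[OF h_tendsto]) auto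
qed

lemma radial_limit:
  "((\<lambda>t. (eval_fps h (t * \<rho>) - \<tau>) * (1 - t) powr (- lam)) \<longlongrightarrow> c) (at_left 1)"
proof -
  let ?y = "\<lambda>z. 1 - z / complex_of_real \<rho>"
  have "((\<lambda>z. (H z - of_real \<tau>) * ?y z powr of_real (- lam)) \<longlongrightarrow> of_real c) (at (of_real \<rho>) within ball 0 \<rho>)"
    by (rule H_continuation)
  from filterlim_compose[OF this filterlim_radius[OF \<rho>_pos]]
  have "((\<lambda>t. Re ((H (of_real (t * \<rho>)) - of_real \<tau>) * ?y (of_real (t * \<rho>)) powr of_real (- lam))) \<longlongrightarrow> Re (of_real c)) (at_left 1)"
    by (rule tendsto_Re)
  then show ?thesis unfolding Re_complex_of_real
  proof (rule Lim_transform_eventually)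
    have "\<forall>\<^sub>F t in at_left (1::real). t \<in> {0<..<1}" by (intro eventually_at_leftI[of 0]) auto
    then show "\<forall>\<^sub>F t in at_left 1. Re ((H (of_real (t * \<rho>)) - of_real \<tau>) * ?y (of_real (t * \<rho>)) powr of_real (- lam)) =
       (eval_fps h (t * \<rho>) - \<tau>) * (1 - t) powr (- lam)"
    proof eventually_elim
      case (elim t)
      have "H (of_real (t * \<rho>)) = of_real (eval_fps h (t * \<rho>))"
        by (rule H_of_real) (use elim \<rho>_pos in \<open>auto simp: abs_mult\<close>)
      moreover have "?y (of_real (t * \<rho>)) = of_real (1 - t)" using \<rho>_pos by simp
      ultimately have "(H (of_real (t * \<rho>)) - of_real \<tau>) * ?y (of_real (t * \<rho>)) powr of_real (- lam)
         = of_real ((eval_fps h (t * \<rho>) - \<tau>) * (1 - t) powr (- lam))"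
        using elim by (simp add: powr_of_real[symmetric] del: of_real_diff of_real_minus) (simp flip: of_real_diff)
      then show ?case by (simp only: Re_complex_of_real)
    qed
  qed
qed

text \<open>Along the radius \<open>h\<close> stays below its limit \<open>\<tau>\<close>, so the
  quotient converging to \<open>c\<close> is nonpositive. This makes \<open>\<kappa>\<close>
  positive later.\<close>

lemma c_neg: "c < 0"
proof -
  have "\<forall>\<^sub>F t in at_left (1::real). t \<in> {0<..<1}" by (intro eventually_at_leftI[of 0]) auto
  then have "\<forall>\<^sub>F t in at_left 1. (eval_fps h (t * \<rho>) - \<tau>) * (1 - t) powr (- lam) \<le> 0"
    by eventually_elim (use \<rho>_pos in \<open>auto intro!: mult_nonpos_nonneg h_le\<close>)
  then have "c \<le> 0" by (intro tendsto_upperbound[OF radial_limit]) auto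
  then show ?thesis using c by simp
qed

text \<open>Equality at one point would, by monotonicity, make \<open>h\<close> constant from there
  up to \<open>\<rho>\<close> and force \<open>c = 0\<close>.\<close>

lemma h_less: "0 \<le> x \<Longrightarrow> x < \<rho> \<Longrightarrow> eval_fps h x < \<tau>"
proof (rule ccontr)
  assume x: "0 \<le> x" "x < \<rho>" and "\<not> eval_fps h x < \<tau>"
  then have eq: "eval_fps h x = \<tau>" using h_le by fastforce
  have "\<forall>\<^sub>F t in at_left (1::real). t \<in> {x/\<rho><..<1}"
    using x \<rho>_pos by (intro eventually_at_leftI[of "x/\<rho>"]) auto
  then have "\<forall>\<^sub>F t in at_left 1. (eval_fps h (t * \<rho>) - \<tau>) * (1 - t) powr (- lam) = 0"
  proof eventually_elim
    case (elim t)
    have "0 \<le> x / \<rho>" using x \<rho>_pos by simp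
    with elim have "0 \<le> t" by simp
    then have "eval_fps h (t * \<rho>) = \<tau>" using h_mono[of x "t * \<rho>"] h_le[of "t * \<rho>"] elim x \<rho>_pos eq
      by (intro antisym) (auto simp: field_simps)
    then show ?case by simp
  qed
  then have "((\<lambda>t. (eval_fps h (t * \<rho>) - \<tau>) * (1 - t) powr (- lam)) \<longlongrightarrow> 0) (at_left 1)"
    by (rule tendsto_eventually)
  then have "c = 0" using tendsto_unique[OF _ radial_limit] by auto
  then show False using c by simp
qed

lemma norm_H_less: "norm z < \<rho> \<Longrightarrow> norm (H z) < \<tau>"
  using norm_H_le h_less by (meson le_less_trans norm_ge_zero)

lemma \<tau>_pos: "0 < \<tau>"
  using le_less_trans[OF norm_ge_zero norm_H_less[of 0]] \<rho>_pos by simp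

text \<open>
  If a continuation of \<open>H\<close> took the value \<open>\<tau>\<close> at \<open>\<rho> w\<close> with \<open>\<bar>w\<bar> = 1\<close>, \<open>w \<noteq> 1\<close>, then \<open>w\<^sup>n = 1\<close>
  whenever \<open>h\<^sub>n \<noteq> 0\<close>, so \<open>H(z) = H(z w)\<close>, and \<open>H'\<close> would stay bounded near \<open>\<rho>\<close>.
\<close>
lemma continuation_neq:
  assumes \<phi>: "\<phi> holomorphic_on cone_domain \<rho> \<epsilon> \<sigma>" "0 < \<epsilon>" "0 < \<sigma>"
    and eq: "\<And>z. z \<in> ball 0 \<rho> \<Longrightarrow> \<phi> z = H z"
    and z: "norm z = \<rho>" "z \<noteq> of_real \<rho>"
  shows "\<phi> z \<noteq> of_real \<tau>"
proof
  assume \<tau>: "\<phi> z = of_real \<tau>"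
  define w where "w = z / of_real \<rho>"
  have w: "norm w = 1" and zw: "z = of_real \<rho> * w" using z \<rho>_pos by (auto simp: w_def norm_divide)
  have cz: "z \<in> cone_domain \<rho> \<epsilon> \<sigma>" using \<phi> z \<rho>_pos by (intro closed_disc_subset_cone_domain) auto
  have ev: "\<forall>\<^sub>F t in at_left (1::real). t \<in> {0<..<1}" by (intro eventually_at_leftI[of 0]) auto
  have inb: "of_real (t * \<rho>) * w \<in> ball 0 \<rho>" if "t \<in> {0<..<1}" for t
    using that \<rho>_pos w by (simp add: norm_mult)
  have path: "((\<lambda>t. of_real (t * \<rho>) * w) \<longlongrightarrow> z) (at_left 1)"
  proof -
    have "((\<lambda>t. of_real (t * \<rho>) * w) \<longlongrightarrow> of_real (1 * \<rho>) * w) (at_left 1)" by (intro tendsto_intros)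
    then show ?thesis by (simp add: zw)
  qed
  have along: "((\<lambda>t. f (of_real (t * \<rho>) * w)) \<longlongrightarrow> f z) (at_left 1)"
    if "f holomorphic_on cone_domain \<rho> \<epsilon> \<sigma>" for f :: "complex \<Rightarrow> complex"
  proof (rule isCont_tendsto_compose[OF _ path])
    show "isCont f z" using that cz open_cone_domain continuous_on_eq_continuous_at
        holomorphic_on_imp_continuous_on by blast
  qed
  have lim1: "((\<lambda>t. H (of_real (t * \<rho>) * w)) \<longlongrightarrow> of_real \<tau>) (at_left 1)"
    using along[OF \<phi>(1)] unfolding \<tau>
    by (rule Lim_transform_eventually) (use ev in eventually_elim, use eq inb in auto)
  then have "((\<lambda>t. eval_fps h (t * \<rho>) - Re (H (of_real (t * \<rho>) * w))) \<longlongrightarrow> \<tau> - Re (of_real \<tau>)) (at_left 1)"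
    by (intro tendsto_intros h_tendsto)
  then have lim2: "((\<lambda>t. eval_fps h (t * \<rho>) - Re (H (of_real (t * \<rho>) * w))) \<longlongrightarrow> 0) (at_left 1)" by simp
  \<comment> \<open>The difference \<open>h(t \<rho>) - Re H(t \<rho> w)\<close> is a series of
    nonnegative terms \<open>h_k (t \<rho>)^k (1 - Re w^k)\<close>. It tends to \<open>0\<close>,
    hence so does each term, and \<open>\<bar>w\<bar> = 1\<close> turns
    \<open>Re (w ^ n) = 1\<close> into \<open>w ^ n = 1\<close>.\<close>
  have coeff: "w ^ n = 1" if "fps_nth h n \<noteq> 0" for n
  proof -
    have "\<forall>\<^sub>F t in at_left (1::real). fps_nth h n * (t * \<rho>) ^ n * (1 - Re (w ^ n)) \<le>
            eval_fps h (t * \<rho>) - Re (H (of_real (t * \<rho>) * w))"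
      using ev
    proof eventually_elim
      case (elim t)
      then have t: "\<bar>t * \<rho>\<bar> < \<rho>" "0 \<le> t * \<rho>" using \<rho>_pos by (auto simp: abs_mult)
      have "(\<lambda>k. Re (complex_of_real (fps_nth h k) * (of_real (t * \<rho>) * w) ^ k)) sums Re (H (of_real (t * \<rho>) * w))"
        by (intro sums_Re H_sums) (use inb[OF elim] in auto)
      moreover have "Re (complex_of_real (fps_nth h k) * (of_real (t * \<rho>) * w) ^ k) = fps_nth h k * (t * \<rho>) ^ k * Re (w ^ k)" for k
      proof -
        have "complex_of_real (fps_nth h k) * (of_real (t * \<rho>) * w) ^ k = of_real (fps_nth h k * (t * \<rho>) ^ k) * w ^ k"
          by (simp add: power_mult_distrib mult_ac)
        then show ?thesis by (simp only: times_complex.sel Re_complex_of_real Im_complex_of_real mult_zero_left diff_zero)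
      qed
      ultimately have "(\<lambda>k. fps_nth h k * (t * \<rho>) ^ k * Re (w ^ k)) sums Re (H (of_real (t * \<rho>) * w))" by (simp only:)
      from sums_diff[OF h_sums[OF t(1)] this]
      have s: "(\<lambda>k. fps_nth h k * (t * \<rho>) ^ k * (1 - Re (w ^ k))) sums (eval_fps h (t * \<rho>) - Re (H (of_real (t * \<rho>) * w)))"
        by (simp add: algebra_simps)
      have "0 \<le> fps_nth h k * (t * \<rho>) ^ k * (1 - Re (w ^ k))" for k
        using nonneg t complex_Re_le_cmod[of "w ^ k"] w by (intro mult_nonneg_nonneg) (auto simp: norm_power)
      then have "(\<Sum>k\<in>{n}. fps_nth h k * (t * \<rho>) ^ k * (1 - Re (w ^ k))) \<le> suminf (\<lambda>k. fps_nth h k * (t * \<rho>) ^ k * (1 - Re (w ^ k)))"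
        using s by (intro sum_le_suminf) (auto simp: sums_iff)
      then show ?case using s by (simp add: sums_iff)
    qed
    moreover have "((\<lambda>t. fps_nth h n * (t * \<rho>) ^ n * (1 - Re (w ^ n))) \<longlongrightarrow> fps_nth h n * (1 * \<rho>) ^ n * (1 - Re (w ^ n))) (at_left 1)"
      by (intro tendsto_intros)
    ultimately have "fps_nth h n * (1 * \<rho>) ^ n * (1 - Re (w ^ n)) \<le> 0"
      using tendsto_le[OF _ lim2] by (simp add: trivial_limit_at_left_real)
    moreover have "0 < fps_nth h n * (1 * \<rho>) ^ n" using that nonneg[of n] \<rho>_pos by simp
    ultimately have "\<not> 0 < 1 - Re (w ^ n)" using mult_pos_pos by (metis not_le)
    then have "Re (w ^ n) \<ge> 1" by simp
    moreover have n1: "norm (w ^ n) = 1" using w by (simp add: norm_power)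
    ultimately have "Re (w ^ n) = 1" using complex_Re_le_cmod[of "w ^ n"] by simp
    moreover from this have "Im (w ^ n) = 0" using n1 cmod_power2[of "w ^ n"] by simp
    ultimately show ?thesis by (intro complex_eqI) auto
  qed
  have rot: "H (v * w) = H v" if "v \<in> ball 0 \<rho>" for v
  proof -
    have eq: "complex_of_real (fps_nth h n) * (v * w) ^ n = complex_of_real (fps_nth h n) * v ^ n" for n
      using coeff[of n] by (cases "fps_nth h n = 0") (auto simp: power_mult_distrib)
    have "(\<lambda>n. complex_of_real (fps_nth h n) * (v * w) ^ n) sums H (v * w)"
      by (rule H_sums) (use that w in \<open>simp add: norm_mult\<close>)
    then have "(\<lambda>n. complex_of_real (fps_nth h n) * v ^ n) sums H (v * w)" by (simp only: eq)
    then show ?thesis using H_sums[of v] that sums_unique2 by auto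
  qed
  have hol: "H holomorphic_on ball 0 \<rho>" by (rule H_continuation)
  have drot: "deriv H v = w * deriv H (v * w)" if v: "v \<in> ball 0 \<rho>" for v
  proof -
    have "deriv H v = deriv (\<lambda>v. H (v * w)) v"
      by (rule deriv_cong_ev[OF eventually_nhds_in_open[THEN eventually_mono, of "ball 0 \<rho>"]])
        (use v rot in auto)
    also have "(H has_field_derivative deriv H (v * w)) (at (v * w))"
      by (rule holomorphic_derivI[OF hol]) (use v w in \<open>auto simp: norm_mult\<close>)
    then have "((\<lambda>v. H (v * w)) has_field_derivative deriv H (v * w) * w) (at v)"
      by (rule DERIV_chain2[where f=H and g="\<lambda>v. v * w" and x=v and Db=w and s=UNIV])
        (auto intro!: derivative_eq_intros)
    then have "deriv (\<lambda>v. H (v * w)) v = deriv H (v * w) * w" by (rule DERIV_imp_deriv)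
    finally show ?thesis by simp
  qed
  have f': "((\<lambda>z. deriv H z * (1 - z / of_real \<rho>) powr of_real (1 - lam)) \<longlongrightarrow> - of_real lam * of_real c / of_real \<rho>)
       (at (of_real \<rho>) within ball 0 \<rho>)" by (rule H_continuation)
  have L1: "((\<lambda>t. deriv H (of_real (t * \<rho>)) * (1 - of_real (t * \<rho>) / of_real \<rho>) powr of_real (1 - lam)) \<longlongrightarrow>
     - of_real lam * of_real c / of_real \<rho>) (at_left 1)"
    by (rule filterlim_compose[OF f' filterlim_radius[OF \<rho>_pos]])
  have dphi: "deriv \<phi> holomorphic_on cone_domain \<rho> \<epsilon> \<sigma>"
    using \<phi> open_cone_domain holomorphic_deriv by blast
  have dH: "deriv H v = deriv \<phi> v" if "v \<in> ball 0 \<rho>" for v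
    by (rule deriv_cong_ev[OF eventually_nhds_in_open[THEN eventually_mono, of "ball 0 \<rho>"]])
        (use that eq in auto)
  \<comment> \<open>Here \<open>deriv \<phi>\<close> has a finite limit at \<open>z\<close> and
    \<open>1 - lam > 0\<close>, so the limit is \<open>0\<close>, in conflict with the nonzero
    constant of \<open>L1\<close>.\<close>
  have "((\<lambda>t. w * deriv \<phi> (of_real (t * \<rho>) * w) * (1 - of_real (t * \<rho>) / of_real \<rho>) powr of_real (1 - lam)) \<longlongrightarrow>
      w * deriv \<phi> z * 0) (at_left 1)"
    using lam \<rho>_pos
    by (intro tendsto_mult tendsto_const along dphi
        filterlim_compose[OF powr_tendsto_0_disc[of \<rho> "1 - lam" "ball 0 \<rho>"] filterlim_radius]) auto
  then have L2: "((\<lambda>t. deriv H (of_real (t * \<rho>)) * (1 - of_real (t * \<rho>) / of_real \<rho>) powr of_real (1 - lam)) \<longlongrightarrow>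
      w * deriv \<phi> z * 0) (at_left 1)"
  proof (rule Lim_transform_eventually)
    show "\<forall>\<^sub>F t in at_left 1. w * deriv \<phi> (of_real (t * \<rho>) * w) * (1 - of_real (t * \<rho>) / of_real \<rho>) powr of_real (1 - lam) =
        deriv H (of_real (t * \<rho>)) * (1 - of_real (t * \<rho>) / of_real \<rho>) powr of_real (1 - lam)"
      using ev
    proof eventually_elim
      case (elim t)
      have "of_real (t * \<rho>) \<in> ball (0::complex) \<rho>" using elim \<rho>_pos by (simp add: norm_mult)
      from drot[OF this] dH[OF inb[OF elim]] show ?case by simp
    qed
  qed
  have "- of_real lam * of_real c / of_real \<rho> = w * deriv \<phi> z * 0"
    using tendsto_unique[OF _ L1 L2] by simp
  then show False using lam c \<rho>_pos by simp
qed

text \<open>Compactness turns \<open>norm_H_less\<close> and \<open>continuation_neq\<close> into a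
  uniform distance from \<open>\<tau>\<close>: the image of a compact part of the closed disc under
  the continuation is closed and misses \<open>\<tau>\<close>. Thus \<open>G\<close> is evaluated
  away from its singularity unless \<open>z\<close> is near \<open>\<rho>\<close>.\<close>

lemma H_away:
  assumes "0 < \<delta>"
  shows "\<exists>\<delta>'>0. \<forall>z \<in> ball 0 \<rho> - ball (of_real \<rho>) \<delta>. H z \<in> ball 0 \<tau> - ball (of_real \<tau>) \<delta>'"
proof -
  obtain \<epsilon> \<sigma> \<phi> where *: "0 < \<epsilon>" "0 < \<sigma>" "\<phi> holomorphic_on cone_domain \<rho> \<epsilon> \<sigma>"
    "\<And>z. z \<in> ball 0 \<rho> \<Longrightarrow> \<phi> z = H z"
    by (rule H_continuation) (rule that; assumption)
  let ?K = "cball 0 \<rho> - ball (complex_of_real \<rho>) \<delta>"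
  have "of_real \<tau> \<notin> \<phi> ` ?K"
  proof
    assume "of_real \<tau> \<in> \<phi> ` ?K"
    then obtain z where z: "z \<in> ?K" "\<phi> z = of_real \<tau>" by auto
    show False
    proof (cases "norm z < \<rho>")
      case True
      then have "norm (H z) < \<tau>" "H z = of_real \<tau>" using norm_H_less[OF True] *(4)[of z] z by auto
      then show False using \<tau>_pos by simp
    next
      case False
      then have "norm z = \<rho>" "z \<noteq> of_real \<rho>" using z assms by auto
      then show False using continuation_neq[OF *(3,1,2) *(4)] z by blast
    qed
  qed
  moreover have "closed (\<phi> ` ?K)"
    using bounded_off_singularity[OF *(3) \<rho>_pos *(1,2) assms] compact_imp_closed by blast
  ultimately have "of_real \<tau> \<in> - \<phi> ` ?K" "open (- \<phi> ` ?K)" by auto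
  then obtain \<delta>' where "\<delta>' > 0" "ball (of_real \<tau>) \<delta>' \<subseteq> - \<phi> ` ?K"
    using open_contains_ball by blast
  then show ?thesis using * norm_H_less
    by (intro exI[of _ \<delta>']) (force simp: image_iff)
qed

text \<open>\<open>1 - H z / \<tau>\<close> behaves like
  \<open>k * (1 - z / \<rho>) powr lam\<close> with \<open>k = - c / \<tau> > 0\<close>. Inserting
  this into the expansions of \<open>G\<close> and \<open>G'\<close> multiplies the exponents and
  produces the factor \<open>k powr lg\<close>.\<close>

lemma disc_sing_compose:
  assumes g: "cone_sing g \<tau> 0 lg cg"
  shows "disc_sing (eval_fps (map_coeffs complex_of_real g) \<circ> H) \<rho> (lg * lam) (of_real (cg * (- c / \<tau>) powr lg))"
proof -
  define G where "G = eval_fps (map_coeffs complex_of_real g)"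
  let ?y = "\<lambda>z. 1 - z / complex_of_real \<rho>"
  let ?x = "\<lambda>w. 1 - w / complex_of_real \<tau>"
  let ?F = "at (complex_of_real \<rho>) within ball 0 \<rho>"
  define k where "k = - c / \<tau>"
  have k: "k > 0" using c_neg \<tau>_pos by (simp add: k_def divide_neg_pos)
  have dG: "disc_sing G \<tau> lg (of_real cg)" unfolding G_def by (rule disc_sing_cone_sing[OF g])
  have G: "G holomorphic_on ball 0 \<tau>"
     "((\<lambda>z. G z * ?x z powr of_real (- lg)) \<longlongrightarrow> of_real cg) (at (of_real \<tau>) within ball 0 \<tau>)"
     "((\<lambda>z. deriv G z * ?x z powr of_real (1 - lg)) \<longlongrightarrow> - of_real lg * of_real cg / of_real \<tau>)
       (at (of_real \<tau>) within ball 0 \<tau>)"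
     "\<And>\<delta>. \<delta>>0 \<Longrightarrow> bounded (G ` (ball 0 \<tau> - ball (of_real \<tau>) \<delta>))"
     "\<And>\<delta>. \<delta>>0 \<Longrightarrow> bounded (deriv G ` (ball 0 \<tau> - ball (of_real \<tau>) \<delta>))"
    using dG unfolding disc_sing_def by auto
  obtain \<epsilon> \<sigma> \<phi> where H: "0 < \<epsilon>" "0 < \<sigma>" "H holomorphic_on ball 0 \<rho>" "\<phi> holomorphic_on cone_domain \<rho> \<epsilon> \<sigma>"
    "\<And>z. z \<in> ball 0 \<rho> \<Longrightarrow> \<phi> z = H z" "\<And>z. z \<in> ball 0 \<rho> \<Longrightarrow> deriv \<phi> z = deriv H z"
    "((\<lambda>z. (H z - of_real \<tau>) * ?y z powr of_real (- lam)) \<longlongrightarrow> of_real c) ?F"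
    "((\<lambda>z. deriv H z * ?y z powr of_real (1 - lam)) \<longlongrightarrow> - of_real lam * of_real c / of_real \<rho>) ?F"
    by (rule H_continuation) (rule that; assumption)
  have Hb: "H z \<in> ball 0 \<tau>" if "z \<in> ball 0 \<rho>" for z using norm_H_less that by simp
  have fl: "filterlim H (at (of_real \<tau>) within ball 0 \<tau>) ?F"
    unfolding filterlim_at using H_tendsto
  proof (intro conjI)
    have "H z \<in> ball 0 \<tau> \<and> H z \<noteq> of_real \<tau>" if "z \<in> ball 0 \<rho>" for z
      using norm_H_less[of z] that by auto
    then show "\<forall>\<^sub>F z in ?F. H z \<in> ball 0 \<tau> \<and> H z \<noteq> of_real \<tau>"
      by (auto simp: eventually_at_filter)
  qed
  have ratio: "((\<lambda>z. ?x (H z) * ?y z powr of_real (- lam)) \<longlongrightarrow> of_real k) ?F"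
  proof -
    have "((\<lambda>z. (H z - of_real \<tau>) * ?y z powr of_real (- lam) * (- 1 / of_real \<tau>)) \<longlongrightarrow> of_real c * (- 1 / of_real \<tau>)) ?F"
      by (intro tendsto_mult H tendsto_const)
    moreover have "(H z - of_real \<tau>) * ?y z powr of_real (- lam) * (- 1 / of_real \<tau>) = ?x (H z) * ?y z powr of_real (- lam)" for z
      using \<tau>_pos by (simp add: field_simps)
    ultimately show ?thesis by (simp add: k_def)
  qed
  \<comment> \<open>The limit \<open>k\<close> is positive, so the power is continuous there. The
    power of the product splits because both bases lie in the right half plane.\<close>
  have pw: "((\<lambda>z. ?x (H z) powr of_real p * ?y z powr of_real (- (lam * p))) \<longlongrightarrow> of_real (k powr p)) ?F" for p
  proof -
    have "((\<lambda>z. (?x (H z) * ?y z powr of_real (- lam)) powr of_real p) \<longlongrightarrow> of_real k powr of_real p) ?F"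
      using k by (intro tendsto_powr_complex ratio tendsto_const) auto
    then have "((\<lambda>z. (?x (H z) * ?y z powr of_real (- lam)) powr of_real p) \<longlongrightarrow> of_real (k powr p)) ?F"
      using k by (simp add: powr_of_real)
    then show ?thesis
    proof (rule Lim_transform_eventually)
      have "(?x (H z) * ?y z powr of_real (- lam)) powr of_real p = ?x (H z) powr of_real p * ?y z powr of_real (- (lam * p))"
        if "z \<in> ball 0 \<rho>" for z
        using lam by (intro powr_mult_powr_right_half_plane disc_Re_pos Hb that) auto
      then show "\<forall>\<^sub>F z in ?F. (?x (H z) * ?y z powr of_real (- lam)) powr of_real p = ?x (H z) powr of_real p * ?y z powr of_real (- (lam * p))"
        unfolding eventually_at_filter by (intro always_eventually) blast
    qed
  qed
  have x0: "?x (H z) \<noteq> 0" if "z \<in> ball 0 \<rho>" for z using disc_nonzero[OF Hb[OF that]] .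
  have cancel: "?x (H z) powr of_real (- p) * ?x (H z) powr of_real p = 1" if "z \<in> ball 0 \<rho>" for z p
    using x0[OF that] by (simp add: powr_add[symmetric] flip: of_real_add of_real_minus)
  have 1: "((\<lambda>z. (G \<circ> H) z * ?y z powr of_real (- (lg * lam))) \<longlongrightarrow> of_real (cg * k powr lg)) ?F"
  proof -
    have "((\<lambda>z. (G (H z) * ?x (H z) powr of_real (- lg)) * (?x (H z) powr of_real lg * ?y z powr of_real (- (lam * lg))))
       \<longlongrightarrow> of_real cg * of_real (k powr lg)) ?F"
      by (intro tendsto_mult pw filterlim_compose[OF G(2) fl])
    then have "((\<lambda>z. (G \<circ> H) z * ?y z powr of_real (- (lg * lam))) \<longlongrightarrow> of_real cg * of_real (k powr lg)) ?F"
    proof (rule Lim_transform_eventually)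
      have "(G (H z) * ?x (H z) powr of_real (- lg)) * (?x (H z) powr of_real lg * ?y z powr of_real (- (lam * lg)))
         = (G \<circ> H) z * ?y z powr of_real (- (lg * lam))" if "z \<in> ball 0 \<rho>" for z
      proof -
        have "(G (H z) * ?x (H z) powr of_real (- lg)) * (?x (H z) powr of_real lg * ?y z powr of_real (- (lam * lg)))
          = G (H z) * ?y z powr of_real (- (lam * lg)) * (?x (H z) powr of_real (- lg) * ?x (H z) powr of_real lg)"
          by (simp only: mult_ac)
        then show ?thesis unfolding cancel[OF that] by (simp add: mult.commute)
      qed
      then show "\<forall>\<^sub>F z in ?F. (G (H z) * ?x (H z) powr of_real (- lg)) * (?x (H z) powr of_real lg * ?y z powr of_real (- (lam * lg)))
         = (G \<circ> H) z * ?y z powr of_real (- (lg * lam))"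
        unfolding eventually_at_filter by (intro always_eventually) blast
    qed
    then show ?thesis by simp
  qed
  have d: "deriv (G \<circ> H) z = deriv G (H z) * deriv H z" if "z \<in> ball 0 \<rho>" for z
    by (intro deriv_chain holomorphic_on_imp_differentiable_at[OF H(3)]
      holomorphic_on_imp_differentiable_at[OF G(1)]) (use that Hb[OF that] in auto)
  have 2: "((\<lambda>z. deriv (G \<circ> H) z * ?y z powr of_real (1 - lg * lam)) \<longlongrightarrow>
     - of_real (lg * lam) * of_real (cg * k powr lg) / of_real \<rho>) ?F"
  proof -
    have "((\<lambda>z. (deriv G (H z) * ?x (H z) powr of_real (1 - lg)) * (?x (H z) powr of_real (lg - 1) * ?y z powr of_real (- (lam * (lg - 1))))
         * (deriv H z * ?y z powr of_real (1 - lam)))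
       \<longlongrightarrow> (- of_real lg * of_real cg / of_real \<tau>) * of_real (k powr (lg - 1)) * (- of_real lam * of_real c / of_real \<rho>)) ?F"
      by (intro tendsto_mult pw filterlim_compose[OF G(3) fl] H(8))
    \<comment> \<open>Since \<open>c / \<tau> = - k\<close>, the derivative of \<open>H\<close>
      supplies the factor that raises \<open>k powr (lg - 1)\<close> to
      \<open>k powr lg\<close>.\<close>
    moreover have "(- of_real lg * of_real cg / of_real \<tau>) * of_real (k powr (lg - 1)) * (- of_real lam * of_real c / of_real \<rho>)
       = - of_real (lg * lam) * (of_real (cg * k powr lg) :: complex) / of_real \<rho>"
    proof -
      have "k powr lg = k * k powr (lg - 1)" using k by (simp add: powr_diff)
      then have kp: "k powr lg = - c / \<tau> * k powr (lg - 1)" by (simp only: k_def)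
      have "(- lg * cg / \<tau>) * k powr (lg - 1) * (- lam * c / \<rho>) = - (lg * lam) * (cg * k powr lg) / \<rho>"
        using \<tau>_pos \<rho>_pos unfolding kp by (simp add: field_simps)
      then have "complex_of_real ((- lg * cg / \<tau>) * k powr (lg - 1) * (- lam * c / \<rho>)) = of_real (- (lg * lam) * (cg * k powr lg) / \<rho>)"
        by (rule arg_cong)
      then show ?thesis by simp
    qed
    ultimately have "((\<lambda>z. (deriv G (H z) * ?x (H z) powr of_real (1 - lg)) * (?x (H z) powr of_real (lg - 1) * ?y z powr of_real (- (lam * (lg - 1))))
         * (deriv H z * ?y z powr of_real (1 - lam)))
       \<longlongrightarrow> - of_real (lg * lam) * of_real (cg * k powr lg) / of_real \<rho>) ?F" by simp
    then show ?thesis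
    proof (rule Lim_transform_eventually)
      have "(deriv G (H z) * ?x (H z) powr of_real (1 - lg)) * (?x (H z) powr of_real (lg - 1) * ?y z powr of_real (- (lam * (lg - 1))))
         * (deriv H z * ?y z powr of_real (1 - lam)) = deriv (G \<circ> H) z * ?y z powr of_real (1 - lg * lam)" if "z \<in> ball 0 \<rho>" for z
      proof -
        have "(deriv G (H z) * ?x (H z) powr of_real (1 - lg)) * (?x (H z) powr of_real (lg - 1) * ?y z powr of_real (- (lam * (lg - 1))))
         * (deriv H z * ?y z powr of_real (1 - lam)) = (deriv G (H z) * deriv H z) *
          (?x (H z) powr of_real (- (lg - 1)) * ?x (H z) powr of_real (lg - 1)) *
          (?y z powr of_real (- (lam * (lg - 1))) * ?y z powr of_real (1 - lam))"
          by (simp only: mult_ac minus_diff_eq)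
        also have "?y z powr of_real (- (lam * (lg - 1))) * ?y z powr of_real (1 - lam) = ?y z powr of_real (1 - lg * lam)"
          unfolding powr_add[symmetric] of_real_add[symmetric] by (simp add: algebra_simps)
        finally show ?thesis unfolding cancel[OF that] d[OF that] by simp
      qed
      then show "\<forall>\<^sub>F z in ?F. (deriv G (H z) * ?x (H z) powr of_real (1 - lg)) * (?x (H z) powr of_real (lg - 1) * ?y z powr of_real (- (lam * (lg - 1))))
         * (deriv H z * ?y z powr of_real (1 - lam)) = deriv (G \<circ> H) z * ?y z powr of_real (1 - lg * lam)"
        unfolding eventually_at_filter by (intro always_eventually) blast
    qed
  qed
  have 3: "bounded ((G \<circ> H) ` (ball 0 \<rho> - ball (of_real \<rho>) \<delta>)) \<and>
     bounded (deriv (G \<circ> H) ` (ball 0 \<rho> - ball (of_real \<rho>) \<delta>))" if \<delta>: "\<delta> > 0" for \<delta>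
  proof -
    let ?K = "ball 0 \<rho> - ball (complex_of_real \<rho>) \<delta>"
    obtain \<delta>' where \<delta>': "\<delta>' > 0" "H ` ?K \<subseteq> ball 0 \<tau> - ball (of_real \<tau>) \<delta>'"
      using H_away[OF \<delta>] by blast
    have b1: "bounded ((\<lambda>z. G (H z)) ` ?K)" "bounded ((\<lambda>z. deriv G (H z)) ` ?K)"
      using bounded_subset[OF G(4)[OF \<delta>'(1)], of "(\<lambda>z. G (H z)) ` ?K"]
        bounded_subset[OF G(5)[OF \<delta>'(1)], of "(\<lambda>z. deriv G (H z)) ` ?K"] \<delta>'(2) by blast+
    have "deriv \<phi> holomorphic_on cone_domain \<rho> \<epsilon> \<sigma>" using H(4) open_cone_domain holomorphic_deriv by blast
    then have "bounded (deriv \<phi> ` (cball 0 \<rho> - ball (of_real \<rho>) \<delta>))"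
      by (intro compact_imp_bounded bounded_off_singularity[of _ \<rho> \<epsilon> \<sigma>] H \<rho>_pos \<delta>)
    then have "bounded (deriv H ` ?K)"
      by (rule bounded_subset) (use H(6) in \<open>force simp: image_iff\<close>)
    then have "bounded ((\<lambda>z. deriv G (H z) * deriv H z) ` ?K)" by (intro bounded_image_mult b1)
    then have "bounded (deriv (G \<circ> H) ` ?K)" by (rule bounded_subset) (use d in \<open>auto simp: image_iff\<close>)
    then show ?thesis using b1 by (simp add: o_def)
  qed
  have "(G \<circ> H) holomorphic_on ball 0 \<rho>"
    by (rule holomorphic_on_compose_gen[OF H(3) G(1)]) (use Hb in auto)
  then show ?thesis unfolding disc_sing_def G_def[symmetric] k_def[symmetric]
    using \<rho>_pos 1 2 3 by (intro conjI allI impI) auto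
qed

end

section \<open>Transfer to coefficients\<close>

text \<open>From \<open>sin x \<ge> x - x^3 / 6\<close>: as \<open>x \<le> pi / 2 \<le> 1.6\<close>,
  the cube is at most \<open>3 * x\<close>.\<close>

lemma half_le_sin:
  fixes x :: real
  assumes "0 \<le> x" "x \<le> pi / 2"
  shows "x / 2 \<le> sin x"
proof -
  have "x \<le> 1.6" using assms pi_less_4 pi_approx by simp
  then have "x * x \<le> 1.6 * 1.6" using assms by (intro mult_mono) auto
  then have "x * (x * x) \<le> x * 3" using assms by (intro mult_left_mono) auto
  then have "x ^ 3 \<le> 3 * x" by (simp add: power3_eq_cube mult_ac)
  moreover have "\<bar>sin x - (\<Sum>m<3. sin_coeff m * x ^ m)\<bar> \<le> inverse (fact 3) * \<bar>x\<bar> ^ 3"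
    by (rule Maclaurin_sin_bound)
  moreover have "(\<Sum>m<3. sin_coeff m * x ^ m) = x"
    by (simp add: eval_nat_numeral sin_coeff_def)
  ultimately show ?thesis using assms by (simp add: fact_numeral abs_if split: if_splits)
qed

text \<open>The squared modulus equals
  \<open>d\<^sup>2 + 4 * (1 - d) * (sin (pi * t))\<^sup>2\<close>, and \<open>d \<le> 1 / 2\<close>
  keeps the second term at least as large as the squared distance of \<open>t\<close> from the
  integers. So on the circle of radius \<open>1 - d\<close> the distance to \<open>1\<close> is at
  least of order \<open>d\<close> plus arc length.\<close>

lemma norm_one_minus_circle_ge:
  fixes t d :: real
  assumes t: "0 \<le> t" "t \<le> 1" and d: "0 < d" "d \<le> 1 / 2"
  shows "(d + min t (1 - t)) / 2 \<le> norm (1 - of_real (1 - d) * exp (2 * of_real pi * \<i> * of_real t))"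
proof -
  define m where "m = min t (1 - t)"
  have m: "0 \<le> m" "m \<le> 1 / 2" using t by (auto simp: m_def min_def)
  have sin: "sin (pi * t) \<ge> m"
  proof -
    have "sin (pi * t) = sin (pi * m)"
      unfolding m_def min_def by (auto simp: algebra_simps sin_diff)
    moreover have "pi * m / 2 \<le> sin (pi * m)"
      using m by (intro half_le_sin) (auto intro: mult_left_mono[of m "1/2" pi, simplified])
    moreover have "2 * m \<le> pi * m" using m pi_gt3 by (intro mult_right_mono) auto
    ultimately show ?thesis by simp
  qed
  have e: "exp (2 * of_real pi * \<i> * of_real t) = cis (2 * (pi * t))"
    by (simp add: cis_conv_exp mult_ac)
  have "(norm (1 - of_real (1 - d) * cis (2 * (pi * t))))\<^sup>2 =
     (1 - (1 - d) * cos (2 * (pi * t)))\<^sup>2 + ((1 - d) * sin (2 * (pi * t)))\<^sup>2"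
    by (simp add: cmod_power2 del: of_real_diff)
  also have "\<dots> = 1 - 2 * (1 - d) * cos (2 * (pi * t)) + (1 - d)\<^sup>2"
    unfolding power_mult_distrib sin_squared_eq by (simp add: power2_eq_square algebra_simps)
  also have "\<dots> = d\<^sup>2 + 4 * (1 - d) * (sin (pi * t))\<^sup>2"
    unfolding cos_double_sin by (simp add: power2_eq_square algebra_simps)
  finally have eq: "(norm (1 - of_real (1 - d) * cis (2 * (pi * t))))\<^sup>2 = d\<^sup>2 + 4 * (1 - d) * (sin (pi * t))\<^sup>2" .
  have "m\<^sup>2 \<le> (sin (pi * t))\<^sup>2" using sin m by (intro power_mono) auto
  moreover have "1 * (sin (pi * t))\<^sup>2 \<le> 4 * (1 - d) * (sin (pi * t))\<^sup>2" using d by (intro mult_right_mono) auto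
  ultimately have "d\<^sup>2 + m\<^sup>2 \<le> (norm (1 - of_real (1 - d) * cis (2 * (pi * t))))\<^sup>2" using eq by simp
  moreover have "((d + m) / 2)\<^sup>2 \<le> d\<^sup>2 + m\<^sup>2"
  proof -
    have "((d + m) / 2)\<^sup>2 = (2 * (d\<^sup>2 + m\<^sup>2) - (d - m)\<^sup>2) / 4"
      by (simp add: power2_eq_square field_simps)
    moreover have "x \<le> y" if "x = (2 * y - z) / 4" "0 \<le> z" "0 \<le> y" for x y z :: real using that by simp
    from this[OF calculation] show ?thesis by simp
  qed
  ultimately have "((d + m) / 2)\<^sup>2 \<le> (norm (1 - of_real (1 - d) * cis (2 * (pi * t))))\<^sup>2" by simp
  then have "(d + m) / 2 \<le> norm (1 - of_real (1 - d) * cis (2 * (pi * t)))" by (rule power2_le_imp_le) auto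
  then show ?thesis unfolding e m_def .
qed

text \<open>The two ends of \<open>[0, 1]\<close> are the same point of the circle, approached from
  both sides. As \<open>a > 1\<close>, both integrals are of order
  \<open>d powr (1 - a)\<close>.\<close>

lemma has_integral_shifted_powr:
  fixes a d :: real
  assumes "0 < d" "1 < a"
  shows "((\<lambda>t. (d + t) powr - a) has_integral (d powr (1 - a) - (d + 1) powr (1 - a)) / (a - 1)) {0..1}"
    and "((\<lambda>t. (d + (1 - t)) powr - a) has_integral (d powr (1 - a) - (d + 1) powr (1 - a)) / (a - 1)) {0..1}"
proof -
  have flip: "x / (1 - a) - y / (1 - a) = (y - x) / (a - 1)" for x y
    by (metis diff_divide_distrib minus_diff_eq minus_divide_divide)
  have D1: "((\<lambda>t. (d + t) powr (1 - a) / (1 - a)) has_real_derivative (d + t) powr - a) (at t)"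
    if "t \<in> {0..1}" for t
  proof -
    have "((\<lambda>t. d + t) has_real_derivative 1) (at t)" by (auto intro!: derivative_eq_intros)
    from DERIV_cdivide[OF DERIV_fun_powr[OF this, of "1 - a"], of "1 - a"] show ?thesis
      using assms that by simp
  qed
  have D2: "((\<lambda>t. - ((d + (1 - t)) powr (1 - a)) / (1 - a)) has_real_derivative (d + (1 - t)) powr - a) (at t)"
    if "t \<in> {0..1}" for t
  proof -
    have "((\<lambda>t. d + (1 - t)) has_real_derivative (- 1)) (at t)" by (auto intro!: derivative_eq_intros)
    from DERIV_cdivide[OF DERIV_minus[OF DERIV_fun_powr[OF this, of "1 - a"]], of "1 - a"] show ?thesis
      using assms that by simp
  qed
  have "((\<lambda>t. (d + t) powr - a) has_integral
     ((d + 1) powr (1 - a) / (1 - a) - (d + 0) powr (1 - a) / (1 - a))) {0..1}"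
    using has_field_derivative_at_within[OF D1]
    by (intro fundamental_theorem_of_calculus) (simp_all only: has_real_derivative_iff_has_vector_derivative zero_le_one)
  moreover have "(d + 1) powr (1 - a) / (1 - a) - (d + 0) powr (1 - a) / (1 - a) = (d powr (1 - a) - (d + 1) powr (1 - a)) / (a - 1)"
    unfolding flip by simp
  ultimately show "((\<lambda>t. (d + t) powr - a) has_integral (d powr (1 - a) - (d + 1) powr (1 - a)) / (a - 1)) {0..1}" by simp
  have "((\<lambda>t. (d + (1 - t)) powr - a) has_integral
     (- ((d + (1 - 1)) powr (1 - a)) / (1 - a) - (- ((d + (1 - 0)) powr (1 - a)) / (1 - a)))) {0..1}"
    using has_field_derivative_at_within[OF D2]
    by (intro fundamental_theorem_of_calculus) (simp_all only: has_real_derivative_iff_has_vector_derivative zero_le_one)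
  moreover have "(- ((d + (1 - 1)) powr (1 - a)) / (1 - a) - (- ((d + (1 - 0)) powr (1 - a)) / (1 - a))) = (d powr (1 - a) - (d + 1) powr (1 - a)) / (a - 1)"
    unfolding flip by simp
  ultimately show "((\<lambda>t. (d + (1 - t)) powr - a) has_integral (d powr (1 - a) - (d + 1) powr (1 - a)) / (a - 1)) {0..1}" by simp
qed

text \<open>Cauchy's formula with an integrable majorant on the circle. A bound by the maximum would
  lose a factor of order \<open>n\<close> in the application.\<close>

lemma Cauchy_coefficient_bound:
  assumes hol: "f holomorphic_on ball 0 \<rho>" and R: "0 < R" "R < \<rho>"
    and g: "(g has_integral J) {0..1}"
    and le: "\<And>t. t \<in> {0..1} \<Longrightarrow> norm (f (of_real R * exp (2 * of_real pi * \<i> * of_real t))) \<le> g t"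
  shows "norm ((deriv ^^ n) f 0 / fact n) \<le> J / R ^ n"
proof -
  let ?e = "\<lambda>t::real. exp (2 * of_real pi * \<i> * of_real t)"
  have cont: "continuous_on (cball 0 R) f" "f holomorphic_on ball 0 R"
    using hol R by (auto intro!: holomorphic_on_imp_continuous_on[OF holomorphic_on_subset[OF hol]]
        holomorphic_on_subset[OF hol])
  let ?i = "(2 * pi * \<i>) / (fact n) * (deriv ^^ n) f 0"
  have "((\<lambda>u. f u / (u-0) ^ (Suc n)) has_contour_integral ?i) (circlepath 0 R)"
    by (rule Cauchy_has_contour_integral_higher_derivative_circlepath[OF cont]) (use R in auto)
  then have hi: "((\<lambda>t. f (circlepath 0 R t) / (circlepath 0 R t) ^ Suc n *
      vector_derivative (circlepath 0 R) (at t within {0..1})) has_integral ?i) {0..1}"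
    unfolding has_contour_integral_def by simp
  have gi: "((\<lambda>t. (2 * pi / R ^ n) * g t) has_integral (2 * pi / R ^ n) * J) {0..1}"
    by (intro has_integral_mult_right g)
  have "norm ?i \<le> (2 * pi / R ^ n) * J"
  proof -
    have "norm (integral {0..1} (\<lambda>t. f (circlepath 0 R t) / (circlepath 0 R t) ^ Suc n *
      vector_derivative (circlepath 0 R) (at t within {0..1}))) \<le> integral {0..1} (\<lambda>t. (2 * pi / R ^ n) * g t)"
    proof (rule integral_norm_bound_integral)
      fix t :: real assume t: "t \<in> {0..1}"
      have "norm (f (circlepath 0 R t) / (circlepath 0 R t) ^ Suc n *
         vector_derivative (circlepath 0 R) (at t within {0..1})) = (2 * pi / R ^ n) * norm (f (of_real R * ?e t))"
      proof -
        have vd: "vector_derivative (circlepath 0 R) (at t within {0..1}) = 2 * pi * \<i> * R * ?e t"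
          using t by (simp add: vector_derivative_circlepath01)
        have cp: "circlepath 0 R t = of_real R * ?e t" by (simp add: circlepath)
        show ?thesis unfolding vd cp using R
          by (simp add: norm_mult norm_divide norm_power field_simps)
      qed
      also have "\<dots> \<le> (2 * pi / R ^ n) * g t" using le[OF t] R by (intro mult_left_mono) auto
      finally show "norm (f (circlepath 0 R t) / (circlepath 0 R t) ^ Suc n *
         vector_derivative (circlepath 0 R) (at t within {0..1})) \<le> (2 * pi / R ^ n) * g t" .
    qed (use hi gi in \<open>auto simp: integrable_on_def\<close>)
    then show ?thesis unfolding integral_unique[OF hi] integral_unique[OF gi] .
  qed
  then have "2 * pi * norm ((deriv ^^ n) f 0 / fact n) \<le> 2 * pi * (J / R ^ n)"
    by (simp add: norm_mult norm_divide)
  then show ?thesis by (subst (asm) mult_le_cancel_left_pos) auto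
qed

lemma higher_deriv_binomial:
  fixes z :: complex
  assumes "z \<in> ball 0 \<rho>"
  shows "(deriv ^^ n) (\<lambda>z. (1 - z / of_real \<rho>) powr of_real (- a)) z =
    of_real (pochhammer a n / \<rho> ^ n) * (1 - z / of_real \<rho>) powr of_real (- a - real n)"
  using assms
proof (induction n arbitrary: z)
  case (Suc n)
  have \<rho>: "0 < \<rho>" using Suc.prems by (metis centre_in_ball empty_iff ball_eq_empty not_le)
  let ?p = "\<lambda>z. of_real (pochhammer a n / \<rho> ^ n) * (1 - z / complex_of_real \<rho>) powr of_real (- a - real n)"
  have "(deriv ^^ Suc n) (\<lambda>z. (1 - z / of_real \<rho>) powr of_real (- a)) z = deriv ?p z"
    unfolding funpow.simps o_def
    by (rule deriv_cong_ev[OF eventually_nhds_in_open[THEN eventually_mono, of "ball 0 \<rho>"]]) (use Suc in auto)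
  also have "\<dots> = of_real (pochhammer a (Suc n) / \<rho> ^ Suc n) * (1 - z / of_real \<rho>) powr of_real (- a - real (Suc n))"
  proof (rule DERIV_imp_deriv)
    have "1 - z / of_real \<rho> \<notin> \<real>\<^sub>\<le>\<^sub>0" using disc_Re_pos[OF Suc.prems] by (auto simp: complex_nonpos_Reals_iff)
    then have "(?p has_field_derivative of_real (pochhammer a n / \<rho> ^ n) *
       ((- (1 / of_real \<rho>)) * (of_real (- a - real n) * (1 - z / of_real \<rho>) powr (of_real (- a - real n) - 1)))) (at z)"
      using \<rho> by (auto intro!: derivative_eq_intros simp: mult_ac)
    moreover have "complex_of_real (- a - real n) - 1 = of_real (- a - real (Suc n))" by simp
    moreover have "of_real (pochhammer a n / \<rho> ^ n) * ((- (1 / of_real \<rho>)) * (of_real (- a - real n) * w)) =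
      of_real (pochhammer a (Suc n) / \<rho> ^ Suc n) * w" for w :: complex
      using \<rho> by (simp add: pochhammer_Suc field_simps)
    ultimately show "(?p has_field_derivative of_real (pochhammer a (Suc n) / \<rho> ^ Suc n) * (1 - z / of_real \<rho>) powr of_real (- a - real (Suc n))) (at z)"
      by (simp only:)
  qed
  finally show ?case .
qed simp

text \<open>\<open>rGamma_series a n\<close> is \<open>pochhammer a (n + 1)\<close> divided by
  \<open>n! * n powr a\<close> and tends to \<open>1 / Gamma a\<close>; the surplus factor
  \<open>a + n\<close> is traded for \<open>n\<close>.\<close>

lemma pochhammer_asymp:
  fixes a :: real
  assumes "0 < a"
  shows "(\<lambda>n. pochhammer a n / fact n / real n powr (a - 1)) \<longlonglongrightarrow> 1 / Gamma a"
proof -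
  have "(\<lambda>n. rGamma_series a n * (real n / (a + real n))) \<longlonglongrightarrow> rGamma a * 1"
  proof (intro tendsto_mult rGamma_series_LIMSEQ)
    show "(\<lambda>n. real n / (a + real n)) \<longlonglongrightarrow> 1" by real_asymp
  qed
  moreover have "\<forall>\<^sub>F n in sequentially. rGamma_series a n * (real n / (a + real n)) = pochhammer a n / fact n / real n powr (a - 1)"
    using eventually_gt_at_top[of 0]
  proof eventually_elim
    case (elim n)
    have "exp (a * ln (real n)) = real n powr (a - 1) * real n"
      using elim by (simp add: powr_def algebra_simps exp_diff)
    moreover have "p * u / (f * (q * v)) * (v / u) = p / f / q" if "u \<noteq> 0" "v \<noteq> 0" for p u f q v :: real
      using that by (simp add: field_simps)
    ultimately show ?case using elim assms by (simp add: rGamma_series_def pochhammer_Suc)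
  qed
  ultimately have "(\<lambda>n. pochhammer a n / fact n / real n powr (a - 1)) \<longlonglongrightarrow> rGamma a * 1"
    by (rule Lim_transform_eventually)
  then show ?thesis by (simp add: rGamma_inverse_Gamma inverse_eq_divide)
qed

text \<open>
  Passing from \<open>F\<close> to \<open>F'\<close> makes the exponent smaller than \<open>-1\<close>. Then the error term can be integrated
  over the circle of radius \<open>\<rho> (1 - 1/n)\<close>, and no contour outside the disc of convergence is needed.
\<close>
lemma singularity_transfer:
  assumes F: "disc_sing F \<rho> lam C" and lam: "lam < 0"
  shows "(\<lambda>n. (deriv ^^ n) F 0 / fact n * of_real (\<rho> ^ n / real n powr (- lam - 1))) \<longlonglongrightarrow> C / of_real (Gamma (- lam))"
proof -
  define a where "a = 1 - lam"
  have a: "1 < a" using lam by (simp add: a_def)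
  define K where "K = - of_real lam * C / of_real \<rho>"
  let ?y = "\<lambda>z. 1 - z / complex_of_real \<rho>"
  let ?F = "at (complex_of_real \<rho>) within ball 0 \<rho>"
  \<comment> \<open>\<open>D\<close> is the error of \<open>F'\<close> after removal of its main
    term, whose coefficients are known explicitly.\<close>
  define D where "D z = deriv F z - K * ?y z powr of_real (- a)" for z
  have \<rho>: "0 < \<rho>" and hol: "F holomorphic_on ball 0 \<rho>"
    and lim: "((\<lambda>z. deriv F z * ?y z powr of_real a) \<longlongrightarrow> K) ?F"
    and bdd: "\<And>\<delta>. \<delta> > 0 \<Longrightarrow> bounded (deriv F ` (ball 0 \<rho> - ball (of_real \<rho>) \<delta>))"
    using F unfolding disc_sing_def K_def a_def by auto
  have y0: "?y z \<noteq> 0" if "z \<in> ball 0 \<rho>" for z using disc_nonzero[OF that] .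
  have hol': "deriv F holomorphic_on ball 0 \<rho>" using hol by (intro holomorphic_deriv) auto
  have slit: "?y z \<notin> \<real>\<^sub>\<le>\<^sub>0" if "z \<in> ball 0 \<rho>" for z
    using disc_Re_pos[OF that] by (auto simp: complex_nonpos_Reals_iff)
  have holy: "(\<lambda>z. ?y z powr of_real (- a)) holomorphic_on ball 0 \<rho>"
    using \<rho> slit by (intro holomorphic_intros) auto
  have holD: "D holomorphic_on ball 0 \<rho>"
    unfolding D_def by (intro holomorphic_on_diff hol' holomorphic_on_mult holy holomorphic_on_const)
  have ny: "norm (?y z) = norm (z - of_real \<rho>) / \<rho>" for z
  proof -
    have "?y z = - ((z - of_real \<rho>) / of_real \<rho>)" using \<rho> by (simp add: field_simps)
    then show ?thesis using \<rho> by (simp only: norm_minus_cancel norm_divide norm_of_real abs_of_pos)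
  qed
  \<comment> \<open>Near \<open>\<rho>\<close> the limit gives the factor \<open>e\<close>;
    elsewhere both parts of \<open>D\<close> are bounded, uniformly up to the circle.\<close>
  have D_bound: "\<exists>B\<ge>0. \<forall>z\<in>ball 0 \<rho>. norm (D z) \<le> e * norm (?y z) powr - a + B" if e: "0 < e" for e
  proof -
    have "((\<lambda>z. deriv F z * ?y z powr of_real a - K) \<longlongrightarrow> K - K) ?F"
      by (intro tendsto_diff lim tendsto_const)
    then have "\<forall>\<^sub>F z in ?F. dist (deriv F z * ?y z powr of_real a - K) (K - K) < e"
      by (rule tendstoD[OF _ e])
    then obtain \<delta> where \<delta>: "\<delta> > 0" "\<And>z. z \<in> ball 0 \<rho> \<Longrightarrow> z \<noteq> of_real \<rho> \<Longrightarrow> dist z (of_real \<rho>) < \<delta> \<Longrightarrow>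
        dist (deriv F z * ?y z powr of_real a - K) (K - K) < e"
      unfolding eventually_at by blast
    obtain b where b: "b > 0" "\<forall>w \<in> deriv F ` (ball 0 \<rho> - ball (of_real \<rho>) \<delta>). norm w \<le> b"
      using bdd[OF \<delta>(1)] unfolding bounded_pos by blast
    define B where "B = b + norm K * (\<delta> / \<rho>) powr - a"
    have "norm (D z) \<le> e * norm (?y z) powr - a + B" if z: "z \<in> ball 0 \<rho>" for z
    proof (cases "norm (z - of_real \<rho>) < \<delta>")
      case True
      have "D z = (deriv F z * ?y z powr of_real a - K) * ?y z powr of_real (- a)"
        using y0[OF z] unfolding D_def by (simp add: powr_minus field_simps)
      then have "norm (D z) = norm (deriv F z * ?y z powr of_real a - K) * norm (?y z) powr - a"
        using y0[OF z] by (simp add: norm_mult norm_powr_real_powr' del: of_real_minus)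
      also have "\<dots> \<le> e * norm (?y z) powr - a"
      proof (intro mult_right_mono)
        have "z \<noteq> of_real \<rho>" using z by auto
        then show "norm (deriv F z * ?y z powr of_real a - K) \<le> e"
          using \<delta>(2)[OF z] True by (simp add: dist_norm)
      qed simp
      finally show ?thesis using b unfolding B_def by (simp add: add_increasing2)
    next
      case False
      have "norm (D z) \<le> norm (deriv F z) + norm (K * ?y z powr of_real (- a))"
        unfolding D_def by (rule norm_triangle_ineq4)
      also have "norm (K * ?y z powr of_real (- a)) = norm K * norm (?y z) powr - a"
        using y0[OF z] by (simp add: norm_mult norm_powr_real_powr' del: of_real_minus)
      also have "norm (?y z) powr - a \<le> (\<delta> / \<rho>) powr - a"
        unfolding ny using False \<rho> \<delta> a by (intro powr_mono2') (auto simp: divide_right_mono)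
      also have "norm (deriv F z) \<le> b"
        using z False by (intro b(2)[rule_format] imageI) (auto simp: dist_norm norm_minus_commute)
      finally have "norm (D z) \<le> B" unfolding B_def by (simp add: mult_left_mono)
      then show ?thesis using e by (simp add: add_increasing)
    qed
    moreover have "B \<ge> 0" using b unfolding B_def by simp
    ultimately show ?thesis by blast
  qed
  define q where "q n = (1 - 1 / real n) ^ n" for n
  have q_lim: "q \<longlonglongrightarrow> exp (- 1)"
    unfolding q_def using tendsto_exp_limit_sequentially[of "-1::real"] by simp
  have D0: "(\<lambda>n. (deriv ^^ n) D 0 / fact n * of_real (\<rho> ^ n / real n powr (a - 1))) \<longlonglongrightarrow> 0"
  proof (rule tendstoI)
    fix e :: real assume e: "0 < e"
    \<comment> \<open>\<open>L\<close> eventually bounds \<open>1 / q n\<close>, as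
      \<open>q n\<close> tends to \<open>exp (- 1)\<close>. \<open>Q\<close> collects
      \<open>2 powr a\<close> from the lower bound of the distance to the singularity and
      \<open>2 / (a - 1)\<close> from the two ends of the parameter interval.\<close>
    define L where "L = 2 * exp (1 :: real)"
    define Q where "Q = 2 powr a * (2 / (a - 1))"
    have Q: "Q > 0" using a by (simp add: Q_def)
    define e' where "e' = e / (2 * L * Q)"
    have e': "e' > 0" using e Q by (simp add: e'_def L_def)
    obtain B where B: "B \<ge> 0" "\<And>z. z \<in> ball 0 \<rho> \<Longrightarrow> norm (D z) \<le> e' * norm (?y z) powr - a + B"
      using D_bound[OF e'] by blast
    have "\<forall>\<^sub>F n in sequentially. exp (- 1) / 2 < q n"
      using order_tendstoD(1)[OF q_lim, of "exp (-1) / 2"] by simp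
    moreover have "\<forall>\<^sub>F n in sequentially. L * B / real n powr (a - 1) < e / 2"
    proof -
      have "(\<lambda>n. L * B * real n powr - (a - 1)) \<longlonglongrightarrow> L * B * 0"
        using a by (intro tendsto_mult tendsto_const tendsto_neg_powr filterlim_real_sequentially) auto
      then have "(\<lambda>n. L * B / real n powr (a - 1)) \<longlonglongrightarrow> 0"
        unfolding powr_minus by (simp add: divide_inverse)
      from order_tendstoD(2)[OF this, of "e / 2"] show ?thesis using e by simp
    qed
    ultimately show "\<forall>\<^sub>F n in sequentially. dist ((deriv ^^ n) D 0 / fact n * of_real (\<rho> ^ n / real n powr (a - 1))) 0 < e"
      using eventually_ge_at_top[of 2]
    proof eventually_elim
      case (elim n)
      define d where "d = 1 / real n"
      have d: "0 < d" "d \<le> 1 / 2" using elim by (auto simp: d_def field_simps)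
      let ?g = "\<lambda>t. e' * (2 powr a * ((d + t) powr - a + (d + (1 - t)) powr - a)) + B"
      define I where "I = (d powr (1 - a) - (d + 1) powr (1 - a)) / (a - 1)"
      have gi: "(?g has_integral (e' * (2 powr a * (I + I)) + B)) {0..1}"
        using has_integral_const_real[of B 0 1] unfolding I_def
        by (intro has_integral_add has_integral_mult_right has_integral_shifted_powr d a) simp
      have R: "0 < \<rho> * (1 - d)" "\<rho> * (1 - d) < \<rho>" using \<rho> d by auto
      have "norm ((deriv ^^ n) D 0 / fact n) \<le> (e' * (2 powr a * (I + I)) + B) / (\<rho> * (1 - d)) ^ n"
      proof (rule Cauchy_coefficient_bound[OF holD R gi])
        fix t :: real assume t: "t \<in> {0..1}"
        let ?z = "of_real (\<rho> * (1 - d)) * exp (2 * of_real pi * \<i> * of_real t)"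
        have "norm ?z = \<rho> * (1 - d)" using R(1) by (simp add: norm_mult del: of_real_mult of_real_diff)
        then have z: "?z \<in> ball 0 \<rho>" using R by simp
        let ?m = "min t (1 - t)"
        have yz: "?y ?z = 1 - of_real (1 - d) * exp (2 * of_real pi * \<i> * of_real t)" using \<rho> by simp
        have ge: "(d + ?m) / 2 \<le> norm (?y ?z)"
          unfolding yz by (rule norm_one_minus_circle_ge) (use t d in auto)
        have "0 < (d + ?m) / 2" using d t by (auto simp: min_def)
        then have "norm (?y ?z) powr - a \<le> ((d + ?m) / 2) powr - a"
          using a by (intro powr_mono2' ge) auto
        also have "\<dots> = 2 powr a * (d + ?m) powr - a"
          using d t by (simp add: powr_divide powr_minus field_simps)
        also have "(d + ?m) powr - a \<le> (d + t) powr - a + (d + (1 - t)) powr - a"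
          by (auto simp: min_def)
        finally have "norm (?y ?z) powr - a \<le> 2 powr a * ((d + t) powr - a + (d + (1 - t)) powr - a)"
          by (simp only: mult_left_mono powr_ge_zero)
        then have "e' * norm (?y ?z) powr - a + B \<le> ?g t"
          by (intro add_right_mono mult_left_mono less_imp_le[OF e'])
        then show "norm (D ?z) \<le> ?g t" by (rule order_trans[OF B(2)[OF z]])
      qed
      also have "\<dots> \<le> (e' * (Q * real n powr (a - 1)) + B) / (\<rho> * (1 - d)) ^ n"
      proof -
        have "I \<le> d powr (1 - a) / (a - 1)" unfolding I_def using a by (intro divide_right_mono) auto
        also have "d powr (1 - a) = real n powr (a - 1)"
          using elim unfolding d_def by (simp add: powr_divide powr_diff field_simps)
        finally have "I + I \<le> 2 / (a - 1) * real n powr (a - 1)" by simp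
        then have "2 powr a * (I + I) \<le> Q * real n powr (a - 1)"
          unfolding Q_def mult.assoc by (intro mult_left_mono) auto
        then show ?thesis using e' R by (intro divide_right_mono add_right_mono mult_left_mono) auto
      qed
      finally have "norm ((deriv ^^ n) D 0 / fact n) * (\<rho> ^ n / real n powr (a - 1)) \<le>
         (e' * (Q * real n powr (a - 1)) + B) / (\<rho> * (1 - d)) ^ n * (\<rho> ^ n / real n powr (a - 1))"
        using \<rho> by (intro mult_right_mono) auto
      also have "(\<rho> * (1 - d)) ^ n = \<rho> ^ n * q n" unfolding q_def d_def by (simp add: power_mult_distrib)
      also have "(e' * (Q * real n powr (a - 1)) + B) / (\<rho> ^ n * q n) * (\<rho> ^ n / real n powr (a - 1)) =
         (e' * Q + B / real n powr (a - 1)) / q n"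
      proof -
        have "(x * (y * v) + z) / (u * w) * (u / v) = (x * y + z / v) / w" if "u \<noteq> 0" "v \<noteq> 0" for x y z u v w :: real
          using that by (cases "w = 0") (auto simp: field_simps)
        from this[of "\<rho> ^ n" "real n powr (a - 1)"] show ?thesis using \<rho> elim by simp
      qed
      also have "\<dots> \<le> (e' * Q + B / real n powr (a - 1)) / (1 / L)"
      proof (rule divide_left_mono)
        have L: "1 / L = exp (- 1) / 2" unfolding L_def by (simp add: exp_minus field_simps)
        show "1 / L \<le> q n" unfolding L using elim by simp
        have "0 < exp (- 1) / (2 :: real)" by simp
        then have "0 < q n" using elim by linarith
        then show "0 < q n * (1 / L)" unfolding L by simp
        show "0 \<le> e' * Q + B / real n powr (a - 1)" using e' Q B by simp
      qed
      also have "\<dots> = e' * Q * L + L * B / real n powr (a - 1)" by (simp add: algebra_simps)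
      also have "e' * Q * L = e / 2" using Q by (simp add: e'_def L_def)
      also have "e / 2 + L * B / real n powr (a - 1) < e" using elim(2) by linarith
      finally have "norm ((deriv ^^ n) D 0 / fact n) * (\<rho> ^ n / real n powr (a - 1)) < e" .
      moreover have "norm (complex_of_real (\<rho> ^ n / real n powr (a - 1))) = \<rho> ^ n / real n powr (a - 1)"
        unfolding norm_of_real using \<rho> by (intro abs_of_nonneg divide_nonneg_nonneg zero_le_power) auto
      ultimately show ?case unfolding dist_norm diff_zero norm_mult by (simp only:)
    qed
  qed
  have main: "(\<lambda>n. K * of_real (pochhammer a n / fact n / real n powr (a - 1))) \<longlonglongrightarrow> K * of_real (1 / Gamma a)"
    using a by (intro tendsto_mult tendsto_const tendsto_of_real pochhammer_asymp) auto
  have coeff: "(deriv ^^ n) D 0 / fact n * of_real (\<rho> ^ n / real n powr (a - 1)) + K * of_real (pochhammer a n / fact n / real n powr (a - 1))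
     = (deriv ^^ Suc n) F 0 / fact n * of_real (\<rho> ^ n / real n powr (a - 1))" for n
  proof -
    have 0: "(0::complex) \<in> ball 0 \<rho>" using \<rho> by simp
    have "(deriv ^^ n) D 0 = (deriv ^^ n) (deriv F) 0 - (deriv ^^ n) (\<lambda>z. K * ?y z powr of_real (- a)) 0"
      unfolding D_def by (rule higher_deriv_diff[OF hol' holomorphic_on_mult[OF holomorphic_on_const holy] _ 0]) auto
    also have "(deriv ^^ n) (\<lambda>z. K * ?y z powr of_real (- a)) 0 = K * (deriv ^^ n) (\<lambda>z. ?y z powr of_real (- a)) 0"
      by (rule higher_deriv_cmult[OF holy 0]) auto
    also have "\<dots> = K * of_real (pochhammer a n / \<rho> ^ n)" unfolding higher_deriv_binomial[OF 0] by simp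
    also have "(deriv ^^ n) (deriv F) 0 = (deriv ^^ Suc n) F 0" by (simp only: funpow_Suc_right o_def)
    finally have eq: "(deriv ^^ n) D 0 = (deriv ^^ Suc n) F 0 - K * (of_real (pochhammer a n) / of_real (\<rho> ^ n))" by simp
    have "(x - k * (p / r)) / f * (r / v) + k * (p / f / v) = x / f * (r / v)" if "r \<noteq> 0" "f \<noteq> 0" for x k p r f v :: complex
      using that by (cases "v = 0") (auto simp: field_simps)
    from this[of "of_real (\<rho> ^ n)" "fact n"] show ?thesis unfolding eq using \<rho> by simp
  qed
  have L1: "(\<lambda>n. (deriv ^^ Suc n) F 0 / fact n * of_real (\<rho> ^ n / real n powr (a - 1))) \<longlonglongrightarrow> 0 + K * of_real (1 / Gamma a)"
    using tendsto_add[OF D0 main] unfolding coeff .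
  \<comment> \<open>Coefficient \<open>n\<close> of \<open>F'\<close> is \<open>n + 1\<close> times
    coefficient \<open>n + 1\<close> of \<open>F\<close>. This factor adapts the normalization to
    index \<open>Suc n\<close>, and \<open>LIMSEQ_imp_Suc\<close> removes the shift at the
    end.\<close>
  have L2: "(\<lambda>n. \<rho> * (real n / real (Suc n)) powr (a - 1)) \<longlonglongrightarrow> \<rho> * 1 powr (a - 1)"
  proof (intro tendsto_mult tendsto_powr tendsto_const)
    show "(\<lambda>n. real n / real (Suc n)) \<longlonglongrightarrow> 1" by real_asymp
  qed simp
  have L3: "(\<lambda>n. (deriv ^^ Suc n) F 0 / fact n * of_real (\<rho> ^ n / real n powr (a - 1)) * of_real (\<rho> * (real n / real (Suc n)) powr (a - 1)))
     \<longlonglongrightarrow> (0 + K * of_real (1 / Gamma a)) * of_real (\<rho> * 1 powr (a - 1))"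
    by (rule tendsto_mult[OF L1 tendsto_of_real[OF L2]])
  have limit: "(0 + K * of_real (1 / Gamma a)) * of_real (\<rho> * 1 powr (a - 1)) = C / of_real (Gamma (- lam))"
  proof -
    have "Gamma a = (- lam) * Gamma (- lam)" using Gamma_plus1[of "- lam"] nonpos_Ints_nonpos[of "- lam"] lam by (auto simp: a_def)
    then have Ga: "1 / Gamma a = 1 / (- lam * Gamma (- lam))" by simp
    have gp: "Gamma (- lam) \<noteq> 0" using nonpos_Ints_nonpos[of "- lam"] lam by (auto simp: Gamma_eq_zero_iff)
    have gen: "(0 + (- l * c / r) * (1 / (- l * g))) * r = c / g" if "l \<noteq> 0" "r \<noteq> 0" "g \<noteq> 0" for l c r g :: complex
      using that by (simp add: divide_simps)
    have "(0 + K * (1 / (- of_real lam * of_real (Gamma (- lam))))) * of_real \<rho> = C / of_real (Gamma (- lam))"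
      unfolding K_def by (rule gen) (use \<rho> lam gp in auto)
    then show ?thesis unfolding Ga by simp
  qed
  have ev: "\<forall>\<^sub>F n in sequentially. (deriv ^^ Suc n) F 0 / fact n * of_real (\<rho> ^ n / real n powr (a - 1)) * of_real (\<rho> * (real n / real (Suc n)) powr (a - 1))
     = (deriv ^^ Suc n) F 0 / fact (Suc n) * of_real (\<rho> ^ Suc n / real (Suc n) powr (- lam - 1))"
    using eventually_gt_at_top[of 0]
  proof eventually_elim
    case (elim n)
    have "v powr (a - 1) = v powr (- lam - 1) * v" if "0 < v" for v
      using that powr_add[of v "- lam - 1" 1] by (simp add: a_def)
    then have e: "real (Suc n) powr (a - 1) = real (Suc n) powr (- lam - 1) * real (Suc n)"
      by (simp del: of_nat_Suc)
    have "x / u * (\<rho> * (u / (w * v))) = \<rho> * x / w / v" if "u \<noteq> 0" for x u w v :: real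
      using that by simp
    moreover have "real n powr (a - 1) \<noteq> 0" using elim by simp
    ultimately have "\<rho> ^ n / real n powr (a - 1) * (\<rho> * (real n / real (Suc n)) powr (a - 1)) =
       \<rho> ^ Suc n / real (Suc n) powr (- lam - 1) / real (Suc n)"
      unfolding powr_divide e power_Suc by blast
    then have r: "complex_of_real (\<rho> ^ n / real n powr (a - 1)) * of_real (\<rho> * (real n / real (Suc n)) powr (a - 1)) =
       of_real (\<rho> ^ Suc n / real (Suc n) powr (- lam - 1) / real (Suc n))" by (simp only: of_real_mult[symmetric])
    have "x / f * (u / v) = x / (v * f) * u" for x f u v :: complex by simp
    from this[of _ "fact n" _ "of_nat (Suc n)"] show ?case unfolding mult.assoc r fact_Suc of_real_divide[of _ "real (Suc n)"] of_real_of_nat_eq .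
  qed
  show ?thesis
    using Lim_transform_eventually[OF L3 ev] unfolding limit by (rule LIMSEQ_imp_Suc)
qed

section \<open>Coefficients of the scheme\<close>

text \<open>A homomorphism of semirings, given by its properties as \<open>single 0\<close> is not an instance of a class.\<close>
locale coeff_hom =
  fixes \<iota> :: "real \<Rightarrow> 'a::comm_semiring_1"
  assumes zero [simp]: "\<iota> 0 = 0" and one [simp]: "\<iota> 1 = 1"
    and add: "\<iota> (a + b) = \<iota> a + \<iota> b" and mult: "\<iota> (a * b) = \<iota> a * \<iota> b"
begin

lemma sum: "\<iota> (sum f S) = (\<Sum>x\<in>S. \<iota> (f x))"
  by (induction S rule: infinite_finite_induct) (auto simp: add)

lemma map_coeffs_mult: "map_coeffs \<iota> (f * g) = map_coeffs \<iota> f * map_coeffs \<iota> g"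
  by (rule fps_ext) (simp add: fps_mult_nth sum mult)

lemma map_coeffs_one: "map_coeffs \<iota> 1 = 1"
  by (rule fps_ext) (simp add: fps_one_nth)

lemma map_coeffs_power: "map_coeffs \<iota> (f ^ k) = map_coeffs \<iota> f ^ k"
  by (induction k) (auto simp: map_coeffs_mult map_coeffs_one)

lemma map_coeffs_prod: "map_coeffs \<iota> (prod f S) = (\<Prod>x\<in>S. map_coeffs \<iota> (f x))"
  by (induction S rule: infinite_finite_induct) (auto simp: map_coeffs_mult map_coeffs_one)

end

lemma fps_mult_nth_cong:
  assumes "\<And>i. i \<le> n \<Longrightarrow> fps_nth a i = fps_nth a' i" "\<And>i. i \<le> n \<Longrightarrow> fps_nth b i = fps_nth b' i"
  shows "fps_nth (a * b) n = fps_nth (a' * b') n"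
  unfolding fps_mult_nth by (rule sum.cong) (auto simp: assms)

lemma fps_prod_nth_cong:
  fixes a b :: "'l \<Rightarrow> 'a::comm_semiring_1 fps"
  assumes "finite S" "\<And>l i. l \<in> S \<Longrightarrow> i \<le> n \<Longrightarrow> fps_nth (a l) i = fps_nth (b l) i"
  shows "i \<le> n \<Longrightarrow> fps_nth (prod a S) i = fps_nth (prod b S) i"
  using assms
proof (induction S arbitrary: i rule: finite_induct)
  case (insert x S)
  then show ?case by (auto intro!: fps_mult_nth_cong)
qed auto

lemma fps_power_nth_0:
  fixes f :: "'a::comm_semiring_1 fps"
  assumes "fps_nth f 0 = 0" "n < k"
  shows "fps_nth (f ^ k) n = 0"
  using assms(2)
proof (induction k arbitrary: n)
  case (Suc k)
  have "fps_nth f i * fps_nth (f ^ k) (n - i) = 0" if "i \<le> n" for i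
    using that Suc assms(1) by (cases "i = 0") auto
  then show ?case by (simp add: fps_mult_nth)
qed auto

text \<open>The coefficient of \<open>z^n\<close> and of the monomial with exponents
  \<open>k\<close>, separated before any \<open>u\<close> is substituted. The polynomial series
  behind \<open>scheme_coeff\<close> and the real series behind \<open>scheme_total\<close> both
  reduce to these numbers.\<close>

definition multi_coeff ::
  "real fps \<Rightarrow> ('m::finite \<Rightarrow> real fps) \<Rightarrow> ('m \<Rightarrow> real fps) \<Rightarrow> nat \<Rightarrow> ('m \<Rightarrow> nat) \<Rightarrow> real" where
  "multi_coeff M G H n k =
     fps_nth (M * (\<Prod>l\<in>UNIV. fps_const (fps_nth (G l) (k l)) * H l ^ k l)) n"

lemma multi_coeff_nonneg:
  assumes "\<And>n. 0 \<le> fps_nth M n" "\<And>l n. 0 \<le> fps_nth (G l) n" "\<And>l n. 0 \<le> fps_nth (H l) n"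
  shows "0 \<le> multi_coeff M G H n k"
proof -
  have mult: "0 \<le> fps_nth (f * g) n" if "\<And>n. 0 \<le> fps_nth f n" "\<And>n. 0 \<le> fps_nth g n" for f g :: "real fps" and n
    using that by (simp add: fps_mult_nth sum_nonneg)
  have pow: "0 \<le> fps_nth (f ^ i) n" if "\<And>n. 0 \<le> fps_nth f n" for f :: "real fps" and n i
    by (induction i arbitrary: n) (auto intro!: mult that simp: fps_one_nth)
  have "0 \<le> fps_nth (\<Prod>l\<in>S. fps_const (fps_nth (G l) (k l)) * H l ^ k l) n" for S n
    by (induction S arbitrary: n rule: infinite_finite_induct) (auto intro!: mult pow assms simp: fps_one_nth)
  then show ?thesis unfolding multi_coeff_def by (intro mult assms)
qed

text \<open>\<open>H l ^ k l\<close> has order at least \<open>k l > n\<close>. So only exponent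
  vectors with entries in \<open>{..n}\<close> contribute to the coefficient of \<open>z^n\<close>,
  and all sums are finite.\<close>

lemma multi_coeff_eq_0:
  fixes H :: "'m::finite \<Rightarrow> real fps"
  assumes "\<And>l. fps_nth (H l) 0 = 0" "n < k l"
  shows "multi_coeff M G H n k = 0"
proof -
  let ?a = "\<lambda>l. fps_const (fps_nth (G l) (k l)) * H l ^ k l"
  have "M * prod ?a UNIV = H l ^ k l * (M * (fps_const (fps_nth (G l) (k l)) * prod ?a (UNIV - {l})))"
    unfolding prod.remove[OF finite UNIV_I, of ?a l] by (simp only: mult_ac)
  also have "fps_nth \<dots> n = 0"
    using fps_power_nth_0[of "H l"] assms by (simp add: fps_mult_nth[of "H l ^ k l"] sum.neutral)
  finally show ?thesis unfolding multi_coeff_def .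
qed

text \<open>Up to order \<open>n\<close> each composition equals its truncation after degree
  \<open>n\<close>; expanding the product of these sums gives a sum over exponent vectors. Stated
  for a homomorphism, it covers the polynomial coefficients as well as the evaluation at
  \<open>u = 1\<close>.\<close>

lemma (in coeff_hom) composition_scheme_nth:
  fixes H :: "'m::finite \<Rightarrow> real fps"
  assumes H: "\<And>l. fps_nth (H l) 0 = 0"
  shows "fps_nth (composition_scheme \<iota> M G H u) n =
    (\<Sum>k\<in>PiE UNIV (\<lambda>_. {..n}). \<iota> (multi_coeff M G H n k) * (\<Prod>l\<in>UNIV. u l ^ k l))"
proof -
  let ?c = "\<lambda>l i. fps_const (fps_nth (G l) i) * H l ^ i"
  let ?t = "\<lambda>l i. fps_const (u l ^ i) * map_coeffs \<iota> (?c l i)"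
  have hom_const: "map_coeffs \<iota> (fps_const a) = fps_const (\<iota> a)" for a
    by (rule fps_ext) simp
  have const_pow: "fps_const (c ^ i) = fps_const c ^ i" for c :: 'a and i
    by (induction i) (auto simp flip: fps_const_mult)
  have t_eq: "?t l i = fps_const (\<iota> (fps_nth (G l) i)) * (fps_const (u l) * map_coeffs \<iota> (H l)) ^ i" for l i
    unfolding map_coeffs_mult map_coeffs_power hom_const power_mult_distrib const_pow by (simp only: mult_ac)
  have t_nth: "fps_nth (?t l i) j = \<iota> (fps_nth (G l) i) * fps_nth ((fps_const (u l) * map_coeffs \<iota> (H l)) ^ i) j" for l i j
    unfolding t_eq by simp
  have comp: "fps_nth (fps_compose (map_coeffs \<iota> (G l)) (fps_const (u l) * map_coeffs \<iota> (H l))) j =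
     fps_nth (\<Sum>i\<in>{..n}. ?t l i) j" if "j \<le> n" for l j
  proof -
    have "fps_nth (fps_compose (map_coeffs \<iota> (G l)) (fps_const (u l) * map_coeffs \<iota> (H l))) j = (\<Sum>i\<in>{0..j}. fps_nth (?t l i) j)"
      by (simp only: fps_compose_nth t_nth map_coeffs_nth)
    also have "\<dots> = (\<Sum>i\<in>{..n}. fps_nth (?t l i) j)"
    proof (rule sum.mono_neutral_left)
      show "\<forall>i\<in>{..n} - {0..j}. fps_nth (?t l i) j = 0"
        unfolding t_nth by (auto simp: fps_power_nth_0 H)
    qed (use that in auto)
    finally show ?thesis by (simp add: fps_sum_nth)
  qed
  have "fps_nth (composition_scheme \<iota> M G H u) n = fps_nth (map_coeffs \<iota> M * (\<Prod>l\<in>UNIV. \<Sum>i\<in>{..n}. ?t l i)) n"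
    unfolding composition_scheme_def
    by (intro fps_mult_nth_cong refl fps_prod_nth_cong[where n=n] comp) auto
  also have "(\<Prod>l\<in>UNIV. \<Sum>i\<in>{..n}. ?t l i) = (\<Sum>k\<in>PiE UNIV (\<lambda>_. {..n}). \<Prod>l\<in>UNIV. ?t l (k l))"
    by (rule prod_sum_PiE) auto
  also have "map_coeffs \<iota> M * \<dots> = (\<Sum>k\<in>PiE UNIV (\<lambda>_. {..n}).
      fps_const (\<Prod>l\<in>UNIV. u l ^ k l) * map_coeffs \<iota> (M * (\<Prod>l\<in>UNIV. ?c l (k l))))"
  proof -
    have fc: "(\<Prod>l\<in>UNIV. fps_const (u l ^ k l)) = fps_const (\<Prod>l\<in>UNIV. u l ^ k l)" for k
    proof -
      have "(\<Prod>l\<in>S. fps_const (u l ^ k l)) = fps_const (\<Prod>l\<in>S. u l ^ k l)" for S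
        by (induction S rule: infinite_finite_induct) auto
      then show ?thesis .
    qed
    show ?thesis unfolding sum_distrib_left map_coeffs_mult map_coeffs_prod prod.distrib fc
      by (simp add: mult_ac)
  qed
  finally show ?thesis
    by (simp add: fps_sum_nth multi_coeff_def mult.commute)
qed

lemma coeff_hom_id: "coeff_hom (\<lambda>c::real. c)"
  by unfold_locales auto

lemma coeff_hom_single: "coeff_hom (Poly_Mapping.single 0 :: real \<Rightarrow> ('m \<Rightarrow>\<^sub>0 nat) \<Rightarrow>\<^sub>0 real)"
  by unfold_locales (auto simp: single_add mult_single)

lemma scheme_total_eq:
  fixes H :: "'m::finite \<Rightarrow> real fps"
  assumes "\<And>l. fps_nth (H l) 0 = 0"
  shows "scheme_total M G H n = (\<Sum>k\<in>PiE UNIV (\<lambda>_. {..n}). multi_coeff M G H n k)"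
  unfolding scheme_total_def coeff_hom.composition_scheme_nth[OF coeff_hom_id assms] by simp

lemma scheme_coeff_eq:
  fixes H :: "'m::finite \<Rightarrow> real fps"
  assumes "\<And>l. fps_nth (H l) 0 = 0"
  shows "scheme_coeff M G H n k = multi_coeff M G H n k"
proof -
  let ?s = "\<lambda>k. Poly_Mapping.single (Poly_Mapping.Abs_poly_mapping k) (1::real)"
  have fin: "finite {x. (k::'m \<Rightarrow> nat) x \<noteq> 0}" for k by simp
  have prod1: "(\<Prod>l\<in>S. Poly_Mapping.single (Poly_Mapping.single l (1::nat)) (1::real) ^ k l) =
     Poly_Mapping.single (\<Sum>l\<in>S. Poly_Mapping.single l (k l)) 1" for k :: "'m \<Rightarrow> nat" and S
  proof (induction S rule: infinite_finite_induct)
    case (insert x S)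
    have "Poly_Mapping.single (Poly_Mapping.single x (1::nat)) (1::real) ^ i = Poly_Mapping.single (Poly_Mapping.single x i) 1" for i
      by (induction i) (auto simp: mult_single simp flip: single_add)
    then show ?case using insert by (simp add: mult_single)
  qed auto
  have sum1: "(\<Sum>l\<in>UNIV. Poly_Mapping.single l (k l)) = Poly_Mapping.Abs_poly_mapping k" for k :: "'m \<Rightarrow> nat"
    by (rule poly_mapping_eqI) (simp add: lookup_sum lookup_single when_def Abs_poly_mapping_inverse)
  have "fps_nth (composition_scheme (Poly_Mapping.single 0) M G H
      (\<lambda>l. Poly_Mapping.single (Poly_Mapping.single l 1) 1 :: ('m \<Rightarrow>\<^sub>0 nat) \<Rightarrow>\<^sub>0 real)) n =
     (\<Sum>j\<in>PiE UNIV (\<lambda>_. {..n}). Poly_Mapping.single (Poly_Mapping.Abs_poly_mapping j) (multi_coeff M G H n j))"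
    unfolding coeff_hom.composition_scheme_nth[OF coeff_hom_single assms] prod1 sum1 by (simp add: mult_single)
  then have "scheme_coeff M G H n k = (\<Sum>j\<in>PiE UNIV (\<lambda>_. {..n}). if j = k then multi_coeff M G H n j else 0)"
    unfolding scheme_coeff_def
    by (simp add: lookup_sum lookup_single when_def Abs_poly_mapping_inject)
  also have "\<dots> = multi_coeff M G H n k"
  proof (cases "\<forall>l. k l \<le> n")
    case True
    then have "k \<in> PiE UNIV (\<lambda>_. {..n})" by auto
    moreover have "finite (PiE (UNIV :: 'm set) (\<lambda>_. {..n}))" by (intro finite_PiE) auto
    ultimately show ?thesis by (simp only: sum.delta if_True)
  next
    case False
    then obtain l where "n < k l" by (auto simp: not_le)
    then have "multi_coeff M G H n k = 0" using multi_coeff_eq_0 assms by blast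
    then show ?thesis by (simp add: sum.delta finite_PiE)
  qed
  finally show ?thesis .
qed

text \<open>\<open>multi_coeff\<close> is linear in coefficient \<open>k l\<close> of each
  \<open>G l\<close>, so the weight \<open>real (k l) ^ s l\<close> can be absorbed into
  \<open>G l\<close>. By \<open>0 ^ 0 = 1\<close> the case \<open>s l = 0\<close> leaves
  \<open>G l\<close> unchanged.\<close>

lemma expectation_scheme:
  fixes H :: "'m::finite \<Rightarrow> real fps" and p :: "('m \<Rightarrow> nat) pmf"
  assumes "\<And>l. fps_nth (H l) 0 = 0" "scheme_total M G H n \<noteq> 0"
    and "\<And>k. pmf p k = scheme_coeff M G H n k / scheme_total M G H n"
  shows "measure_pmf.expectation p (\<lambda>k. \<Prod>l\<in>UNIV. real (k l) ^ s l) =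
    scheme_total M (\<lambda>l. Abs_fps (\<lambda>i. real i ^ s l * fps_nth (G l) i)) H n / scheme_total M G H n"
    and "set_pmf p \<subseteq> PiE UNIV (\<lambda>_. {..n})"
proof -
  show sub: "set_pmf p \<subseteq> PiE UNIV (\<lambda>_. {..n})"
  proof
    fix k assume "k \<in> set_pmf p"
    then have "multi_coeff M G H n k \<noteq> 0"
      using assms by (auto simp: set_pmf_iff scheme_coeff_eq)
    then show "k \<in> PiE UNIV (\<lambda>_. {..n})"
      using multi_coeff_eq_0[of H n k] assms(1) by (force simp: not_le)
  qed
  have mc: "(\<Prod>l\<in>UNIV. real (k l) ^ s l) * multi_coeff M G H n k =
     multi_coeff M (\<lambda>l. Abs_fps (\<lambda>i. real i ^ s l * fps_nth (G l) i)) H n k" for k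
  proof -
    have fc: "(\<Prod>l\<in>S. fps_const (g l)) = fps_const (\<Prod>l\<in>S. g l)" for S and g :: "'m \<Rightarrow> real"
      by (induction S rule: infinite_finite_induct) auto
    show ?thesis unfolding multi_coeff_def
      by (simp add: prod.distrib fc mult.left_commute[of M] mult.assoc)
  qed
  have "measure_pmf.expectation p (\<lambda>k. \<Prod>l\<in>UNIV. real (k l) ^ s l) =
     (\<Sum>k\<in>PiE UNIV (\<lambda>_. {..n}). pmf p k *\<^sub>R (\<Prod>l\<in>UNIV. real (k l) ^ s l))"
    by (rule integral_measure_pmf) (use sub in \<open>auto simp: finite_PiE\<close>)
  also have "\<dots> = (\<Sum>k\<in>PiE UNIV (\<lambda>_. {..n}). multi_coeff M (\<lambda>l. Abs_fps (\<lambda>i. real i ^ s l * fps_nth (G l) i)) H n k) / scheme_total M G H n"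
    unfolding sum_divide_distrib mc[symmetric] by (simp add: assms(3) scheme_coeff_eq[OF assms(1)] mult_ac)
  finally show "measure_pmf.expectation p (\<lambda>k. \<Prod>l\<in>UNIV. real (k l) ^ s l) =
    scheme_total M (\<lambda>l. Abs_fps (\<lambda>i. real i ^ s l * fps_nth (G l) i)) H n / scheme_total M G H n"
    unfolding scheme_total_eq[OF assms(1)] .
qed

section \<open>The method of moments\<close>

text \<open>Both characteristic functions are approximated by the same Taylor polynomial of degree
  \<open>2 * n\<close>, with an error controlled by the moment of order \<open>2 * n\<close>. The
  even degree turns absolute moments into moments.\<close>

lemma real_distribution_eq_if_moments_eq:
  assumes M: "real_distribution M" and N: "real_distribution N"
    and int: "\<And>k::nat. integrable M (\<lambda>x. x ^ k)" "\<And>k::nat. integrable N (\<lambda>x. x ^ k)"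
    and eq: "\<And>k::nat. (\<integral>x. x ^ k \<partial>M) = (\<integral>x. x ^ k \<partial>N)"
    and growth: "\<And>t::real. (\<lambda>n. t ^ (2 * n) * (\<integral>x. x ^ (2 * n) \<partial>M) / fact (2 * n)) \<longlonglongrightarrow> 0"
  shows "M = N"
proof (rule Levy_uniqueness[OF M N], rule ext)
  fix t :: real
  interpret M: real_distribution M by fact
  interpret N: real_distribution N by fact
  let ?T = "\<lambda>n. \<Sum>k\<le>2 * n. ((\<i> * t) ^ k / fact k) * complex_of_real (\<integral>x. x ^ k \<partial>M)"
  let ?b = "\<lambda>n. (2 * \<bar>t\<bar> ^ (2 * n) / fact (2 * n)) * (\<integral>x. x ^ (2 * n) \<partial>M)"
  have abs: "\<bar>x\<bar> ^ (2 * n) = x ^ (2 * n)" for x :: real and n by (simp add: power_mult)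
  have 1: "cmod (char M t - ?T n) \<le> ?b n" for n
    using M.char_approx1[of "2 * n" t] int unfolding abs by simp
  have 2: "cmod (char N t - ?T n) \<le> ?b n" for n
    using N.char_approx1[of "2 * n" t] int unfolding abs eq by simp
  have "cmod (char M t - char N t) \<le> 4 * (t ^ (2 * n) * (\<integral>x. x ^ (2 * n) \<partial>M) / fact (2 * n))" for n
  proof -
    have "cmod (char M t - char N t) \<le> cmod (char M t - ?T n) + cmod (char N t - ?T n)"
      using norm_triangle_ineq4[of "char M t - ?T n" "char N t - ?T n"] by simp
    also have "\<dots> \<le> ?b n + ?b n" using 1 2 by (intro add_mono)
    finally show ?thesis unfolding abs by simp
  qed
  moreover have "(\<lambda>n. 4 * (t ^ (2 * n) * (\<integral>x. x ^ (2 * n) \<partial>M) / fact (2 * n))) \<longlonglongrightarrow> 4 * 0"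
    by (intro tendsto_mult tendsto_const growth)
  ultimately have "cmod (char M t - char N t) \<le> 4 * 0"
    by (intro tendsto_lowerbound[of _ _ sequentially]) auto
  then show "char M t = char N t" by simp
qed

text \<open>Closed sets form an intersection-stable generator, and their indicators are pointwise
  limits of the bounded continuous functions \<open>max 0 (1 - n * infdist x F)\<close>.\<close>

lemma measure_eq_if_continuous_integrals_eq:
  fixes P Q :: "'a::metric_space measure"
  assumes P: "prob_space P" "sets P = sets borel" and Q: "prob_space Q" "sets Q = sets borel"
    and eq: "\<And>f::'a \<Rightarrow> real. continuous_on UNIV f \<Longrightarrow> bounded (range f) \<Longrightarrow> (\<integral>x. f x \<partial>P) = (\<integral>x. f x \<partial>Q)"
  shows "P = Q"
proof -
  interpret P: prob_space P by fact
  interpret Q: prob_space Q by fact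
  \<comment> \<open>\<open>infdist x {} = 0\<close> by convention, so the empty set is treated
    separately.\<close>
  have closed_eq: "measure P F = measure Q F" if F: "closed F" "F \<noteq> {}" for F
  proof -
    define f where "f n x = max 0 (1 - real n * infdist x F)" for n x
    have cont: "continuous_on UNIV (f n)" for n
      unfolding f_def by (intro continuous_intros)
    have bnd: "0 \<le> f n x" "f n x \<le> 1" for n x
      unfolding f_def using infdist_nonneg[of x F] by auto
    have meas: "f n \<in> borel_measurable borel" for n
      by (rule borel_measurable_continuous_onI[OF cont])
    have lim: "(\<lambda>n. f n x) \<longlonglongrightarrow> indicator F x" for x
    proof (cases "x \<in> F")
      case True
      then have "f n x = 1" for n unfolding f_def by simp
      then show ?thesis using True by simp
    next
      case False
      then have pos: "infdist x F > 0" using F in_closed_iff_infdist_zero infdist_nonneg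
        by (metis order_le_less)
      have "\<forall>\<^sub>F n in sequentially. f n x = 0"
      proof -
        obtain N :: nat where N: "1 / infdist x F < real N" using reals_Archimedean2 by blast
        have "f n x = 0" if "n \<ge> N" for n
        proof -
          have "1 / infdist x F < real n" using N that by linarith
          then show ?thesis unfolding f_def using pos by (simp add: field_simps)
        qed
        then show ?thesis using eventually_sequentially by blast
      qed
      then show ?thesis using False by (simp add: tendsto_eventually)
    qed
    have conv: "(\<lambda>n. \<integral>x. f n x \<partial>R) \<longlonglongrightarrow> measure R F" if R: "prob_space R" "sets R = sets borel" for R
    proof -
      interpret R: prob_space R by fact
      have [measurable_cong]: "sets R = sets borel" by fact
      have Fm: "F \<in> sets R" using F R by simp
      have "(\<lambda>n. \<integral>x. f n x \<partial>R) \<longlonglongrightarrow> (\<integral>x. indicator F x \<partial>R)"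
      proof (rule integral_dominated_convergence[where w="\<lambda>_. 1"])
        show "f n \<in> borel_measurable R" for n using meas by measurable
        show "(indicator F :: 'a \<Rightarrow> real) \<in> borel_measurable R" using Fm by simp
        show "AE x in R. norm (f n x) \<le> 1" for n using bnd by simp
      qed (use lim in auto)
      then show ?thesis using Fm by (simp add: sets_eq_imp_space_eq[OF R(2)])
    qed
    have "(\<integral>x. f n x \<partial>P) = (\<integral>x. f n x \<partial>Q)" for n
      using bnd by (intro eq cont) (auto simp: bounded_iff intro!: exI[of _ 1])
    then show ?thesis using conv[OF P] conv[OF Q] LIMSEQ_unique by auto
  qed
  show ?thesis
  proof (rule measure_eqI_generator_eq[where E="{F. closed F}" and \<Omega>=UNIV and A="\<lambda>_. UNIV"])
    show "Int_stable {F :: 'a set. closed F}" by (auto simp: Int_stable_def)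
    show "sets P = sigma_sets UNIV {F. closed F}" "sets Q = sigma_sets UNIV {F. closed F}"
      using P Q by (simp_all add: borel_eq_closed)
    show "emeasure P X = emeasure Q X" if "X \<in> {F. closed F}" for X
      using closed_eq[of X] that by (cases "X = {}") (auto simp: P.emeasure_eq_measure Q.emeasure_eq_measure)
  qed auto
qed

section \<open>From convergence of moments to convergence in law on the orthant\<close>

lemma abs_exp_minus_Taylor_le:
  fixes u :: real
  assumes "0 \<le> u"
  shows "\<bar>exp (- u) - (\<Sum>i<N. (- u) ^ i / fact i)\<bar> \<le> u ^ N / fact N"
proof (cases "u = 0 \<or> N = 0")
  case True
  then show ?thesis
  proof
    assume "u = 0"
    moreover have "(\<Sum>i<N. (0::real) ^ i / fact i) = 1" if "N = Suc k" for k
      unfolding that sum.lessThan_Suc_shift by simp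
    ultimately show ?thesis by (cases N) auto
  qed (use assms in simp)
next
  case False
  then have "\<exists>t. - u < t \<and> t < 0 \<and> exp (- u) = (\<Sum>m<N. exp 0 / fact m * (- u) ^ m) + exp t / fact N * (- u) ^ N"
    using assms by (intro Maclaurin_minus[where diff="\<lambda>_. exp"]) (auto intro!: derivative_eq_intros)
  then obtain t where t: "t < 0" "exp (- u) = (\<Sum>m<N. exp 0 / fact m * (- u) ^ m) + exp t / fact N * (- u) ^ N"
    by blast
  \<comment> \<open>The intermediate point \<open>t\<close> of the Lagrange remainder is negative,
    so \<open>exp t \<le> 1\<close>.\<close>
  have "\<bar>exp (- u) - (\<Sum>i<N. (- u) ^ i / fact i)\<bar> = exp t * (u ^ N / fact N)"
    unfolding t(2) using assms by (simp add: abs_mult power_abs)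
  also have "\<dots> \<le> 1 * (u ^ N / fact N)" using t assms by (intro mult_right_mono) auto
  finally show ?thesis by simp
qed

definition monomial :: "('m::finite \<Rightarrow> nat) \<Rightarrow> real ^ 'm \<Rightarrow> real" where
  "monomial s x = (\<Prod>l\<in>UNIV. (x $ l) ^ s l)"

lemma monomial_measurable [measurable]: "monomial s \<in> borel_measurable borel"
  unfolding monomial_def by measurable

lemma monomial_single: "monomial (\<lambda>i. if i = l then j else 0) x = (x $ l) ^ j"
proof -
  have "monomial (\<lambda>i. if i = l then j else 0) x = (\<Prod>i\<in>UNIV. if i = l then (x $ i) ^ j else 1)"
    unfolding monomial_def by (rule prod.cong) auto
  then show ?thesis by simp
qed

lemma monomial_upd: "x $ l * monomial s x = monomial (s(l := Suc (s l))) x"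
  unfolding monomial_def
  by (subst (1 2) prod.remove[of UNIV l]) (auto intro!: prod.cong)

text \<open>Each \<open>y l\<close> is replaced by the largest one, whose summand is then bounded by
  the whole sum. This reduces powers of linear forms to one-dimensional moments, whose growth is
  what the locale controls.\<close>

lemma sum_power_le_sum_scaled_powers:
  fixes a y :: "'m::finite \<Rightarrow> real"
  assumes "\<And>l. 0 \<le> a l" "\<And>l. 0 \<le> y l"
  shows "(\<Sum>l\<in>UNIV. a l * y l) ^ N \<le> (\<Sum>l\<in>UNIV. (\<Sum>i\<in>UNIV. a i) ^ N * y l ^ N)"
proof -
  define m where "m = Max (range y)"
  have "m \<in> range y" unfolding m_def by (intro Max_in) auto
  then obtain l where l: "y l = m" by auto
  have "(\<Sum>l\<in>UNIV. a l * y l) \<le> (\<Sum>i\<in>UNIV. a i * y l)"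
    unfolding l m_def by (intro sum_mono mult_left_mono assms Max_ge) auto
  then have "(\<Sum>l\<in>UNIV. a l * y l) ^ N \<le> ((\<Sum>i\<in>UNIV. a i) * y l) ^ N"
    using assms by (intro power_mono) (auto simp: sum_distrib_right intro!: sum_nonneg)
  also have "\<dots> = (\<Sum>l\<in>{l}. (\<Sum>i\<in>UNIV. a i) ^ N * y l ^ N)" by (simp add: power_mult_distrib)
  also have "\<dots> \<le> (\<Sum>l\<in>UNIV. (\<Sum>i\<in>UNIV. a i) ^ N * y l ^ N)"
    using assms by (intro sum_mono2 mult_nonneg_nonneg zero_le_power sum_nonneg) auto
  finally show ?thesis .
qed

text \<open>
  On the orthant, moments control the Laplace transform: the Taylor polynomials of \<open>exp (- u)\<close>, \<open>u \<ge> 0\<close>,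
  have error at most \<open>u\<^sup>N / N!\<close>, which is again a polynomial. By Stone-Weierstrass in the variables
  \<open>exp (- x\<^sub>l)\<close> the Laplace transform controls all bounded continuous functions.
\<close>
locale orthant_moment_convergence =
  fixes P :: "nat \<Rightarrow> (real ^ 'm::finite) measure" and Q :: "(real ^ 'm) measure"
  assumes prob_P: "\<And>n. prob_space (P n)" and prob_Q: "prob_space Q"
    and sets_P: "\<And>n. sets (P n) = sets borel" and sets_Q: "sets Q = sets borel"
    and orthant_P: "\<And>n l. AE x in P n. 0 \<le> x $ l" and orthant_Q: "\<And>l. AE x in Q. 0 \<le> x $ l"
    and int_P: "\<And>n s. integrable (P n) (monomial s)" and int_Q: "\<And>s. integrable Q (monomial s)"
    and conv: "\<And>s. (\<lambda>n. \<integral>x. monomial s x \<partial>P n) \<longlonglongrightarrow> (\<integral>x. monomial s x \<partial>Q)"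
    and growth: "\<And>l r. (\<lambda>j. r ^ j * (\<integral>x. (x $ l) ^ j \<partial>Q) / fact j) \<longlonglongrightarrow> 0"
begin

definition integral_conv :: "(real ^ 'm \<Rightarrow> real) \<Rightarrow> bool" where
  "integral_conv f \<longleftrightarrow> (\<forall>n. integrable (P n) f) \<and> integrable Q f \<and> (\<lambda>n. \<integral>x. f x \<partial>P n) \<longlonglongrightarrow> (\<integral>x. f x \<partial>Q)"

lemma integral_conv_monomial: "integral_conv (monomial s)"
  unfolding integral_conv_def using int_P int_Q conv by auto

lemma integral_conv_sum: "finite I \<Longrightarrow> (\<And>i. i \<in> I \<Longrightarrow> integral_conv (f i)) \<Longrightarrow> integral_conv (\<lambda>x. \<Sum>i\<in>I. f i x)"
  unfolding integral_conv_def by (auto intro!: tendsto_sum)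

lemma integral_conv_cmult: "integral_conv f \<Longrightarrow> integral_conv (\<lambda>x. c * f x)"
  unfolding integral_conv_def by (auto intro!: tendsto_mult)

lemma integral_conv_add: "integral_conv f \<Longrightarrow> integral_conv g \<Longrightarrow> integral_conv (\<lambda>x. f x + g x)"
  unfolding integral_conv_def by (auto intro!: tendsto_add)

text \<open>At each step one factor of the linear form is absorbed into the monomial; this is why
  \<open>s\<close> is carried through the induction.\<close>

lemma integral_conv_linear_power: "integral_conv (\<lambda>x. monomial s x * (\<Sum>l\<in>UNIV. k l * x $ l) ^ i)"
proof (induction i arbitrary: s)
  case 0
  then show ?case using integral_conv_monomial by simp
next
  case (Suc i)
  have "(\<lambda>x. monomial s x * (\<Sum>l\<in>UNIV. k l * x $ l) ^ Suc i) =
     (\<lambda>x. \<Sum>l\<in>UNIV. k l * (monomial (s(l := Suc (s l))) x * (\<Sum>l\<in>UNIV. k l * x $ l) ^ i))"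
    unfolding monomial_upd[symmetric] power_Suc sum_distrib_right sum_distrib_left by (simp add: mult_ac)
  then show ?case using Suc by (auto intro!: integral_conv_sum integral_conv_cmult)
qed

lemma integral_conv_power: "integral_conv (\<lambda>x. (\<Sum>l\<in>UNIV. k l * x $ l) ^ i)"
  using integral_conv_linear_power[of "\<lambda>_. 0" k i] by (simp add: monomial_def)

lemma growth_linear:
  assumes "\<And>l. 0 \<le> k l"
  shows "(\<lambda>N. \<integral>x. (\<Sum>l\<in>UNIV. k l * x $ l) ^ N / fact N \<partial>Q) \<longlonglongrightarrow> 0"
proof (rule tendsto_sandwich)
  interpret Q: prob_space Q by (rule prob_Q)
  have orth: "AE x in Q. \<forall>l. 0 \<le> x $ l" using orthant_Q by (simp add: AE_all_countable)
  have i1: "integrable Q (\<lambda>x. (x $ l) ^ N)" for l N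
    using int_Q[of "\<lambda>i. if i = l then N else 0"] unfolding monomial_single .
  let ?c = "\<Sum>i\<in>UNIV. k i"
  have "AE x in Q. 0 \<le> (\<Sum>l\<in>UNIV. k l * x $ l) ^ N / fact N" for N
    using orth
    by eventually_elim (intro divide_nonneg_nonneg zero_le_power sum_nonneg mult_nonneg_nonneg assms, auto)
  from integral_nonneg_AE[OF this] show "\<forall>\<^sub>F N in sequentially. 0 \<le> (\<integral>x. (\<Sum>l\<in>UNIV. k l * x $ l) ^ N / fact N \<partial>Q)"
    by (intro always_eventually allI)
  have "(\<integral>x. (\<Sum>l\<in>UNIV. k l * x $ l) ^ N / fact N \<partial>Q) \<le> (\<Sum>l\<in>UNIV. ?c ^ N * (\<integral>x. (x $ l) ^ N \<partial>Q) / fact N)" for N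
  proof -
    have "(\<integral>x. (\<Sum>l\<in>UNIV. k l * x $ l) ^ N / fact N \<partial>Q) \<le> (\<integral>x. (\<Sum>l\<in>UNIV. ?c ^ N * (x $ l) ^ N) / fact N \<partial>Q)"
    proof (rule integral_mono_AE)
      show "integrable Q (\<lambda>x. (\<Sum>l\<in>UNIV. k l * x $ l) ^ N / fact N)"
        using integral_conv_power unfolding integral_conv_def by auto
      show "integrable Q (\<lambda>x. (\<Sum>l\<in>UNIV. ?c ^ N * (x $ l) ^ N) / fact N)" using i1 by auto
      show "AE x in Q. (\<Sum>l\<in>UNIV. k l * x $ l) ^ N / fact N \<le> (\<Sum>l\<in>UNIV. ?c ^ N * (x $ l) ^ N) / fact N"
        using orth by eventually_elim (intro divide_right_mono sum_power_le_sum_scaled_powers assms, auto)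
    qed
    also have "\<dots> = (\<Sum>l\<in>UNIV. ?c ^ N * (\<integral>x. (x $ l) ^ N \<partial>Q) / fact N)"
      using i1 by (simp add: sum_divide_distrib)
    finally show ?thesis .
  qed
  then show "\<forall>\<^sub>F N in sequentially. (\<integral>x. (\<Sum>l\<in>UNIV. k l * x $ l) ^ N / fact N \<partial>Q) \<le>
     (\<Sum>l\<in>UNIV. ?c ^ N * (\<integral>x. (x $ l) ^ N \<partial>Q) / fact N)" by simp
  have "(\<lambda>N. \<Sum>l\<in>UNIV. ?c ^ N * (\<integral>x. (x $ l) ^ N \<partial>Q) / fact N) \<longlonglongrightarrow> (\<Sum>l\<in>(UNIV::'m set). 0)"
    by (intro tendsto_sum growth)
  then show "(\<lambda>N. \<Sum>l\<in>UNIV. ?c ^ N * (\<integral>x. (x $ l) ^ N \<partial>Q) / fact N) \<longlonglongrightarrow> 0" by simp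
qed auto

lemma integrable_bounded:
  fixes f :: "real ^ 'm \<Rightarrow> real"
  assumes "prob_space R" "sets R = sets borel" "f \<in> borel_measurable borel" "\<And>x. \<bar>f x\<bar> \<le> b"
  shows "integrable R f"
proof -
  interpret prob_space R by fact
  show ?thesis
  proof (rule integrable_const_bound[where B=b])
    show "f \<in> borel_measurable R" using assms(3) measurable_cong_sets[OF assms(2) refl] by blast
  qed (use assms(4) in simp)
qed

text \<open>The error bound \<open>h\<close> itself has convergent integrals, so the smallness of
  its integral under \<open>Q\<close> passes to \<open>P n\<close> for large
  \<open>n\<close>.\<close>

lemma approximation:
  fixes f :: "real ^ 'm \<Rightarrow> real"
  assumes f: "f \<in> borel_measurable borel" "\<And>x. \<bar>f x\<bar> \<le> b"
    and approx: "\<And>e. e > 0 \<Longrightarrow> \<exists>g h. integral_conv g \<and> integral_conv h \<and> (\<forall>x. (\<forall>l. 0 \<le> x $ l) \<longrightarrow> \<bar>f x - g x\<bar> \<le> h x) \<and> (\<integral>x. h x \<partial>Q) < e"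
  shows "integral_conv f"
proof -
  have iP: "integrable (P n) f" for n by (rule integrable_bounded[OF prob_P sets_P f])
  have iQ: "integrable Q f" by (rule integrable_bounded[OF prob_Q sets_Q f])
  have "(\<lambda>n. \<integral>x. f x \<partial>P n) \<longlonglongrightarrow> (\<integral>x. f x \<partial>Q)"
  proof (rule tendstoI)
    fix e :: real assume e: "0 < e"
    then obtain g h where g: "integral_conv g" and h: "integral_conv h"
      and le: "\<And>x. (\<And>l. 0 \<le> x $ l) \<Longrightarrow> \<bar>f x - g x\<bar> \<le> h x" and small: "(\<integral>x. h x \<partial>Q) < e / 4"
      using approx[of "e / 4"] by auto
    have diff: "\<bar>(\<integral>x. f x \<partial>R) - (\<integral>x. g x \<partial>R)\<bar> \<le> (\<integral>x. h x \<partial>R)"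
      if "integrable R f" "integrable R g" "integrable R h" "\<And>l. AE x in R. 0 \<le> x $ l"  for R :: "(real ^ 'm) measure"
    proof -
      have "AE x in R. \<forall>l. 0 \<le> x $ l" using that(4) by (simp add: AE_all_countable)
      then have "AE x in R. \<bar>f x - g x\<bar> \<le> h x" by eventually_elim (use le in auto)
      then have "(\<integral>x. \<bar>f x - g x\<bar> \<partial>R) \<le> (\<integral>x. h x \<partial>R)" using that by (intro integral_mono_AE) auto
      moreover have "\<bar>\<integral>x. f x - g x \<partial>R\<bar> \<le> (\<integral>x. \<bar>f x - g x\<bar> \<partial>R)" by (rule integral_abs_bound)
      ultimately show ?thesis using that by simp
    qed
    have dP: "\<bar>(\<integral>x. f x \<partial>P n) - (\<integral>x. g x \<partial>P n)\<bar> \<le> (\<integral>x. h x \<partial>P n)" for n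
      using g h orthant_P iP unfolding integral_conv_def by (intro diff) auto
    have dQ: "\<bar>(\<integral>x. f x \<partial>Q) - (\<integral>x. g x \<partial>Q)\<bar> \<le> (\<integral>x. h x \<partial>Q)"
      using g h orthant_Q iQ unfolding integral_conv_def by (intro diff) auto
    have "\<forall>\<^sub>F n in sequentially. (\<integral>x. h x \<partial>P n) < e / 4"
      using order_tendstoD(2)[OF _ small] h unfolding integral_conv_def by blast
    moreover have "\<forall>\<^sub>F n in sequentially. dist (\<integral>x. g x \<partial>P n) (\<integral>x. g x \<partial>Q) < e / 4"
      using g e tendstoD[of "\<lambda>n. \<integral>x. g x \<partial>P n" "\<integral>x. g x \<partial>Q" sequentially "e / 4"] unfolding integral_conv_def by simp
    ultimately show "\<forall>\<^sub>F n in sequentially. dist (\<integral>x. f x \<partial>P n) (\<integral>x. f x \<partial>Q) < e"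
    proof eventually_elim
      case (elim n)
      then show ?case using dP[of n] dQ small unfolding dist_real_def by linarith
    qed
  qed
  then show ?thesis using iP iQ unfolding integral_conv_def by auto
qed

text \<open>Truncation by \<open>max 0\<close> makes the function bounded on the whole space; on the
  orthant, where the laws live, it is the kernel of the Laplace transform at
  \<open>k\<close>.\<close>

definition expo :: "('m \<Rightarrow> nat) \<Rightarrow> real ^ 'm \<Rightarrow> real" where
  "expo k x = exp (- (\<Sum>l\<in>UNIV. real (k l) * max 0 (x $ l)))"

lemma expo_bounds: "0 \<le> expo k x" "expo k x \<le> 1"
  unfolding expo_def by (auto intro!: sum_nonneg)

lemma expo_measurable [measurable]: "expo k \<in> borel_measurable borel"
  unfolding expo_def by measurable

lemma integral_conv_expo: "integral_conv (expo k)"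
proof (rule approximation[where b=1])
  fix e :: real assume e: "e > 0"
  let ?u = "\<lambda>x. \<Sum>l\<in>UNIV. real (k l) * x $ l"
  have "\<forall>\<^sub>F N in sequentially. (\<integral>x. ?u x ^ N / fact N \<partial>Q) < e"
    using order_tendstoD(2)[OF growth_linear[of "\<lambda>l. real (k l)"] e] by simp
  then obtain N where N: "(\<integral>x. ?u x ^ N / fact N \<partial>Q) < e"
    by (auto simp: eventually_sequentially)
  have g: "integral_conv (\<lambda>x. \<Sum>i<N. ((- 1) ^ i / fact i) * ?u x ^ i)"
    by (intro integral_conv_sum integral_conv_cmult integral_conv_power) auto
  have h: "integral_conv (\<lambda>x. (1 / fact N) * ?u x ^ N)" by (intro integral_conv_cmult integral_conv_power)
  have "\<bar>expo k x - (\<Sum>i<N. ((- 1) ^ i / fact i) * ?u x ^ i)\<bar> \<le> (1 / fact N) * ?u x ^ N" if "\<forall>l. 0 \<le> x $ l" for x :: "real ^ 'm"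
  proof -
    have "expo k x = exp (- ?u x)" unfolding expo_def using that by (simp add: max_def)
    moreover have "(\<Sum>i<N. ((- 1) ^ i / fact i) * ?u x ^ i) = (\<Sum>i<N. (- ?u x) ^ i / fact i)"
      by (rule sum.cong) (auto simp: power_minus[of "?u x"])
    moreover have "0 \<le> ?u x" using that by (auto intro!: sum_nonneg)
    ultimately show ?thesis using abs_exp_minus_Taylor_le[of "?u x" N] by simp
  qed
  then show "\<exists>g h. integral_conv g \<and> integral_conv h \<and> (\<forall>x. (\<forall>l. 0 \<le> x $ l) \<longrightarrow> \<bar>expo k x - g x\<bar> \<le> h x) \<and> (\<integral>x. h x \<partial>Q) < e"
    using g h N by (intro exI[of _ "\<lambda>x. \<Sum>i<N. ((- 1) ^ i / fact i) * ?u x ^ i"] exI[of _ "\<lambda>x. (1 / fact N) * ?u x ^ N"]) auto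
qed (auto simp: abs_of_nonneg[OF expo_bounds(1)] expo_bounds expo_measurable)

definition expos :: "real ^ 'm \<Rightarrow> real ^ 'm" where
  "expos x = (\<chi> l. exp (- max 0 (x $ l)))"

text \<open>Quantifying over all \<open>k\<close> makes the class stable under multiplication by the
  variables \<open>exp (- x l)\<close>. Hence a polynomial in them can be treated by structural
  induction, without expansion into monomials.\<close>

definition expo_class :: "(real ^ 'm \<Rightarrow> real) \<Rightarrow> bool" where
  "expo_class q \<longleftrightarrow> (\<forall>k. integral_conv (\<lambda>x. q x * expo k x))"

lemma expo_class_mult_expos: "expo_class q \<Longrightarrow> expo_class (\<lambda>x. q x * expos x $ l)"
proof -
  assume q: "expo_class q"
  have "expos x $ l * expo k x = expo (k(l := Suc (k l))) x" for k x
    unfolding expo_def expos_def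
    by (subst (1 2) sum.remove[of UNIV l]) (auto simp: exp_add[symmetric] algebra_simps intro!: sum.cong)
  then show ?thesis using q unfolding expo_class_def by (simp add: mult.assoc)
qed

text \<open>With an arbitrary multiplier \<open>q\<close> the product case is two successive uses of
  the induction hypotheses.\<close>

lemma expo_class_polynomial:
  assumes "real_polynomial_function p"
  shows "expo_class q \<Longrightarrow> expo_class (\<lambda>x. q x * p (expos x))"
  using assms
proof (induction p arbitrary: q rule: real_polynomial_function.induct)
  case (linear p)
  interpret bounded_linear p by fact
  have p: "p y = (\<Sum>l\<in>UNIV. p (axis l 1) * y $ l)" for y
  proof -
    have "p y = p (\<Sum>l\<in>UNIV. y $ l *\<^sub>R axis l 1)"
      using arg_cong[OF basis_expansion[of y, unfolded scalar_mult_eq_scaleR, symmetric], of p] .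
    then show ?thesis by (simp add: sum scaleR mult.commute)
  qed
  have "(\<lambda>x. q x * p (expos x) * expo k x) = (\<lambda>x. \<Sum>l\<in>UNIV. p (axis l 1) * (q x * expos x $ l * expo k x))" for k
    by (rule ext, subst p) (simp add: sum_distrib_left sum_distrib_right mult_ac)
  moreover have "integral_conv (\<lambda>x. \<Sum>l\<in>UNIV. p (axis l 1) * (q x * expos x $ l * expo k x))" for k
    using expo_class_mult_expos[OF linear.prems] unfolding expo_class_def
    by (intro integral_conv_sum integral_conv_cmult) auto
  ultimately show ?case unfolding expo_class_def by simp
next
  case (const c)
  have "(\<lambda>x. q x * c * expo k x) = (\<lambda>x. c * (q x * expo k x))" for k by (simp add: mult_ac)
  then show ?case using const.prems integral_conv_cmult unfolding expo_class_def by simp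
next
  case (add f g)
  then have "integral_conv (\<lambda>x. q x * f (expos x) * expo k x + q x * g (expos x) * expo k x)" for k
    unfolding expo_class_def by (intro integral_conv_add) auto
  then show ?case unfolding expo_class_def by (simp add: algebra_simps)
next
  case (mult f g)
  then have "expo_class (\<lambda>x. q x * f (expos x) * g (expos x))" by blast
  then show ?case by (simp add: mult.assoc)
qed

lemma integral_conv_polynomial_expos: "real_polynomial_function p \<Longrightarrow> integral_conv (\<lambda>x. p (expos x))"
proof -
  assume p: "real_polynomial_function p"
  have "expo_class (\<lambda>x. 1)" unfolding expo_class_def using integral_conv_expo by (simp add: integral_conv_expo[unfolded fun_eq_iff])
  from expo_class_polynomial[OF p this] have "integral_conv (\<lambda>x. 1 * p (expos x) * expo (\<lambda>_. 0) x)"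
    unfolding expo_class_def by blast
  then show ?thesis by (simp add: expo_def)
qed

lemma converges: "converges_in_law P Q"
  unfolding converges_in_law_def
proof (intro allI impI)
  fix f :: "real ^ 'm \<Rightarrow> real" assume f: "continuous_on UNIV f" "bounded (range f)"
  obtain b where b: "b > 0" "\<And>x. \<bar>f x\<bar> \<le> b" using f(2) unfolding bounded_pos by auto
  have "integral_conv f"
  proof (rule approximation[where b=b])
    fix e :: real assume e: "e > 0"
    define A where "A = (\<integral>x. (\<Sum>l\<in>UNIV. x $ l) \<partial>Q)"
    \<comment> \<open>\<open>R\<close> cuts off large coordinates. This value makes the Markov type
      contribution \<open>2 * b / R * A\<close> smaller than \<open>e / 2\<close>.\<close>
    define R where "R = 1 + 4 * b * \<bar>A\<bar> / e"
    have R: "R > 0" using b e by (simp add: R_def add_pos_nonneg)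
    \<comment> \<open>In the variables \<open>y = exp (- x)\<close> the function \<open>f\<close>
      need not extend continuously to \<open>y = 0\<close>, so its arguments are capped at
      \<open>R\<close>. Then \<open>\<phi>\<close> is continuous on the compact cube.\<close>
    define \<phi> where "\<phi> y = f (\<chi> l. - ln (max (y $ l) (exp (- R))))" for y :: "real ^ 'm"
    have mx: "max (y $ l) (exp (- R)) \<noteq> 0" for y :: "real ^ 'm" and l
      by (metis exp_gt_zero less_max_iff_disj less_irrefl)
    have "continuous_on UNIV \<phi>"
      unfolding \<phi>_def
      by (rule continuous_on_compose2[OF f(1)]) (use mx in \<open>auto intro!: continuous_intros continuous_on_vec_lambda\<close>)
    then have "continuous_on (cbox 0 (\<chi> l. 1)) \<phi>" by (rule continuous_on_subset) auto
    moreover have "compact (cbox (0 :: real ^ 'm) (\<chi> l. 1))" by (rule compact_cbox)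
    ultimately obtain p where p: "real_polynomial_function p"
      and pe: "\<And>y. y \<in> cbox 0 (\<chi> l. 1) \<Longrightarrow> \<bar>\<phi> y - p y\<bar> < e / 4"
      using Stone_Weierstrass_real_polynomial_function[of "cbox (0 :: real ^ 'm) (\<chi> l. 1)" \<phi> "e / 4"] e by auto
    let ?h = "\<lambda>x :: real ^ 'm. (2 * b / R) * (\<Sum>l\<in>UNIV. 1 * x $ l) ^ 1 + (e / 4) * (\<Sum>l\<in>UNIV. 1 * x $ l) ^ 0"
    have g: "integral_conv (\<lambda>x. p (expos x))" by (rule integral_conv_polynomial_expos[OF p])
    have h: "integral_conv ?h" by (intro integral_conv_add integral_conv_cmult integral_conv_power)
    have le: "\<bar>f x - p (expos x)\<bar> \<le> ?h x" if x: "\<forall>l. 0 \<le> x $ l" for x :: "real ^ 'm"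
    proof -
      have "expos x \<in> cbox 0 (\<chi> l. 1)"
        unfolding expos_def mem_box_cart by auto
      then have 1: "\<bar>\<phi> (expos x) - p (expos x)\<bar> \<le> e / 4" using pe by (simp add: less_imp_le)
      \<comment> \<open>If no coordinate exceeds \<open>R\<close>, both functions agree; otherwise
        the trivial bound \<open>2 * b\<close> is dominated by a linear function of
        \<open>x\<close>, which has convergent integrals.\<close>
      have "\<bar>f x - \<phi> (expos x)\<bar> \<le> 2 * b / R * (\<Sum>l\<in>UNIV. x $ l)"
      proof (cases "\<forall>l. x $ l \<le> R")
        case True
        have "- ln (max (expos x $ l) (exp (- R))) = x $ l" for l
          using True x by (simp add: expos_def max_absorb1 max_absorb2)
        then have "\<phi> (expos x) = f x" unfolding \<phi>_def by (simp add: vec_eq_iff[symmetric] vec_lambda_eta)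
        then show ?thesis using x b R by (auto intro!: divide_nonneg_pos mult_nonneg_nonneg sum_nonneg)
      next
        case False
        then obtain l where l: "R < x $ l" by (auto simp: not_le)
        also have "x $ l \<le> (\<Sum>l\<in>UNIV. x $ l)" using x by (intro member_le_sum) auto
        finally have "2 * b / R * R \<le> 2 * b / R * (\<Sum>l\<in>UNIV. x $ l)"
          using b R by (intro mult_left_mono) auto
        then have "2 * b \<le> 2 * b / R * (\<Sum>l\<in>UNIV. x $ l)" using R by simp
        moreover have "\<bar>\<phi> (expos x)\<bar> \<le> b" unfolding \<phi>_def by (rule b)
        ultimately show ?thesis using b(2)[of x] by linarith
      qed
      from add_mono[OF this 1] have "\<bar>f x - p (expos x)\<bar> \<le> 2 * b / R * (\<Sum>l\<in>UNIV. x $ l) + e / 4"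
        by (rule order_trans[rotated]) simp
      then show ?thesis by simp
    qed
    have "(\<integral>x. ?h x \<partial>Q) = 2 * b / R * A + e / 4"
    proof -
      interpret Q: prob_space Q by (rule prob_Q)
      have "integrable Q (\<lambda>x. (\<Sum>l\<in>UNIV. 1 * x $ l) ^ 1)"
        using integral_conv_power[of "\<lambda>_. 1" 1] unfolding integral_conv_def by simp
      then show ?thesis unfolding A_def by (simp add: Q.prob_space)
    qed
    also have "\<dots> < e"
    proof -
      have "2 * b * A \<le> 2 * b * \<bar>A\<bar>" using b by simp
      also have "\<dots> < e / 2 * R" using e b by (simp add: R_def field_simps)
      finally have "2 * b / R * A < e / 2" using R by (simp add: field_simps)
      then show ?thesis using e by simp
    qed
    finally have small: "(\<integral>x. ?h x \<partial>Q) < e" .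
    show "\<exists>g h. integral_conv g \<and> integral_conv h \<and> (\<forall>x. (\<forall>l. 0 \<le> x $ l) \<longrightarrow> \<bar>f x - g x\<bar> \<le> h x) \<and> (\<integral>x. h x \<partial>Q) < e"
      by (rule exI[of _ "\<lambda>x. p (expos x)"], rule exI[of _ ?h]) (use g h small le in simp)
  qed (use b borel_measurable_continuous_onI[OF f(1)] in auto)
  then show "(\<lambda>n. \<integral>x. f x \<partial>P n) \<longlonglongrightarrow> (\<integral>x. f x \<partial>Q)" unfolding integral_conv_def by blast
qed

end

section \<open>The Mittag-Leffler moments\<close>

lemma tendsto_0_if_ratio_tendsto_0:
  fixes a q :: "nat \<Rightarrow> real"
  assumes rec: "\<And>n. a (Suc n) = q n * a n" and q: "q \<longlonglongrightarrow> 0"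
  shows "a \<longlonglongrightarrow> 0"
proof -
  obtain N where N: "\<And>n. n \<ge> N \<Longrightarrow> \<bar>q n\<bar> < 1 / 2"
    using LIMSEQ_D[OF q, of "1 / 2"] by auto
  have "norm (a (Suc n)) \<le> 1 / 2 * norm (a n)" if "n \<ge> N" for n
    unfolding rec using mult_right_mono[OF less_imp_le[OF N[OF that]], of "\<bar>a n\<bar>"] by (simp add: abs_mult)
  then have "summable a" by (intro summable_ratio_test[where c="1/2"]) auto
  then show ?thesis by (rule summable_LIMSEQ_zero)
qed

text \<open>\<open>x\<close> is the convex combination of \<open>x + \<alpha>\<close> and
  \<open>x - 1 + \<alpha>\<close> with weights \<open>1 - \<alpha>\<close> and
  \<open>\<alpha>\<close>. Log-convexity of \<open>Gamma\<close> and the functional equation then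
  give the bound.\<close>

lemma Gamma_ratio_le:
  fixes x \<alpha> :: real
  assumes \<alpha>: "0 < \<alpha>" "\<alpha> < 1" and x: "1 - \<alpha> < x"
  shows "Gamma x / Gamma (x + \<alpha>) \<le> (x - 1 + \<alpha>) powr - \<alpha>"
proof -
  have pos: "0 < x" "0 < x - 1 + \<alpha>" "0 < x + \<alpha>" using \<alpha> x by auto
  have x_eq: "x = (1 - \<alpha>) *\<^sub>R (x + \<alpha>) + \<alpha> *\<^sub>R (x - 1 + \<alpha>)" by (simp add: algebra_simps)
  have "(ln \<circ> Gamma) ((1 - \<alpha>) *\<^sub>R (x + \<alpha>) + \<alpha> *\<^sub>R (x - 1 + \<alpha>)) \<le>
      (1 - \<alpha>) * (ln \<circ> Gamma) (x + \<alpha>) + \<alpha> * (ln \<circ> Gamma) (x - 1 + \<alpha>)"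
    using \<alpha> pos by (intro convex_onD[OF log_convex_Gamma_real]) auto
  then have 1: "ln (Gamma x) \<le> (1 - \<alpha>) * ln (Gamma (x + \<alpha>)) + \<alpha> * ln (Gamma (x - 1 + \<alpha>))"
    unfolding x_eq[symmetric] by simp
  have "Gamma (x + \<alpha>) = (x - 1 + \<alpha>) * Gamma (x - 1 + \<alpha>)"
    using Gamma_plus1[of "x - 1 + \<alpha>"] nonpos_Ints_nonpos[of "x - 1 + \<alpha>"] pos by (auto simp: algebra_simps)
  then have "ln (Gamma (x + \<alpha>)) = ln (x - 1 + \<alpha>) + ln (Gamma (x - 1 + \<alpha>))"
    using ln_mult_pos[OF pos(2) Gamma_real_pos[OF pos(2)]] by simp
  then have "ln (Gamma x) \<le> ln (Gamma (x + \<alpha>)) - \<alpha> * ln (x - 1 + \<alpha>)"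
    using 1 by (simp add: algebra_simps)
  then have "ln (Gamma x / Gamma (x + \<alpha>)) \<le> - \<alpha> * ln (x - 1 + \<alpha>)"
    using Gamma_real_pos[OF pos(1)] Gamma_real_pos[OF pos(3)] by (simp add: ln_div)
  then have "Gamma x / Gamma (x + \<alpha>) \<le> exp (- \<alpha> * ln (x - 1 + \<alpha>))"
    using Gamma_real_pos[OF pos(1)] Gamma_real_pos[OF pos(3)] by (subst ln_le_cancel_iff[symmetric]) auto
  then show ?thesis using pos by (simp add: powr_def)
qed

lemma Gamma_ratio_tendsto_0:
  fixes \<alpha> c :: real
  assumes \<alpha>: "0 < \<alpha>" "\<alpha> < 1" and c: "0 < c"
  shows "(\<lambda>n. Gamma (\<alpha> * real n + c) / Gamma (\<alpha> * real n + c + \<alpha>)) \<longlonglongrightarrow> 0"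
proof (rule tendsto_sandwich[where f="\<lambda>_. 0" and h="\<lambda>n. (\<alpha> * real n + c - 1 + \<alpha>) powr - \<alpha>"])
  have top: "filterlim (\<lambda>n. \<alpha> * real n + c - 1 + \<alpha>) at_top sequentially"
    using \<alpha> by real_asymp
  show "(\<lambda>n. (\<alpha> * real n + c - 1 + \<alpha>) powr - \<alpha>) \<longlonglongrightarrow> 0"
    using \<alpha> by (intro tendsto_neg_powr top) auto
  have "\<forall>\<^sub>F n in sequentially. 0 < \<alpha> * real n + c - 1 + \<alpha>"
    using top by (simp add: filterlim_at_top_dense)
  then show "\<forall>\<^sub>F n in sequentially. Gamma (\<alpha> * real n + c) / Gamma (\<alpha> * real n + c + \<alpha>) \<le> (\<alpha> * real n + c - 1 + \<alpha>) powr - \<alpha>"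
    by eventually_elim (intro Gamma_ratio_le \<alpha>, simp)
  have "0 < \<alpha> * real n + c" for n using \<alpha> c by (intro add_nonneg_pos) auto
  then have "0 \<le> Gamma (\<alpha> * real n + c) / Gamma (\<alpha> * real n + c + \<alpha>)" for n
    by (intro divide_nonneg_nonneg less_imp_le[OF Gamma_real_pos] add_pos_pos[OF _ \<alpha>(1)])
  then show "\<forall>\<^sub>F n in sequentially. 0 \<le> Gamma (\<alpha> * real n + c) / Gamma (\<alpha> * real n + c + \<alpha>)" by simp
qed auto

lemma Gamma_real_plus1: "0 < x \<Longrightarrow> Gamma (x + 1) = x * Gamma (x::real)"
  using Gamma_plus1[of x] nonpos_Ints_nonpos[of x] by auto

text \<open>The ratio of consecutive terms is \<open>r\<close>, times a factor tending to
  \<open>1\<close>, times \<open>Gamma (\<alpha> * j + c) / Gamma (\<alpha> * j + c +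
  \<alpha>)\<close>, which tends to \<open>0\<close>.\<close>

lemma moment_growth:
  fixes \<alpha> c g r C :: real
  assumes \<alpha>: "0 < \<alpha>" "\<alpha> < 1" and c: "0 < c" and g: "0 < g"
  shows "(\<lambda>j. r ^ j * (C / Gamma (\<alpha> * real j + c) * Gamma (real j + g)) / fact j) \<longlonglongrightarrow> 0"
proof (rule tendsto_0_if_ratio_tendsto_0)
  let ?q = "\<lambda>j. r * ((real j + g) / (real j + 1)) * (Gamma (\<alpha> * real j + c) / Gamma (\<alpha> * real j + c + \<alpha>))"
  have "(\<lambda>j. r * ((real j + g) / (real j + 1))) \<longlonglongrightarrow> r * 1"
    by (intro tendsto_mult tendsto_const) real_asymp
  from tendsto_mult[OF this Gamma_ratio_tendsto_0[OF \<alpha> c]] show "?q \<longlonglongrightarrow> 0" by simp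
  fix j
  have pos: "0 < Gamma (\<alpha> * real j + c)"
    using \<alpha> c by (intro Gamma_real_pos) (auto intro!: add_nonneg_pos)
  have G: "Gamma (real (Suc j) + g) = (real j + g) * Gamma (real j + g)"
    using Gamma_real_plus1[of "real j + g"] g by (simp add: algebra_simps)
  have e: "\<alpha> * real (Suc j) + c = \<alpha> * real j + c + \<alpha>" by (simp add: algebra_simps)
  have f: "fact (Suc j) = (real j + 1) * fact j" by (simp add: algebra_simps)
  have gen: "r * x * (C / b * (y * z)) / ((k + 1) * f) = r * (y / (k + 1)) * (a / b) * (x * (C / a * z) / f)"
    if "a \<noteq> 0" for a b x y z k f :: real
    using that by (simp, simp add: mult_ac)
  show "r ^ Suc j * (C / Gamma (\<alpha> * real (Suc j) + c) * Gamma (real (Suc j) + g)) / fact (Suc j) =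
     ?q j * (r ^ j * (C / Gamma (\<alpha> * real j + c) * Gamma (real j + g)) / fact j)"
    unfolding G e f power_Suc by (rule gen) (use pos in simp)
qed

text \<open>For Gamma moments, of size \<open>s!\<close>, this is the growth condition after passage
  to symmetrized square roots: the moment of order \<open>2 * s\<close> is compared with
  \<open>(2 * s)!\<close>, which grows faster.\<close>

lemma moment_growth_even:
  fixes g t :: real
  assumes g: "0 < g"
  shows "(\<lambda>s. t ^ (2 * s) * (Gamma (real s + g) / Gamma g) / fact (2 * s)) \<longlonglongrightarrow> 0"
proof (rule tendsto_0_if_ratio_tendsto_0)
  let ?q = "\<lambda>s. t\<^sup>2 * ((real s + g) / ((2 * real s + 2) * (2 * real s + 1)))"
  have "(\<lambda>s. t\<^sup>2 * ((real s + g) / ((2 * real s + 2) * (2 * real s + 1)))) \<longlonglongrightarrow> t\<^sup>2 * 0"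
    by (intro tendsto_mult tendsto_const) real_asymp
  then show "?q \<longlonglongrightarrow> 0" by simp
  fix s
  have G: "Gamma (real (Suc s) + g) = (real s + g) * Gamma (real s + g)"
    using Gamma_real_plus1[of "real s + g"] g by (simp add: algebra_simps)
  have f: "fact (2 * Suc s) = (2 * real s + 2) * (2 * real s + 1) * fact (2 * s)"
    by (simp add: algebra_simps)
  have p: "t ^ (2 * Suc s) = t\<^sup>2 * t ^ (2 * s)" by (simp add: power2_eq_square)
  show "t ^ (2 * Suc s) * (Gamma (real (Suc s) + g) / Gamma g) / fact (2 * Suc s) =
      ?q s * (t ^ (2 * s) * (Gamma (real s + g) / Gamma g) / fact (2 * s))"
    unfolding G f p by (simp, simp add: mult_ac)
qed

lemma (in prob_space) integrable_if_bounded_by_power: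
  fixes X :: "'a \<Rightarrow> real"
  assumes "integrable M (\<lambda>x. X x ^ k)" "AE x in M. 0 \<le> X x" "X \<in> borel_measurable M"
    "f \<in> borel_measurable M" "AE x in M. \<bar>f x\<bar> \<le> 1 + X x ^ k"
  shows "integrable M f"
  by (rule Bochner_Integration.integrable_bound[of _ "\<lambda>x. 1 + X x ^ k"])
    (use assms in \<open>auto intro: AE_mp\<close>)

text \<open>Bounded first moments give tightness, and a weakly convergent subsequence suffices, as
  its moments have the prescribed limits. Moments of order \<open>s\<close> pass to the weak limit
  because those of order \<open>2 * s\<close> stay bounded.\<close>

lemma exists_limit_distribution:
  fixes Y :: "nat \<Rightarrow> real measure" and m :: "nat \<Rightarrow> real"
  assumes Y: "\<And>n. real_distribution (Y n)" "\<And>n. AE x in Y n. 0 \<le> x"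
    and int: "\<And>n s. integrable (Y n) (\<lambda>x. x ^ s)"
    and lim: "\<And>s. (\<lambda>n. \<integral>x. x ^ s \<partial>Y n) \<longlonglongrightarrow> m s"
  shows "\<exists>N. real_distribution N \<and> (AE x in N. 0 \<le> x) \<and>
    (\<forall>s. integrable N (\<lambda>x. x ^ s) \<and> (\<integral>x. x ^ s \<partial>N) = m s)"
proof -
  interpret Y: real_distribution "Y n" for n by (rule Y)
  obtain B where B: "B > 0" "\<And>n. (\<integral>x. x ^ 1 \<partial>Y n) \<le> B"
    using convergent_imp_Bseq[OF convergentI[OF lim[of 1]]] unfolding Bseq_def by (auto simp: abs_le_iff)
  have "tight Y"
    unfolding tight_def
  proof (intro conjI allI impI)
    fix e :: real assume e: "0 < e"
    define b where "b = (B + 1) / e"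
    have b: "b > 0" using e B by (simp add: b_def)
    \<comment> \<open>No law charges the negative half line, so only the upper end requires Markov's
      inequality.\<close>
    have "1 - e < measure (Y n) {-1<..b}" for n
    proof -
      have "emeasure (Y n) {x \<in> space (Y n). b \<le> x ^ 1} \<le> ennreal (1 / b * (\<integral>x. x ^ 1 \<partial>Y n))"
        using int[of n 1] Y(2)[of n] b by (intro integral_Markov_inequality) auto
      moreover have "0 \<le> (\<integral>x. x ^ 1 \<partial>Y n)" using Y(2)[of n] by (intro integral_nonneg_AE) auto
      ultimately have "measure (Y n) {x. b \<le> x} \<le> 1 / b * (\<integral>x. x ^ 1 \<partial>Y n)"
        using b by (simp add: Y.emeasure_eq_measure ennreal_le_iff)
      moreover have "1 / b * (\<integral>x. x ^ 1 \<partial>Y n) \<le> 1 / b * B" using B b by (intro mult_left_mono) auto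
      moreover have "1 / b * B < e" using e B b unfolding b_def by (simp add: field_simps)
      ultimately have "measure (Y n) {x. b \<le> x} < e" by linarith
      moreover have "measure (Y n) (- {-1<..b}) \<le> measure (Y n) {x. b \<le> x}"
        by (rule Y.finite_measure_mono_AE) (use Y(2)[of n] in \<open>auto elim!: eventually_mono\<close>)
      moreover have "measure (Y n) (- {-1<..b}) = 1 - measure (Y n) {-1<..b}"
        using Y.prob_compl[of "{-1<..b}" n] by (simp add: Compl_eq_Diff_UNIV)
      ultimately show ?thesis by linarith
    qed
    then show "\<exists>a b. a < b \<and> (\<forall>n. 1 - e < measure (Y n) {a<..b})" using b by (intro exI[of _ "-1"] exI[of _ b]) auto
  qed (rule Y)
  then obtain r N where r: "strict_mono r" and N: "real_distribution N" and w: "weak_conv_m (Y \<circ> id \<circ> r) N"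
    using tight_imp_convergent_subsubsequence[of Y id] by (auto simp: strict_mono_def)
  interpret N: real_distribution N by (rule N)
  have conv: "(\<lambda>n. \<integral>x. f x \<partial>Y (r n)) \<longlonglongrightarrow> (\<integral>x. f x \<partial>N)"
    if "continuous_on UNIV f" "\<And>x. norm (f x) \<le> b" for f :: "real \<Rightarrow> real" and b
    using weak_conv_imp_integral_bdd_continuous_conv[of "Y \<circ> id \<circ> r" N f b] w N Y that
    by (simp add: continuous_on_eq_continuous_at)
  have limr: "(\<lambda>n. \<integral>x. x ^ s \<partial>Y (r n)) \<longlonglongrightarrow> m s" for s
    using LIMSEQ_subseq_LIMSEQ[OF lim r] by (simp add: o_def)
  have pos: "AE x in N. 0 \<le> x"
  proof -
    \<comment> \<open>A bounded continuous test function that vanishes exactly on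
      \<open>x \<ge> 0\<close>.\<close>
    let ?f = "\<lambda>x :: real. min 1 (max 0 (- x))"
    have L: "(\<lambda>n. \<integral>x. ?f x \<partial>Y (r n)) \<longlonglongrightarrow> (\<integral>x. ?f x \<partial>N)"
      by (rule conv[of ?f 1]) (auto intro!: continuous_intros)
    have Z: "(\<integral>x. ?f x \<partial>Y (r n)) = 0" for n
      using Y(2)[of "r n"] by (intro integral_eq_zero_AE) (auto elim!: eventually_mono)
    from L have "(\<integral>x. ?f x \<partial>N) = 0" unfolding Z LIMSEQ_const_iff by (rule sym)
    have "?f \<in> borel_measurable N" by measurable
    then have "integrable N ?f" by (rule N.integrable_const_bound[where B=1, rotated]) simp
    then have "AE x in N. ?f x = 0"
      using \<open>(\<integral>x. ?f x \<partial>N) = 0\<close> integral_nonneg_eq_0_iff_AE[of N ?f] by simp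
    then show ?thesis by eventually_elim (auto simp: min_def max_def split: if_splits)
  qed
  have moments: "integrable N (\<lambda>x. x ^ s) \<and> (\<integral>x. x ^ s \<partial>N) = m s" for s
  proof -
    \<comment> \<open>Truncation at height \<open>k + 1\<close>; the successor keeps the height
      positive in the divisions below.\<close>
    define f where "f k x = min (max 0 x ^ s) (real (Suc k))" for k and x :: real
    have cont: "continuous_on UNIV (f k)" for k unfolding f_def by (intro continuous_intros)
    have bnd: "0 \<le> f k x" "f k x \<le> real (Suc k)" for k x unfolding f_def by auto
    have fm [measurable]: "f k \<in> borel_measurable borel" for k
      by (rule borel_measurable_continuous_onI[OF cont])
    have fc: "(\<lambda>n. \<integral>x. f k x \<partial>Y (r n)) \<longlonglongrightarrow> (\<integral>x. f k x \<partial>N)" for k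
      by (rule conv[OF cont, of k "real (Suc k)"]) (use bnd in \<open>auto simp: abs_of_nonneg\<close>)
    have fiY: "integrable (Y n) (f k)" for n k
      by (rule Y.integrable_const_bound[where B="real (Suc k)"]) (use bnd in \<open>auto simp: abs_of_nonneg\<close>)
    have fiN: "integrable N (f k)" for k
      by (rule N.integrable_const_bound[where B="real (Suc k)"]) (use bnd in \<open>auto simp: abs_of_nonneg\<close>)
    have up: "(\<integral>x. f k x \<partial>N) \<le> m s" for k
    proof (rule LIMSEQ_le[OF fc limr])
      have "(\<integral>x. f k x \<partial>Y (r n)) \<le> (\<integral>x. x ^ s \<partial>Y (r n))" for n
        by (rule integral_mono_AE[OF fiY int]) (use Y(2)[of "r n"] in \<open>auto elim!: eventually_mono simp: f_def max_absorb2\<close>)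
      then show "\<exists>N. \<forall>n\<ge>N. (\<integral>x. f k x \<partial>Y (r n)) \<le> (\<integral>x. x ^ s \<partial>Y (r n))" by blast
    qed
    \<comment> \<open>From \<open>p - p * p / K \<le> min p K\<close> for
      \<open>p = x ^ s \<ge> 0\<close>: the loss by truncation at height \<open>K\<close> is at most
      the moment of order \<open>2 * s\<close> divided by \<open>K\<close>.\<close>
    have low: "m s - m (2 * s) / real (Suc k) \<le> (\<integral>x. f k x \<partial>N)" for k
    proof (rule LIMSEQ_le[OF tendsto_diff[OF limr tendsto_divide[OF limr[of "2 * s"] tendsto_const]] fc])
      have "(\<integral>x. x ^ s \<partial>Y (r n)) - (\<integral>x. x ^ (2 * s) \<partial>Y (r n)) / real (Suc k) \<le> (\<integral>x. f k x \<partial>Y (r n))" for n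
      proof -
        have "(\<integral>x. x ^ s - x ^ (2 * s) / real (Suc k) \<partial>Y (r n)) \<le> (\<integral>x. f k x \<partial>Y (r n))"
        proof (rule integral_mono_AE[OF _ fiY])
          show "integrable (Y (r n)) (\<lambda>x. x ^ s - x ^ (2 * s) / real (Suc k))"
            using int[of "r n" s] int[of "r n" "2 * s"] by auto
          show "AE x in Y (r n). x ^ s - x ^ (2 * s) / real (Suc k) \<le> f k x"
            using Y(2)[of "r n"]
          proof eventually_elim
            case (elim x)
            let ?p = "x ^ s" and ?K = "real (Suc k)"
            have p: "0 \<le> ?p" using elim by simp
            have e: "x ^ (2 * s) = ?p * ?p" by (simp add: mult_2 power_add)
            show ?case
            proof (cases "?p \<le> ?K")
              case True
              then have "f k x = ?p" using elim by (simp add: f_def max_absorb2)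
              then show ?thesis using p by (simp add: e)
            next
              case False
              then have "?p * ?K \<le> ?p * ?p" using p by (intro mult_left_mono) auto
              then have "?p \<le> ?p * ?p / ?K" by (simp add: field_simps)
              then show ?thesis using bnd(1)[of k x] unfolding e by linarith
            qed
          qed
        qed
        then show ?thesis using int[of "r n" s] int[of "r n" "2 * s"] by simp
      qed
      then show "\<exists>N. \<forall>n\<ge>N. (\<integral>x. x ^ s \<partial>Y (r n)) - (\<integral>x. x ^ (2 * s) \<partial>Y (r n)) / real (Suc k) \<le> (\<integral>x. f k x \<partial>Y (r n))" by blast
    qed auto
    have "(\<lambda>k. m s - m (2 * s) / real (Suc k)) \<longlonglongrightarrow> m s - 0"
      by (intro tendsto_diff tendsto_const LIMSEQ_Suc[OF lim_const_over_n])
    then have ul: "(\<lambda>k. m s - m (2 * s) / real (Suc k)) \<longlonglongrightarrow> m s" unfolding diff_zero .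
    have fl: "(\<lambda>k. \<integral>x. f k x \<partial>N) \<longlonglongrightarrow> m s"
      by (rule tendsto_sandwich[OF always_eventually always_eventually ul tendsto_const]) (use up low in blast)+
    have "AE x in N. mono (\<lambda>k. f k x)" by (auto simp: f_def mono_def)
    moreover have "AE x in N. (\<lambda>k. f k x) \<longlonglongrightarrow> x ^ s"
      using pos
    proof eventually_elim
      case (elim x)
      obtain K where "x ^ s < real K" using reals_Archimedean2 by blast
      then have "f k x = x ^ s" if "k \<ge> K" for k using elim that by (simp add: f_def max_absorb2)
      then have "\<forall>\<^sub>F k in sequentially. f k x = x ^ s" using eventually_sequentially by blast
      then show ?case by (rule tendsto_eventually)
    qed
    ultimately show ?thesis
      using integral_monotone_convergence_nonneg[of N f "\<lambda>x. x ^ s" "m s"] fiN bnd(1) fl by simp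
  qed
  show ?thesis using N pos moments by blast
qed

section \<open>Gamma laws and symmetrized square roots\<close>

definition gamma_measure :: "real \<Rightarrow> real measure" where
  "gamma_measure a = density lborel (\<lambda>t. ennreal (indicator {0..} t * t powr (a - 1) / exp t / Gamma a))"

lemma gamma_measure_moment:
  assumes a: "0 < a" and r: "0 \<le> r"
  shows "(\<integral>\<^sup>+x. ennreal (x powr r) \<partial>gamma_measure a) = ennreal (Gamma (a + r) / Gamma a)"
proof -
  have ga: "0 < Gamma a" using a by (rule Gamma_real_pos)
  have "(\<integral>\<^sup>+x. ennreal (x powr r) \<partial>gamma_measure a) =
     (\<integral>\<^sup>+t. ennreal (indicator {0..} t * t powr (a - 1) / exp t / Gamma a) * ennreal (t powr r) \<partial>lborel)"
    unfolding gamma_measure_def by (rule nn_integral_density) auto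
  also have "\<dots> = (\<integral>\<^sup>+t. ennreal (1 / Gamma a) * ennreal (indicator {0..} t * t powr ((a + r) - 1) / exp t) \<partial>lborel)"
  proof (rule nn_integral_cong)
    fix t :: real
    have "t powr (a - 1) * t powr r = t powr ((a + r) - 1)" by (simp add: powr_add[symmetric] algebra_simps)
    then have "indicator {0..} t * t powr (a - 1) / exp t / Gamma a * t powr r =
       1 / Gamma a * (indicator {0..} t * t powr ((a + r) - 1) / exp t)" by (simp add: mult_ac)
    then show "ennreal (indicator {0..} t * t powr (a - 1) / exp t / Gamma a) * ennreal (t powr r) =
       ennreal (1 / Gamma a) * ennreal (indicator {0..} t * t powr ((a + r) - 1) / exp t)"
      using ga by (simp only: ennreal_mult'[symmetric] ennreal_mult''[symmetric] powr_ge_zero zero_le_divide_1_iff less_imp_le)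
  qed
  also have "\<dots> = ennreal (1 / Gamma a) * ennreal (Gamma (a + r))"
    using Gamma_conv_nn_integral_real[of "a + r"] a r by (subst nn_integral_cmult) auto
  finally show ?thesis using ga by (simp add: ennreal_mult'[symmetric])
qed

lemma prob_space_gamma_measure:
  assumes a: "0 < a"
  shows "prob_space (gamma_measure a)" "AE x in gamma_measure a. 0 < x" "sets (gamma_measure a) = sets borel"
proof -
  show sets: "sets (gamma_measure a) = sets borel" by (simp add: gamma_measure_def)
  have "AE x in lborel. x \<noteq> (0::real)" by (rule AE_lborel_singleton)
  then show pos: "AE x in gamma_measure a. 0 < x"
    unfolding gamma_measure_def by (subst AE_density) (auto elim!: eventually_mono split: split_indicator_asm)
  have "(\<integral>\<^sup>+x. 1 \<partial>gamma_measure a) = (\<integral>\<^sup>+x. ennreal (x powr 0) \<partial>gamma_measure a)"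
    using pos by (intro nn_integral_cong_AE) (auto elim!: eventually_mono)
  also have "\<dots> = 1" using gamma_measure_moment[OF a, of 0] Gamma_real_pos[OF a] by simp
  finally show "prob_space (gamma_measure a)" by (intro prob_spaceI) simp
qed

lemma gamma_measure_integral:
  assumes a: "0 < a" and r: "0 \<le> r"
  shows "integrable (gamma_measure a) (\<lambda>x. x powr r)" "(\<integral>x. x powr r \<partial>gamma_measure a) = Gamma (a + r) / Gamma a"
proof -
  have g: "0 \<le> Gamma (a + r) / Gamma a" using a r by (intro divide_nonneg_nonneg less_imp_le Gamma_real_pos) auto
  have m: "(\<lambda>x. x powr r) \<in> borel_measurable (gamma_measure a)"
    by (subst measurable_cong_sets[OF prob_space_gamma_measure(3)[OF a] refl]) measurable
  have "has_bochner_integral (gamma_measure a) (\<lambda>x. x powr r) (Gamma (a + r) / Gamma a)"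
    by (rule has_bochner_integral_nn_integral[OF m _ g gamma_measure_moment[OF a r]]) auto
  then show "integrable (gamma_measure a) (\<lambda>x. x powr r)" "(\<integral>x. x powr r \<partial>gamma_measure a) = Gamma (a + r) / Gamma a"
    by (auto simp: has_bochner_integral_iff)
qed
text \<open>The law of a fair random sign.\<close>

definition sign_measure :: "real measure" where
  "sign_measure = distr (measure_pmf (pmf_of_set {- 1, 1})) borel (\<lambda>x. x)"

lemma sign_measure:
  "prob_space sign_measure" "sets sign_measure = sets borel" "AE x in sign_measure. x \<noteq> 0"
  "integrable sign_measure (\<lambda>x. x ^ k)"
  "(\<integral>x. x ^ k \<partial>sign_measure) = (if even k then 1 else 0)"
proof -
  show "prob_space sign_measure" unfolding sign_measure_def
    by (rule prob_space.prob_space_distr) (auto intro: measure_pmf.prob_space_axioms)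
  show "sets sign_measure = sets borel" by (simp add: sign_measure_def)
  show "AE x in sign_measure. x \<noteq> 0"
    unfolding sign_measure_def by (subst AE_distr_iff) (auto simp: AE_measure_pmf_iff)
  show "integrable sign_measure (\<lambda>x. x ^ k)"
    unfolding sign_measure_def by (subst integrable_distr_eq) (auto intro!: integrable_measure_pmf_finite)
  have "(\<integral>x. x ^ k \<partial>sign_measure) = measure_pmf.expectation (pmf_of_set {- 1, 1}) (\<lambda>x. x ^ k)"
    unfolding sign_measure_def by (subst integral_distr) auto
  also have "\<dots> = (if even k then 1 else 0)" by (subst integral_pmf_of_set) auto
  finally show "(\<integral>x. x ^ k \<partial>sign_measure) = (if even k then 1 else 0)" .
qed

text \<open>For \<open>X \<ge> 0\<close> this is the law of
  \<open>e * sqrt (X * g powr \<alpha>)\<close> with independent \<open>X\<close>, Gamma variable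
  \<open>g\<close> of parameter \<open>a\<close> and fair sign \<open>e\<close>. The sign removes
  the odd moments; by the square root the moment of order \<open>2 * s\<close> is that of
  \<open>X * g powr \<alpha>\<close> of order \<open>s\<close>.\<close>

definition signed_mixture :: "real measure \<Rightarrow> real \<Rightarrow> real \<Rightarrow> real measure" where
  "signed_mixture N a \<alpha> = distr (PiM {0, 1, 2 :: nat} (\<lambda>i. if i = 0 then N else if i = 1 then gamma_measure a else sign_measure))
     borel (\<lambda>x. x 2 * sqrt (x 0) * x 1 powr (\<alpha> / 2))"

text \<open>On the product space the moments factor over the three coordinates. As \<open>g\<close>
  and the sign are almost surely nonzero, an atom at \<open>0\<close> can only come from
  \<open>X\<close>.\<close>

lemma signed_mixture:
  assumes N: "real_distribution N" "AE x in N. 0 \<le> x" "\<And>s::nat. integrable N (\<lambda>x. x ^ s)"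
    and a: "0 < a" and \<alpha>: "0 < \<alpha>"
  shows "real_distribution (signed_mixture N a \<alpha>)"
    and "integrable (signed_mixture N a \<alpha>) (\<lambda>x. x ^ k)"
    and "odd k \<Longrightarrow> (\<integral>x. x ^ k \<partial>signed_mixture N a \<alpha>) = 0"
    and "(\<integral>x. x ^ (2 * s) \<partial>signed_mixture N a \<alpha>) = (\<integral>x. x ^ s \<partial>N) * (Gamma (a + \<alpha> * real s) / Gamma a)"
    and "(AE x in signed_mixture N a \<alpha>. x \<noteq> 0) \<longleftrightarrow> (AE x in N. x \<noteq> 0)"
proof -
  define I where "I = {0, 1, 2 :: nat}"
  define K where "K i = (if i = 0 then N else if i = 1 then gamma_measure a else sign_measure)" for i :: nat
  define T where "T x = x 2 * sqrt (x 0) * x 1 powr (\<alpha> / 2)" for x :: "nat \<Rightarrow> real"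
  interpret N: real_distribution N by (rule N)
  have probK: "prob_space (K i)" for i
    unfolding K_def using N.prob_space_axioms prob_space_gamma_measure[OF a] sign_measure by simp
  have setsK [measurable_cong]: "sets (K i) = sets borel" for i
    unfolding K_def using prob_space_gamma_measure[OF a] sign_measure by simp
  interpret Kp: prob_space "K i" for i by (rule probK)
  interpret K: product_prob_space K I by unfold_locales
  interpret fK: finite_product_prob_space K I by standard (simp add: I_def)
  have comp [measurable]: "(\<lambda>x. x i) \<in> borel_measurable (PiM I K)" if "i \<in> I" for i
    using measurable_component_singleton[OF that, of K] measurable_cong_sets[OF refl setsK, of "PiM I K" i] by blast
  have mT: "T \<in> borel_measurable (PiM I K)"
    unfolding T_def using comp[of 0] comp[of 1] comp[of 2] by (simp add: I_def)
  have mix: "signed_mixture N a \<alpha> = distr (PiM I K) borel T"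
    unfolding signed_mixture_def I_def K_def[abs_def] T_def[abs_def] ..
  show "real_distribution (signed_mixture N a \<alpha>)"
    unfolding mix by (rule K.P.real_distribution_distr[OF mT])
  \<comment> \<open>One function per coordinate, whose product is the \<open>k\<close>-th power of
    the variable wherever \<open>x 1 > 0\<close>, hence almost everywhere.\<close>
  define F where "F k i x = (if i = 0 then sqrt x ^ k else if i = 1 then x powr (\<alpha> / 2 * real k) else x ^ k)"
    for k :: nat and i :: nat and x :: real
  have gpos: "AE x in gamma_measure a. 0 < x" by (rule prob_space_gamma_measure[OF a])
  have AE_comp: "AE x in PiM I K. P (x i)" if "i \<in> I" "AE x in K i. P x" for i P
    by (rule AE_PiM_component[where M=K and i=i and P=P]) (use probK that in auto)
  have K_simps: "K 0 = N" "K 1 = gamma_measure a" "K 2 = sign_measure" by (simp_all add: K_def)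
  have pos1: "AE x in PiM I K. 0 < x 1"
    by (rule AE_comp) (unfold K_simps, use gpos in \<open>auto simp: I_def\<close>)
  have pos0: "AE x in PiM I K. 0 \<le> x 0"
    by (rule AE_comp) (unfold K_simps, use N in \<open>auto simp: I_def\<close>)
  have nz2: "AE x in PiM I K. x 2 \<noteq> 0"
    by (rule AE_comp) (unfold K_simps, use sign_measure(3) in \<open>auto simp: I_def\<close>)
  have TF: "AE x in PiM I K. T x ^ k = (\<Prod>i\<in>I. F k i (x i))" for k
    using pos1
  proof eventually_elim
    case (elim x)
    have "(x 1 powr (\<alpha> / 2)) ^ k = x 1 powr (\<alpha> / 2 * real k)" using elim by (simp add: powr_power mult.commute)
    then show ?case by (simp add: I_def F_def T_def power_mult_distrib mult_ac)
  qed
  have sqrt_int: "integrable N (\<lambda>x. sqrt x ^ k)" for k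
  proof (rule N.integrable_if_bounded_by_power[where X="\<lambda>x. x" and k=k])
    show "AE x in N. \<bar>sqrt x ^ k\<bar> \<le> 1 + x ^ k" using N(2)
    proof eventually_elim
      case (elim x)
      have "sqrt x \<le> max 1 x"
        using elim by (cases "x \<le> 1") (auto simp: max_def real_sqrt_le_1_iff intro: order_trans[OF real_sqrt_le_iff[THEN iffD2], of _ "x * x"])
      then have "sqrt x ^ k \<le> max 1 x ^ k" using elim by (intro power_mono) auto
      also have "\<dots> \<le> 1 + x ^ k" using elim by (auto simp: max_def)
      finally show ?case using elim by simp
    qed
  qed (use N in auto)
  have FI: "integrable (K i) (F k i)" if "i \<in> I" for i k
    using that sqrt_int[of k] sign_measure(4)[of k] gamma_measure_integral(1)[OF a, of "\<alpha> / 2 * real k"] \<alpha>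
    unfolding I_def F_def[abs_def] K_def by auto
  have PI: "integrable (PiM I K) (\<lambda>x. \<Prod>i\<in>I. F k i (x i))" for k
    by (rule K.product_integrable_prod) (auto simp: FI I_def[symmetric], simp add: I_def)
  have PE: "(\<integral>x. (\<Prod>i\<in>I. F k i (x i)) \<partial>PiM I K) = (\<Prod>i\<in>I. \<integral>x. F k i x \<partial>K i)" for k
    by (rule K.product_integral_prod) (auto simp: FI I_def[symmetric], simp add: I_def)
  have Tk: "(\<lambda>x. T x ^ k) \<in> borel_measurable (PiM I K)" for k using mT by measurable
  have int: "integrable (PiM I K) (\<lambda>x. T x ^ k)" for k
    using PI[of k] TF[of k] Tk[of k] integrable_cong_AE borel_measurable_integrable by blast
  show "integrable (signed_mixture N a \<alpha>) (\<lambda>x. x ^ k)"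
    unfolding mix by (subst integrable_distr_eq[OF mT]) (use int in auto)
  have E: "(\<integral>x. x ^ k \<partial>signed_mixture N a \<alpha>) = (\<Prod>i\<in>I. \<integral>x. F k i x \<partial>K i)" for k
  proof -
    have "(\<integral>x. x ^ k \<partial>signed_mixture N a \<alpha>) = (\<integral>x. T x ^ k \<partial>PiM I K)"
      unfolding mix by (subst integral_distr[OF mT]) auto
    also have "\<dots> = (\<integral>x. (\<Prod>i\<in>I. F k i (x i)) \<partial>PiM I K)"
      by (rule integral_cong_AE[OF Tk borel_measurable_integrable[OF PI] TF])
    finally show ?thesis unfolding PE .
  qed
  have E3: "(\<integral>x. x ^ k \<partial>signed_mixture N a \<alpha>) =
     (\<integral>x. sqrt x ^ k \<partial>N) * (Gamma (a + \<alpha> / 2 * real k) / Gamma a) * (if even k then 1 else 0)" for k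
    unfolding E using gamma_measure_integral(2)[OF a, of "\<alpha> / 2 * real k"] sign_measure(5)[of k] \<alpha>
    by (simp add: I_def F_def[abs_def] K_def)
  show "odd k \<Longrightarrow> (\<integral>x. x ^ k \<partial>signed_mixture N a \<alpha>) = 0" unfolding E3 by simp
  have "(\<integral>x. sqrt x ^ (2 * s) \<partial>N) = (\<integral>x. x ^ s \<partial>N)"
    using N(2) by (intro integral_cong_AE) (auto elim!: eventually_mono simp: power_mult)
  then show "(\<integral>x. x ^ (2 * s) \<partial>signed_mixture N a \<alpha>) = (\<integral>x. x ^ s \<partial>N) * (Gamma (a + \<alpha> * real s) / Gamma a)"
    unfolding E3 by simp
  have "(AE x in signed_mixture N a \<alpha>. x \<noteq> 0) \<longleftrightarrow> (AE x in PiM I K. T x \<noteq> 0)"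
    unfolding mix by (subst AE_distr_iff[OF mT]) auto
  also have "\<dots> \<longleftrightarrow> (AE x in PiM I K. x 0 \<noteq> 0)"
  proof
    assume "AE x in PiM I K. T x \<noteq> 0"
    then show "AE x in PiM I K. x 0 \<noteq> 0" by eventually_elim (auto simp: T_def)
  next
    assume "AE x in PiM I K. x 0 \<noteq> 0"
    then show "AE x in PiM I K. T x \<noteq> 0" using pos1 nz2 by eventually_elim (auto simp: T_def)
  qed
  also have "\<dots> \<longleftrightarrow> (AE x in distr (PiM I K) (K 0) (\<lambda>x. x 0). x \<noteq> 0)"
    by (subst AE_distr_iff) (auto simp: I_def K_def)
  also have "distr (PiM I K) (K 0) (\<lambda>x. x 0) = K 0"
    by (rule distr_PiM_component[OF probK]) (auto simp: I_def)
  finally show "(AE x in signed_mixture N a \<alpha>. x \<noteq> 0) \<longleftrightarrow> (AE x in N. x \<noteq> 0)" unfolding K_simps .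
qed

text \<open>
  If \<open>X\<close> has the Mittag-Leffler moments and \<open>g\<close> is an independent Gamma variable of parameter \<open>\<alpha> c\<close>, then
  \<open>X g\<^sup>\<alpha>\<close> has the moments of a Gamma variable of parameter \<open>c\<close>. As moments of size \<open>s!\<close> determine
  symmetric laws only after a square root has been taken, the laws of the symmetrized square roots are
  compared. The Gamma law has no atom at \<open>0\<close>, hence neither has \<open>X\<close>.
\<close>
lemma no_atom_at_0:
  assumes N: "real_distribution N" "AE x in N. 0 \<le> x" "\<And>s::nat. integrable N (\<lambda>x. x ^ s)"
    and \<alpha>: "0 < \<alpha>" and c: "0 < c"
    and mom: "\<And>s::nat. (\<integral>x. x ^ s \<partial>N) = Gamma (\<alpha> * c) / Gamma (\<alpha> * c + \<alpha> * real s) * (Gamma (real s + c) / Gamma c)"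
  shows "AE x in N. 0 < x"
proof -
  \<comment> \<open>With the point mass at \<open>1\<close> and exponent \<open>1\<close> the
    mixture is the symmetrized square root of the Gamma law of parameter \<open>c\<close>
    itself.\<close>
  let ?D = "return borel (1::real)"
  have D: "real_distribution ?D" unfolding real_distribution_def real_distribution_axioms_def
    by (auto intro: prob_space_return)
  have D2: "AE x in ?D. 0 \<le> x" by (simp add: AE_return)
  have D3: "integrable ?D (\<lambda>x. x ^ s)" "(\<integral>x. x ^ s \<partial>?D) = 1" for s :: nat
    by (auto simp: integral_return intro!: integrableI_bounded simp: nn_integral_return)
  have ac: "0 < \<alpha> * c" using \<alpha> c by simp
  note 1 = signed_mixture[OF N ac \<alpha>] and 2 = signed_mixture[OF D D2 D3(1) c zero_less_one]
  have m1: "(\<integral>x. x ^ (2 * s) \<partial>signed_mixture N (\<alpha> * c) \<alpha>) = Gamma (real s + c) / Gamma c" for s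
  proof -
    have "0 < Gamma (\<alpha> * c)" "0 < Gamma (\<alpha> * c + \<alpha> * real s)"
      using \<alpha> ac by (auto intro!: Gamma_real_pos add_pos_nonneg)
    then show ?thesis unfolding 1(4) mom by simp
  qed
  have m2: "(\<integral>x. x ^ (2 * s) \<partial>signed_mixture ?D c 1) = Gamma (real s + c) / Gamma c" for s
    unfolding 2(4) D3 by (simp add: add.commute)
  have eq: "signed_mixture N (\<alpha> * c) \<alpha> = signed_mixture ?D c 1"
  proof (rule real_distribution_eq_if_moments_eq[OF 1(1) 2(1) 1(2) 2(2)])
    show "(\<integral>x. x ^ k \<partial>signed_mixture N (\<alpha> * c) \<alpha>) = (\<integral>x. x ^ k \<partial>signed_mixture ?D c 1)" for k
    proof (cases "even k")
      case True
      then obtain s where "k = 2 * s" by (elim evenE)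
      then show ?thesis using m1 m2 by simp
    next
      case False
      then show ?thesis using 1(3) 2(3) by simp
    qed
    show "(\<lambda>n. t ^ (2 * n) * (\<integral>x. x ^ (2 * n) \<partial>signed_mixture N (\<alpha> * c) \<alpha>) / fact (2 * n)) \<longlonglongrightarrow> 0" for t
      unfolding m1 using moment_growth_even[OF c] by simp
  qed
  have "AE x in ?D. x \<noteq> 0" by (simp add: AE_return)
  then have "AE x in N. x \<noteq> 0" unfolding 2(5)[symmetric] eq[symmetric] unfolding 1(5) .
  with N(2) show ?thesis by eventually_elim auto
qed

section \<open>The Dirichlet law\<close>

text \<open>The substitution \<open>y = S * x\<close> reduces the integral to the Beta integral on
  \<open>[0, 1]\<close>.\<close>

lemma nn_integral_beta:
  fixes a b S :: real
  assumes a: "0 < a" and b: "0 < b" and S: "0 < S"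
  shows "(\<integral>\<^sup>+y. (if 0 < y \<and> y < S then ennreal (y powr (a - 1) * (S - y) powr (b - 1)) else 0) \<partial>lborel) =
    ennreal (S powr (a + b - 1) * (Gamma a * Gamma b / Gamma (a + b)))"
proof -
  let ?f = "\<lambda>y. if 0 < y \<and> y < S then ennreal (y powr (a - 1) * (S - y) powr (b - 1)) else 0"
  let ?h = "\<lambda>x. x powr (a - 1) * (1 - x) powr (b - 1)"
  have fm: "?f \<in> borel_measurable borel" by measurable
  have point: "?f (0 + S * x) = ennreal (S powr (a + b - 2)) * (ennreal (?h x) * indicator {0..1} x)" for x
  proof (cases "0 < x \<and> x < 1")
    case True
    have "S - S * x = S * (1 - x)" by (simp add: algebra_simps)
    then have "(S * x) powr (a - 1) * (S - S * x) powr (b - 1) = (S powr (a - 1) * S powr (b - 1)) * ?h x"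
      using True S by (simp add: powr_mult)
    also have "S powr (a - 1) * S powr (b - 1) = S powr (a + b - 2)" by (simp add: powr_add[symmetric] algebra_simps)
    finally show ?thesis using True S by (simp add: ennreal_mult')
  next
    case False
    then have "?h x = 0 \<or> x \<notin> {0..1}" by (cases "x = 0"; cases "x = 1") auto
    moreover have "?f (0 + S * x) = 0" using False S by (auto simp: zero_less_mult_iff)
    ultimately show ?thesis by (auto simp: indicator_def)
  qed
  have "(\<integral>\<^sup>+y. ?f y \<partial>lborel) = ennreal \<bar>S\<bar> * (\<integral>\<^sup>+x. ?f (0 + S * x) \<partial>lborel)"
    by (rule nn_integral_real_affine[OF fm]) (use S in simp)
  also have "(\<integral>\<^sup>+x. ?f (0 + S * x) \<partial>lborel) = ennreal (S powr (a + b - 2)) * (\<integral>\<^sup>+x. ennreal (?h x) * indicator {0..1} x \<partial>lborel)"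
    unfolding point by (rule nn_integral_cmult) measurable
  also have "(\<integral>\<^sup>+x. ennreal (?h x) * indicator {0..1} x \<partial>lborel) = ennreal (Beta a b)"
    by (rule nn_integral_has_integral_lebesgue'[OF _ has_integral_Beta_real[OF a b]]) auto
  also have "ennreal \<bar>S\<bar> * (ennreal (S powr (a + b - 2)) * ennreal (Beta a b)) = ennreal (S * S powr (a + b - 2) * Beta a b)"
    using S by (simp add: ennreal_mult' mult.assoc)
  also have "S * S powr (a + b - 2) = S powr (a + b - 1)"
    using S powr_add[of S 1 "a + b - 2"] by simp
  finally show ?thesis by (simp add: Beta_def)
qed

lemma beta_integrand_measurable:
  "(\<lambda>y. if 0 < y \<and> y < S then ennreal (y powr p * (S - y) powr q) else 0) \<in> borel_measurable lborel"
  for S p q :: real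
  by measurable

text \<open>Integrating out one coordinate is a Beta integral over the remaining length and turns
  the last parameter \<open>b\<close> into \<open>a j + b\<close>; therefore \<open>b\<close> is
  generalized in the induction.\<close>

lemma nn_integral_simplex:
  fixes a :: "'i \<Rightarrow> real" and S :: real
  assumes J: "finite J" and a: "\<And>i. i \<in> J \<Longrightarrow> 0 < a i" and S: "0 < S" and b: "0 < b"
  shows "(\<integral>\<^sup>+x. (if (\<forall>i\<in>J. 0 < x i) \<and> (\<Sum>i\<in>J. x i) < S
      then ennreal ((\<Prod>i\<in>J. x i powr (a i - 1)) * (S - (\<Sum>i\<in>J. x i)) powr (b - 1)) else 0) \<partial>PiM J (\<lambda>_. lborel)) =
    ennreal ((\<Prod>i\<in>J. Gamma (a i)) * Gamma b / Gamma ((\<Sum>i\<in>J. a i) + b) * S powr ((\<Sum>i\<in>J. a i) + b - 1))"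
  using J a b
proof (induction J arbitrary: b rule: finite_induct)
  case empty
  interpret product_sigma_finite "\<lambda>_::'i. lborel :: real measure" by standard
  show ?case using S Gamma_real_pos[OF empty.prems(2)] by (simp add: PiM_empty nn_integral_count_space_finite)
next
  case (insert j J)
  interpret product_sigma_finite "\<lambda>_::'i. lborel :: real measure" by standard
  let ?f = "\<lambda>J b x. (if (\<forall>i\<in>J. 0 < x i) \<and> (\<Sum>i\<in>J. x i) < S
      then ennreal ((\<Prod>i\<in>J. x i powr (a i - 1)) * (S - (\<Sum>i\<in>J. x i)) powr (b - 1)) else 0)"
  have [simp]: "finite J" "finite (insert j J)" by (simp_all add: insert.hyps)
  have comp [measurable]: "(\<lambda>x. x i) \<in> borel_measurable (PiM L (\<lambda>_. lborel :: real measure))" if "i \<in> L" for i :: 'i and L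
    using measurable_component_singleton[OF that, of "\<lambda>_. lborel :: real measure"] by simp
  have meas: "?f L b \<in> borel_measurable (PiM L (\<lambda>_. lborel))" if "finite L" for L :: "'i set" and b
    using that by measurable
  have aj: "0 < a j" and b: "0 < b" using insert.prems by auto
  have inner: "(\<integral>\<^sup>+y. ?f (insert j J) b (x(j := y)) \<partial>lborel) =
     ennreal (Gamma (a j) * Gamma b / Gamma (a j + b)) * ?f J (a j + b) x" for x
  proof -
    have upd: "(\<Sum>i\<in>J. (x(j := y)) i) = (\<Sum>i\<in>J. x i)" "(\<Prod>i\<in>J. (x(j := y)) i powr (a i - 1)) = (\<Prod>i\<in>J. x i powr (a i - 1))"
      "(\<forall>i\<in>J. 0 < (x(j := y)) i) \<longleftrightarrow> (\<forall>i\<in>J. 0 < x i)" for y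
      using insert.hyps by (auto intro!: sum.cong prod.cong)
    show ?thesis
    proof (cases "(\<forall>i\<in>J. 0 < x i) \<and> (\<Sum>i\<in>J. x i) < S")
      case True
      let ?P = "\<Prod>i\<in>J. x i powr (a i - 1)" and ?S = "S - (\<Sum>i\<in>J. x i)"
      have P: "0 \<le> ?P" by (intro prod_nonneg) auto
      have S': "0 < ?S" using True by simp
      have "?f (insert j J) b (x(j := y)) = ennreal ?P * (if 0 < y \<and> y < ?S then ennreal (y powr (a j - 1) * (?S - y) powr (b - 1)) else 0)" for y
      proof -
        have s: "(\<Sum>i\<in>insert j J. (x(j := y)) i) = y + (\<Sum>i\<in>J. x i)"
          by (subst sum.insert) (use insert.hyps upd in auto)
        have p: "(\<Prod>i\<in>insert j J. (x(j := y)) i powr (a i - 1)) = y powr (a j - 1) * ?P"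
          by (subst prod.insert) (use insert.hyps upd in auto)
        have c: "(\<forall>i\<in>insert j J. 0 < (x(j := y)) i) \<longleftrightarrow> 0 < y" using True upd(3)[of y] by simp
        have d: "S - (y + (\<Sum>i\<in>J. x i)) = ?S - y" by simp
        have e: "y + (\<Sum>i\<in>J. x i) < S \<longleftrightarrow> y < ?S" by auto
        have "?f (insert j J) b (x(j := y)) = (if 0 < y \<and> y < ?S then ennreal ((y powr (a j - 1) * ?P) * (?S - y) powr (b - 1)) else 0)"
          unfolding s p c d e ..
        also have "\<dots> = ennreal ?P * (if 0 < y \<and> y < ?S then ennreal (y powr (a j - 1) * (?S - y) powr (b - 1)) else 0)"
        proof (cases "0 < y \<and> y < ?S")
          case True
          have "(y powr (a j - 1) * ?P) * (?S - y) powr (b - 1) = ?P * (y powr (a j - 1) * (?S - y) powr (b - 1))"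
            by (simp only: mult_ac)
          then show ?thesis unfolding if_P[OF True] by (simp only: ennreal_mult'[OF P])
        qed (simp only: if_False mult_zero_right)
        finally show ?thesis .
      qed
      then have "(\<integral>\<^sup>+y. ?f (insert j J) b (x(j := y)) \<partial>lborel) =
         (\<integral>\<^sup>+y. ennreal ?P * (if 0 < y \<and> y < ?S then ennreal (y powr (a j - 1) * (?S - y) powr (b - 1)) else 0) \<partial>lborel)"
        by (simp only:)
      also have "\<dots> = ennreal ?P * ennreal (?S powr (a j + b - 1) * (Gamma (a j) * Gamma b / Gamma (a j + b)))"
        unfolding nn_integral_beta[OF aj b S', symmetric] by (rule nn_integral_cmult[OF beta_integrand_measurable])
      also have "\<dots> = ennreal (Gamma (a j) * Gamma b / Gamma (a j + b)) * ennreal (?P * ?S powr (a j + b - 1))"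
        using P Gamma_real_pos[OF aj] Gamma_real_pos[OF b] Gamma_real_pos[OF add_pos_pos[OF aj b]]
        by (simp add: ennreal_mult[symmetric] mult_ac)
      also have "\<dots> = ennreal (Gamma (a j) * Gamma b / Gamma (a j + b)) * ?f J (a j + b) x"
        using True by (simp add: algebra_simps)
      finally show ?thesis .
    next
      case False
      have "?f (insert j J) b (x(j := y)) = 0" for y
      proof -
        have "\<not> ((\<forall>i\<in>insert j J. 0 < (x(j := y)) i) \<and> (\<Sum>i\<in>insert j J. (x(j := y)) i) < S)"
        proof
          assume A: "(\<forall>i\<in>insert j J. 0 < (x(j := y)) i) \<and> (\<Sum>i\<in>insert j J. (x(j := y)) i) < S"
          then have "0 < y" "\<forall>i\<in>J. 0 < x i" using upd(3)[of y] by auto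
          moreover have "(\<Sum>i\<in>insert j J. (x(j := y)) i) = y + (\<Sum>i\<in>J. x i)"
            by (subst sum.insert) (use insert.hyps upd in auto)
          ultimately show False using A False by auto
        qed
        then show ?thesis by (simp only: if_False)
      qed
      then show ?thesis using False by (simp only: nn_integral_0_iff_AE) auto
    qed
  qed
  have "(\<integral>\<^sup>+x. ?f (insert j J) b x \<partial>PiM (insert j J) (\<lambda>_. lborel)) =
     (\<integral>\<^sup>+x. (\<integral>\<^sup>+y. ?f (insert j J) b (x(j := y)) \<partial>lborel) \<partial>PiM J (\<lambda>_. lborel))"
    by (rule product_nn_integral_insert[OF insert.hyps meas]) simp
  also have "\<dots> = ennreal (Gamma (a j) * Gamma b / Gamma (a j + b)) * (\<integral>\<^sup>+x. ?f J (a j + b) x \<partial>PiM J (\<lambda>_. lborel))"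
    unfolding inner by (rule nn_integral_cmult[OF meas]) simp
  also have "(\<integral>\<^sup>+x. ?f J (a j + b) x \<partial>PiM J (\<lambda>_. lborel)) =
     ennreal ((\<Prod>i\<in>J. Gamma (a i)) * Gamma (a j + b) / Gamma ((\<Sum>i\<in>J. a i) + (a j + b)) * S powr ((\<Sum>i\<in>J. a i) + (a j + b) - 1))"
    by (rule insert.IH) (use insert.prems in \<open>auto intro: add_pos_pos\<close>)
  also have "ennreal (Gamma (a j) * Gamma b / Gamma (a j + b)) * \<dots> =
     ennreal (Gamma (a j) * Gamma b / Gamma (a j + b) * ((\<Prod>i\<in>J. Gamma (a i)) * Gamma (a j + b) / Gamma ((\<Sum>i\<in>J. a i) + (a j + b)) * S powr ((\<Sum>i\<in>J. a i) + (a j + b) - 1)))"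
    using Gamma_real_pos[OF aj] Gamma_real_pos[OF b] Gamma_real_pos[OF add_pos_pos[OF aj b]]
    by (intro ennreal_mult'[symmetric]) simp
  also have "Gamma (a j) * Gamma b / Gamma (a j + b) * ((\<Prod>i\<in>J. Gamma (a i)) * Gamma (a j + b) / Gamma ((\<Sum>i\<in>J. a i) + (a j + b)) * S powr ((\<Sum>i\<in>J. a i) + (a j + b) - 1)) =
     (\<Prod>i\<in>insert j J. Gamma (a i)) * Gamma b / Gamma ((\<Sum>i\<in>insert j J. a i) + b) * S powr ((\<Sum>i\<in>insert j J. a i) + b - 1)"
  proof -
    have s: "(\<Sum>i\<in>insert j J. a i) + b = (\<Sum>i\<in>J. a i) + (a j + b)" using insert.hyps by simp
    have p: "(\<Prod>i\<in>insert j J. Gamma (a i)) = Gamma (a j) * (\<Prod>i\<in>J. Gamma (a i))" using insert.hyps by simp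
    have "x * y / z * (p * z / g * v) = x * p * y / g * v" if "z \<noteq> 0" for x y z p g v :: real using that by simp
    from this[of "Gamma (a j + b)"] show ?thesis
      unfolding s p using Gamma_real_pos[OF add_pos_pos[OF aj b]] by simp
  qed
  finally show ?case .
qed

abbreviation dirichlet_density :: "('k::finite \<Rightarrow> real) \<Rightarrow> 'k \<Rightarrow> ('k \<Rightarrow> real) \<Rightarrow> ennreal" where
  "dirichlet_density a j \<equiv>
      (\<lambda>x. if (\<forall>i\<in>{i. a i > 0} - {j}. 0 < x i) \<and> (\<Sum>i\<in>{i. a i > 0} - {j}. x i) < 1
         then ennreal (Gamma (\<Sum>i\<in>{i. a i > 0}. a i) / (\<Prod>i\<in>{i. a i > 0}. Gamma (a i)) *
                (\<Prod>i\<in>{i. a i > 0} - {j}. x i powr (a i - 1)) *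
                (1 - (\<Sum>i\<in>{i. a i > 0} - {j}. x i)) powr (a j - 1))
         else 0)"

text \<open>The extra powers only shift the parameters from \<open>a\<close> to
  \<open>a + r\<close>, so the integral is a quotient of two normalizing constants. The exponents
  are real, as \<open>W\<close> later occurs with powers \<open>lamH l * s l\<close>.\<close>

lemma dirichlet_mixed_integral:
  fixes a r :: "'k::finite \<Rightarrow> real"
  assumes j: "a j > 0" and r: "\<And>i. 0 \<le> r i"
  defines "I \<equiv> {i. a i > 0}" and "J \<equiv> {i. a i > 0} - {j}"
  shows "(\<integral>\<^sup>+x. dirichlet_density a j x * ennreal ((\<Prod>i\<in>J. x i powr r i) * (1 - (\<Sum>i\<in>J. x i)) powr r j)
      \<partial>PiM J (\<lambda>_. lborel)) =
    ennreal (Gamma (\<Sum>i\<in>I. a i) / Gamma (\<Sum>i\<in>I. a i + r i) * (\<Prod>i\<in>I. Gamma (a i + r i) / Gamma (a i)))"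
proof -
  let ?C = "Gamma (\<Sum>i\<in>I. a i) / (\<Prod>i\<in>I. Gamma (a i))"
  let ?f = "\<lambda>x. (if (\<forall>i\<in>J. 0 < x i) \<and> (\<Sum>i\<in>J. x i) < 1
      then ennreal ((\<Prod>i\<in>J. x i powr ((a i + r i) - 1)) * (1 - (\<Sum>i\<in>J. x i)) powr ((a j + r j) - 1)) else 0)"
  have IJ: "I = insert j J" "j \<notin> J" "finite J" unfolding I_def J_def using j by auto
  have aJ: "0 < a i + r i" if "i \<in> J" for i using that r[of i] by (simp add: J_def add_pos_nonneg)
  have aj: "0 < a j + r j" using j r[of j] by simp
  have sumI: "0 < (\<Sum>i\<in>I. a i)" using j unfolding I_def by (intro sum_pos) auto
  have C: "0 \<le> ?C"
    using sumI by (intro divide_nonneg_nonneg prod_nonneg less_imp_le[OF Gamma_real_pos]) (auto simp: I_def intro!: less_imp_le[OF Gamma_real_pos])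
  have comp [measurable]: "(\<lambda>x. x i) \<in> borel_measurable (PiM J (\<lambda>_. lborel :: real measure))" if "i \<in> J" for i :: 'k
    using measurable_component_singleton[OF that, of "\<lambda>_. lborel :: real measure"] by simp
  have fm: "?f \<in> borel_measurable (PiM J (\<lambda>_. lborel))" using IJ(3) by measurable
  have "dirichlet_density a j x * ennreal ((\<Prod>i\<in>J. x i powr r i) * (1 - (\<Sum>i\<in>J. x i)) powr r j) = ennreal ?C * ?f x" for x
  proof (cases "(\<forall>i\<in>J. 0 < x i) \<and> (\<Sum>i\<in>J. x i) < 1")
    case True
    have 1: "(\<Prod>i\<in>J. x i powr (a i - 1)) * (\<Prod>i\<in>J. x i powr r i) = (\<Prod>i\<in>J. x i powr ((a i + r i) - 1))"
      unfolding prod.distrib[symmetric] powr_add[symmetric] by (simp add: algebra_simps)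
    have 2: "(1 - (\<Sum>i\<in>J. x i)) powr (a j - 1) * (1 - (\<Sum>i\<in>J. x i)) powr r j = (1 - (\<Sum>i\<in>J. x i)) powr ((a j + r j) - 1)"
      unfolding powr_add[symmetric] by (simp add: algebra_simps)
    have "dirichlet_density a j x = ennreal (?C * (\<Prod>i\<in>J. x i powr (a i - 1)) * (1 - (\<Sum>i\<in>J. x i)) powr (a j - 1))"
      using True unfolding J_def[symmetric] unfolding I_def[symmetric] by simp
    then show ?thesis unfolding 1[symmetric] 2[symmetric] using True C
      by (simp add: ennreal_mult''[symmetric] ennreal_mult'[symmetric] prod_nonneg mult_ac)
  next
    case False
    then show ?thesis unfolding J_def[symmetric] unfolding I_def[symmetric]
      by (simp only: False if_False mult_zero_left mult_zero_right)
  qed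
  then have "(\<integral>\<^sup>+x. dirichlet_density a j x * ennreal ((\<Prod>i\<in>J. x i powr r i) * (1 - (\<Sum>i\<in>J. x i)) powr r j)
      \<partial>PiM J (\<lambda>_. lborel)) = (\<integral>\<^sup>+x. ennreal ?C * ?f x \<partial>PiM J (\<lambda>_. lborel))" by (simp only:)
  also have "\<dots> = ennreal ?C * (\<integral>\<^sup>+x. ?f x \<partial>PiM J (\<lambda>_. lborel))" by (rule nn_integral_cmult[OF fm])
  also have "(\<integral>\<^sup>+x. ?f x \<partial>PiM J (\<lambda>_. lborel)) =
     ennreal ((\<Prod>i\<in>J. Gamma (a i + r i)) * Gamma (a j + r j) / Gamma ((\<Sum>i\<in>J. a i + r i) + (a j + r j)) * 1 powr ((\<Sum>i\<in>J. a i + r i) + (a j + r j) - 1))"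
    by (rule nn_integral_simplex[OF IJ(3) aJ _ aj]) auto
  also have "\<dots> = ennreal ((\<Prod>i\<in>I. Gamma (a i + r i)) / Gamma (\<Sum>i\<in>I. a i + r i))"
    unfolding IJ(1) using IJ(2,3) by (simp add: mult_ac add_ac)
  also have "ennreal ?C * \<dots> = ennreal (?C * ((\<Prod>i\<in>I. Gamma (a i + r i)) / Gamma (\<Sum>i\<in>I. a i + r i)))"
    by (rule ennreal_mult'[OF C, symmetric])
  also have "?C * ((\<Prod>i\<in>I. Gamma (a i + r i)) / Gamma (\<Sum>i\<in>I. a i + r i)) =
     Gamma (\<Sum>i\<in>I. a i) / Gamma (\<Sum>i\<in>I. a i + r i) * (\<Prod>i\<in>I. Gamma (a i + r i) / Gamma (a i))"
    unfolding prod_dividef by simp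
  finally show ?thesis .
qed

text \<open>The density omits the eliminated coordinate \<open>j\<close>. It is recovered as
  \<open>1\<close> minus the others, because coordinates with parameter \<open>0\<close> vanish and
  the total is \<open>1\<close>.\<close>

lemma dirichlet_support_and_moments:
  fixes a :: "'k::finite \<Rightarrow> real"
  assumes prob: "prob_space \<Omega>" and dir: "dirichlet \<Omega> a W"
  shows "AE \<omega> in \<Omega>. (\<forall>i. (0 < a i \<longrightarrow> 0 < W \<omega> $ i) \<and> (a i = 0 \<longrightarrow> W \<omega> $ i = 0))" (is ?pos)
    and "(\<And>i. 0 \<le> r i) \<Longrightarrow> (\<integral>\<^sup>+\<omega>. ennreal (\<Prod>i | 0 < a i. W \<omega> $ i powr r i) \<partial>\<Omega>) =
      ennreal (Gamma (\<Sum>i | 0 < a i. a i) / Gamma (\<Sum>i | 0 < a i. a i + r i) * (\<Prod>i | 0 < a i. Gamma (a i + r i) / Gamma (a i)))"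
proof -
  obtain j where j: "a j > 0"
    and dis0: "distributed \<Omega> (PiM ({i. a i > 0} - {j}) (\<lambda>_. lborel)) (\<lambda>\<omega>. \<lambda>i\<in>{i. a i > 0} - {j}. W \<omega> $ i) (dirichlet_density a j)"
    using dir unfolding dirichlet_def Let_def by blast
  define J where "J = {i. a i > 0} - {j}"
  define X where "X = (\<lambda>\<omega>. \<lambda>i\<in>J. W \<omega> $ i)"
  define f where "f = dirichlet_density a j"
  have dis: "distributed \<Omega> (PiM J (\<lambda>_. lborel)) X f" using dis0 unfolding J_def X_def f_def .
  have zero: "AE \<omega> in \<Omega>. \<forall>i. a i = 0 \<longrightarrow> W \<omega> $ i = 0"
    unfolding AE_all_countable
  proof
    show "AE \<omega> in \<Omega>. a i = 0 \<longrightarrow> W \<omega> $ i = 0" for i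
      using dir unfolding dirichlet_def by (cases "a i = 0") auto
  qed
  have one: "AE \<omega> in \<Omega>. (\<Sum>i\<in>UNIV. W \<omega> $ i) = 1" using dir unfolding dirichlet_def by blast
  have nn: "0 \<le> a i" for i using dir unfolding dirichlet_def by blast
  have Wj: "AE \<omega> in \<Omega>. W \<omega> $ j = 1 - (\<Sum>i\<in>J. X \<omega> i)"
    using zero one
  proof eventually_elim
    case (elim \<omega>)
    have "(\<Sum>i\<in>UNIV. W \<omega> $ i) = (\<Sum>i\<in>insert j J. W \<omega> $ i)"
      using elim(1) nn by (intro sum.mono_neutral_right) (auto simp: J_def less_le)
    also have "\<dots> = W \<omega> $ j + (\<Sum>i\<in>J. W \<omega> $ i)" by (rule sum.insert) (auto simp: J_def)
    also have "(\<Sum>i\<in>J. W \<omega> $ i) = (\<Sum>i\<in>J. X \<omega> i)" by (simp add: X_def)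
    finally show ?case using elim(2) by simp
  qed
  have "AE x in density (PiM J (\<lambda>_. lborel)) f. (\<forall>i\<in>J. 0 < x i) \<and> (\<Sum>i\<in>J. x i) < 1"
    using dis unfolding distributed_def by (subst AE_density) (auto simp: f_def J_def[symmetric] split: if_splits)
  then have "AE x in distr \<Omega> (PiM J (\<lambda>_. lborel)) X. (\<forall>i\<in>J. 0 < x i) \<and> (\<Sum>i\<in>J. x i) < 1"
    unfolding distributed_distr_eq_density[OF dis] .
  then have posX: "AE \<omega> in \<Omega>. (\<forall>i\<in>J. 0 < X \<omega> i) \<and> (\<Sum>i\<in>J. X \<omega> i) < 1"
    by (rule AE_distrD[rotated]) (use dis in \<open>simp add: distributed_def\<close>)
  show ?pos using zero Wj posX
  proof eventually_elim
    case (elim \<omega>)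
    show ?case
    proof (intro allI conjI impI)
      fix i assume "0 < a i"
      then show "0 < W \<omega> $ i" using elim by (cases "i = j") (auto simp: J_def X_def)
    qed (use elim in auto)
  qed
  assume r: "\<And>i. 0 \<le> r i"
  have comp [measurable]: "(\<lambda>x. x i) \<in> borel_measurable (PiM J (\<lambda>_. lborel :: real measure))" if "i \<in> J" for i :: 'k
    using measurable_component_singleton[OF that, of "\<lambda>_. lborel :: real measure"] by simp
  let ?g = "\<lambda>x. ennreal ((\<Prod>i\<in>J. x i powr r i) * (1 - (\<Sum>i\<in>J. x i)) powr r j)"
  have gm: "?g \<in> borel_measurable (PiM J (\<lambda>_. lborel))" by measurable
  have "(\<integral>\<^sup>+\<omega>. ennreal (\<Prod>i | 0 < a i. W \<omega> $ i powr r i) \<partial>\<Omega>) = (\<integral>\<^sup>+\<omega>. ?g (X \<omega>) \<partial>\<Omega>)"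
  proof (rule nn_integral_cong_AE)
    show "AE \<omega> in \<Omega>. ennreal (\<Prod>i | 0 < a i. W \<omega> $ i powr r i) = ?g (X \<omega>)"
      using Wj
    proof eventually_elim
      case (elim \<omega>)
      have "{i. 0 < a i} = insert j J" using j by (auto simp: J_def)
      moreover have "(\<Prod>i\<in>insert j J. W \<omega> $ i powr r i) = W \<omega> $ j powr r j * (\<Prod>i\<in>J. W \<omega> $ i powr r i)"
        by (rule prod.insert) (auto simp: J_def)
      ultimately have "(\<Prod>i | 0 < a i. W \<omega> $ i powr r i) = W \<omega> $ j powr r j * (\<Prod>i\<in>J. W \<omega> $ i powr r i)"
        by (simp only:)
      also have "(\<Prod>i\<in>J. W \<omega> $ i powr r i) = (\<Prod>i\<in>J. X \<omega> i powr r i)" by (simp add: X_def)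
      finally show ?case unfolding elim by (simp add: mult.commute)
    qed
  qed
  also have "\<dots> = (\<integral>\<^sup>+x. f x * ?g x \<partial>PiM J (\<lambda>_. lborel))"
    by (rule distributed_nn_integral[OF dis gm, symmetric])
  also have "\<dots> = ennreal (Gamma (\<Sum>i | 0 < a i. a i) / Gamma (\<Sum>i | 0 < a i. a i + r i) * (\<Prod>i | 0 < a i. Gamma (a i + r i) / Gamma (a i)))"
    unfolding J_def f_def by (rule dirichlet_mixed_integral[where a=a and r=r]) (use j r in auto)
  finally show "(\<integral>\<^sup>+\<omega>. ennreal (\<Prod>i | 0 < a i. W \<omega> $ i powr r i) \<partial>\<Omega>) =
      ennreal (Gamma (\<Sum>i | 0 < a i. a i) / Gamma (\<Sum>i | 0 < a i. a i + r i) * (\<Prod>i | 0 < a i. Gamma (a i + r i) / Gamma (a i)))" .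
qed

lemma borel_measurable_vec_lambdaI:
  fixes f :: "'a \<Rightarrow> 'k::finite \<Rightarrow> real"
  assumes "\<And>i. (\<lambda>x. f x i) \<in> borel_measurable M"
  shows "(\<lambda>x. \<chi> i. f x i) \<in> borel_measurable M"
  by (subst borel_measurable_euclidean_space) (auto simp: Basis_vec_def inner_axis assms)

text \<open>The density has total mass \<open>1\<close> by the mixed integral with
  \<open>r = 0\<close>. Its image under the map that restores coordinate \<open>j\<close> and fills
  in zeros is the desired law.\<close>

lemma exists_dirichlet:
  fixes a :: "'k::finite \<Rightarrow> real"
  assumes a: "\<And>i. 0 \<le> a i" and j: "0 < a j"
  shows "\<exists>D :: (real ^ 'k) measure. prob_space D \<and> sets D = sets borel \<and> dirichlet D a (\<lambda>x. x)"
proof -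
  define J where "J = {i. a i > 0} - {j}"
  define N where "N = PiM J (\<lambda>_. lborel :: real measure)"
  define f where "f = dirichlet_density a j"
  define W :: "('k \<Rightarrow> real) \<Rightarrow> real ^ 'k" where
    "W x = (\<chi> i. if i = j then 1 - (\<Sum>i\<in>J. x i) else if i \<in> J then x i else 0)" for x
  define D where "D = distr (density N f) borel W"
  have comp [measurable]: "(\<lambda>x. x i) \<in> borel_measurable N" if "i \<in> J" for i
    using measurable_component_singleton[OF that, of "\<lambda>_. lborel :: real measure"] by (simp add: N_def)
  have fm [measurable]: "f \<in> borel_measurable N"
    unfolding f_def J_def[symmetric] by measurable
  have Wm: "W \<in> borel_measurable N"
    unfolding W_def[abs_def]
  proof (rule borel_measurable_vec_lambdaI)
    show "(\<lambda>x. if i = j then 1 - (\<Sum>i\<in>J. x i) else if i \<in> J then x i else 0) \<in> borel_measurable N" for i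
      by (cases "i = j"; cases "i \<in> J") auto
  qed
  have "(\<integral>\<^sup>+x. f x \<partial>N) = 1"
  proof -
    have "(\<integral>\<^sup>+x. f x \<partial>N) = (\<integral>\<^sup>+x. f x * ennreal ((\<Prod>i\<in>J. x i powr 0) * (1 - (\<Sum>i\<in>J. x i)) powr 0) \<partial>N)"
    proof (rule nn_integral_cong)
      fix x show "f x = f x * ennreal ((\<Prod>i\<in>J. x i powr 0) * (1 - (\<Sum>i\<in>J. x i)) powr 0)"
      proof (cases "(\<forall>i\<in>J. 0 < x i) \<and> (\<Sum>i\<in>J. x i) < 1")
        case True
        then have "(\<Prod>i\<in>J. x i powr 0) * (1 - (\<Sum>i\<in>J. x i)) powr 0 = 1" by (auto intro!: prod.neutral)
        then show ?thesis by (simp only: ennreal_1 mult_1_right)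
      next
        case False
        then have "f x = 0" unfolding f_def J_def[symmetric] by (simp only: if_False)
        then show ?thesis by simp
      qed
    qed
    also have "\<dots> = ennreal (Gamma (\<Sum>i | 0 < a i. a i) / Gamma (\<Sum>i | 0 < a i. a i + 0) * (\<Prod>i | 0 < a i. Gamma (a i + 0) / Gamma (a i)))"
      unfolding N_def f_def J_def by (rule dirichlet_mixed_integral[where a=a and r="\<lambda>_. 0"]) (use j in auto)
    also have "\<dots> = 1"
    proof -
      have "0 < (\<Sum>i | 0 < a i. a i)" using j by (intro sum_pos) auto
      then have "Gamma (\<Sum>i | 0 < a i. a i) \<noteq> 0" using Gamma_real_pos by fastforce
      moreover have "(\<Prod>i | 0 < a i. Gamma (a i + 0) / Gamma (a i)) = 1"
      proof (rule prod.neutral, safe)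
        fix i assume "0 < a i"
        from Gamma_real_pos[OF this] show "Gamma (a i + 0) / Gamma (a i) = 1" by simp
      qed
      ultimately show ?thesis by simp
    qed
    finally show ?thesis .
  qed
  then have prob0: "prob_space (density N f)" by (intro prob_spaceI) (simp add: emeasure_density cong: nn_integral_cong)
  have Wm' [measurable]: "W \<in> borel_measurable (density N f)" using Wm by simp
  have prob: "prob_space D" unfolding D_def by (rule prob_space.prob_space_distr[OF prob0 Wm'])
  have sets: "sets D = sets borel" by (simp add: D_def)
  have proj: "(\<lambda>\<omega>. \<lambda>i\<in>J. \<omega> $ i) \<in> measurable borel N" unfolding N_def
    by (rule measurable_restrict) auto
  have AE_W: "AE \<omega> in D. P \<omega>" if "Measurable.pred borel P" "\<And>x. x \<in> space N \<Longrightarrow> P (W x)" for P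
    unfolding D_def using that by (subst AE_distr_iff) (auto simp: pred_def intro!: AE_I2)
  have "distributed D N (\<lambda>\<omega>. \<lambda>i\<in>J. \<omega> $ i) f"
    unfolding distributed_def
  proof (intro conjI fm)
    show "(\<lambda>\<omega>. \<lambda>i\<in>J. \<omega> $ i) \<in> measurable D N" using proj measurable_cong_sets[OF sets refl] by blast
    have "distr D N (\<lambda>\<omega>. \<lambda>i\<in>J. \<omega> $ i) = distr (density N f) N ((\<lambda>\<omega>. \<lambda>i\<in>J. \<omega> $ i) \<circ> W)"
      unfolding D_def by (rule distr_distr[OF proj Wm'])
    also have "\<dots> = distr (density N f) N (\<lambda>x. x)"
    proof (rule distr_cong[OF refl refl])
      fix x assume "x \<in> space (density N f)"
      then have "x \<in> extensional J" by (auto simp: N_def space_PiM PiE_def)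
      moreover have "j \<notin> J" by (simp add: J_def)
      ultimately show "((\<lambda>\<omega>. \<lambda>i\<in>J. \<omega> $ i) \<circ> W) x = x"
        by (auto simp: W_def restrict_def extensional_def fun_eq_iff)
    qed
    also have "\<dots> = density N f" by (rule distr_id2) simp
    finally show "distr D N (\<lambda>\<omega>. \<lambda>i\<in>J. \<omega> $ i) = density N f" .
  qed
  then have dis: "distributed D (PiM ({i. a i > 0} - {j}) (\<lambda>_. lborel)) (\<lambda>\<omega>. \<lambda>i\<in>{i. a i > 0} - {j}. \<omega> $ i) (dirichlet_density a j)"
    unfolding N_def f_def J_def .
  have z: "AE \<omega> in D. \<omega> $ i = 0" if "a i = 0" for i
    by (rule AE_W) (use that j in \<open>auto simp: W_def J_def\<close>)
  have o: "AE \<omega> in D. (\<Sum>i\<in>UNIV. \<omega> $ i) = 1"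
  proof (rule AE_W)
    fix x
    have "(\<Sum>i\<in>UNIV. W x $ i) = (\<Sum>i\<in>insert j J. W x $ i)"
      by (rule sum.mono_neutral_right) (auto simp: W_def)
    also have "\<dots> = W x $ j + (\<Sum>i\<in>J. W x $ i)" by (rule sum.insert) (auto simp: J_def)
    also have "(\<Sum>i\<in>J. W x $ i) = (\<Sum>i\<in>J. x i)" by (rule sum.cong) (auto simp: W_def J_def)
    finally show "(\<Sum>i\<in>UNIV. W x $ i) = 1" by (simp add: W_def)
  qed measurable
  have m: "(\<lambda>x. x) \<in> borel_measurable D"
    by (rule measurable_ident_sets[OF sets])
  have "dirichlet D a (\<lambda>x. x)"
    unfolding dirichlet_def Let_def by (intro conjI allI impI exI[of _ j] m a z o j dis)
  then show ?thesis using prob sets by blast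
qed

section \<open>Asymptotics of the scheme\<close>

lemma coeff_hom_complex: "coeff_hom complex_of_real"
  by unfold_locales auto

lemma eval_fps_compose_disc:
  assumes g: "ereal \<tau> \<le> fps_conv_radius G" "0 < \<tau>" and h: "ereal \<rho> \<le> fps_conv_radius H" "0 < \<rho>"
    and H0: "fps_nth H 0 = 0" and le: "\<And>z. norm z < \<rho> \<Longrightarrow> norm (eval_fps H z) < \<tau>"
  shows "(eval_fps G \<circ> eval_fps H) has_fps_expansion fps_compose G (H :: complex fps)"
proof (rule has_fps_expansion_compose)
  have "0 < ereal \<tau>" "0 < ereal \<rho>" using g h by auto
  then have "0 < fps_conv_radius G" "0 < fps_conv_radius H"
    using less_le_trans[OF _ g(1), of 0] less_le_trans[OF _ h(1), of 0] by auto
  then show "eval_fps G has_fps_expansion G" "eval_fps H has_fps_expansion H"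
    by (auto intro: eval_fps_has_fps_expansion)
qed (rule H0)

definition weighted :: "nat \<Rightarrow> real fps \<Rightarrow> real fps" where
  "weighted s f = Abs_fps (\<lambda>i. real i ^ s * fps_nth f i)"

lemma weighted_Suc: "weighted (Suc s) f = fps_X * fps_deriv (weighted s f)"
proof (rule fps_ext)
  fix n show "fps_nth (weighted (Suc s) f) n = fps_nth (fps_X * fps_deriv (weighted s f)) n"
    by (cases n) (auto simp: weighted_def)
qed

text \<open>Each application of \<open>z d/dz\<close> multiplies the constant by minus the current
  exponent; these factors form the rising factorial of \<open>- lam\<close>.\<close>

lemma cone_sing_weighted:
  assumes "cone_sing f \<rho> 0 lam c"
  shows "cone_sing (weighted s f) \<rho> 0 (lam - real s) (pochhammer (- lam) s * c)"
proof (induction s)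
  case 0
  have "weighted 0 f = f" by (rule fps_ext) (simp add: weighted_def)
  then show ?case using assms by simp
next
  case (Suc s)
  have 1: "- (lam - real s) * (pochhammer (- lam) s * c) = pochhammer (- lam) (Suc s) * c"
    by (simp add: pochhammer_Suc algebra_simps)
  have 2: "lam - real s - 1 = lam - real (Suc s)" by simp
  show ?case using cone_sing_theta[OF Suc] unfolding weighted_Suc 1 2 .
qed

text \<open>\<open>G\<close> is not fixed here, as the asymptotics are used for \<open>G\<close> and
  for its weighted versions. The condition on \<open>M\<close> covers the singular and the analytic
  case at once.\<close>

locale critical_scheme =
  fixes M :: "real fps" and H :: "'m::finite \<Rightarrow> real fps"
    and \<rho> lamM cM :: real and \<tau> lamH cH :: "'m \<Rightarrow> real"
  assumes H0: "\<And>l. fps_nth (H l) 0 = 0"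
    and inner: "\<And>l. inner_series (H l) \<rho> (\<tau> l) (lamH l) (cH l)"
    and M: "disc_sing (eval_fps (map_coeffs complex_of_real M)) \<rho> lamM (of_real cM)"
      "0 < fps_conv_radius M" and lamM: "lamM \<le> 0"
begin

lemma scheme_total_asymp:
  fixes G :: "'m \<Rightarrow> real fps"
  assumes G: "\<And>l. cone_sing (G l) (\<tau> l) 0 (lamG l) (cG l)" and lamG: "\<And>l. lamG l < 0"
  defines "L \<equiv> (\<Sum>l\<in>UNIV. lamG l * lamH l) + lamM"
  shows "(\<lambda>n. scheme_total M G H n * (\<rho> ^ n / real n powr (- L - 1)))
    \<longlonglongrightarrow> cM * (\<Prod>l\<in>UNIV. cG l * (- cH l / \<tau> l) powr lamG l) / Gamma (- L)"
proof -
  interpret inner: inner_series "H l" \<rho> "\<tau> l" "lamH l" "cH l" for l by (rule inner)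
  interpret hom: coeff_hom complex_of_real by (rule coeff_hom_complex)
  have \<rho>: "0 < \<rho>" by (rule inner.\<rho>_pos)
  define GH where "GH l = eval_fps (map_coeffs complex_of_real (G l)) \<circ> inner.H l" for l
  define F where "F z = eval_fps (map_coeffs complex_of_real M) z * (\<Prod>l\<in>UNIV. GH l z)" for z
  define C where "C = complex_of_real cM * (\<Prod>l\<in>UNIV. of_real (cG l * (- cH l / \<tau> l) powr lamG l))"
  have "disc_sing (\<lambda>z. \<Prod>l\<in>UNIV. GH l z) \<rho> (\<Sum>l\<in>UNIV. lamG l * lamH l)
      (\<Prod>l\<in>UNIV. of_real (cG l * (- cH l / \<tau> l) powr lamG l))"
    unfolding GH_def by (intro disc_sing_prod \<rho> inner.disc_sing_compose G) auto
  then have "disc_sing F \<rho> (lamM + (\<Sum>l\<in>UNIV. lamG l * lamH l)) C"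
    unfolding F_def C_def by (rule disc_sing_mult[OF M(1)])
  then have dF: "disc_sing F \<rho> L C" unfolding L_def by (simp add: add.commute)
  \<comment> \<open>The contribution of the \<open>G l\<close> is strictly negative, so the transfer
    applies even if \<open>lamM = 0\<close>.\<close>
  have L: "L < 0"
  proof -
    have "(\<Sum>l\<in>UNIV. lamG l * lamH l) < 0"
      using sum_strict_mono[of UNIV "\<lambda>l. lamG l * lamH l" "\<lambda>_. 0"] lamG inner.lam(1) by (simp add: mult_neg_pos)
    then show ?thesis using lamM by (simp add: L_def)
  qed
  have exp_GH: "GH l has_fps_expansion map_coeffs complex_of_real (fps_compose (G l) (H l))" for l
  proof -
    have "GH l has_fps_expansion fps_compose (map_coeffs complex_of_real (G l)) (map_coeffs complex_of_real (H l))"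
      unfolding GH_def inner.H_def
    proof (rule eval_fps_compose_disc)
      show "ereal (\<tau> l) \<le> fps_conv_radius (map_coeffs complex_of_real (G l))"
        using G[of l] by (simp add: cone_sing_def)
      show "ereal \<rho> \<le> fps_conv_radius (map_coeffs complex_of_real (H l))" using inner.conv_radius by simp
      show "norm (eval_fps (map_coeffs complex_of_real (H l)) z) < \<tau> l" if "norm z < \<rho>" for z
        using inner.norm_H_less[OF that] unfolding inner.H_def .
    qed (use inner.\<tau>_pos \<rho> H0 in auto)
    moreover have "fps_compose (map_coeffs complex_of_real (G l)) (map_coeffs complex_of_real (H l)) =
       map_coeffs complex_of_real (fps_compose (G l) (H l))"
    proof (rule fps_ext)
      fix n
      show "fps_nth (fps_compose (map_coeffs complex_of_real (G l)) (map_coeffs complex_of_real (H l))) n =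
         fps_nth (map_coeffs complex_of_real (fps_compose (G l) (H l))) n"
        unfolding hom.map_coeffs_power[symmetric] fps_compose_nth map_coeffs_nth by simp
    qed
    ultimately show ?thesis by simp
  qed
  have "F has_fps_expansion map_coeffs complex_of_real M * (\<Prod>l\<in>UNIV. map_coeffs complex_of_real (fps_compose (G l) (H l)))"
    unfolding F_def[abs_def]
    by (intro has_fps_expansion_mult has_fps_expansion_prod exp_GH eval_fps_has_fps_expansion) (use M in simp)
  then have "F has_fps_expansion map_coeffs complex_of_real (M * (\<Prod>l\<in>UNIV. fps_compose (G l) (H l)))"
    by (simp only: hom.map_coeffs_mult hom.map_coeffs_prod)
  then have coeff: "(deriv ^^ n) F 0 / fact n = of_real (scheme_total M G H n)" for n
  proof -
    assume "F has_fps_expansion map_coeffs complex_of_real (M * (\<Prod>l\<in>UNIV. fps_compose (G l) (H l)))"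
    from fps_nth_fps_expansion[OF this, of n]
    have "(deriv ^^ n) F 0 / fact n = of_real (fps_nth (M * (\<Prod>l\<in>UNIV. fps_compose (G l) (H l))) n)" by simp
    moreover have "map_coeffs (\<lambda>c. c) f = f" for f :: "real fps" by (rule fps_ext) simp
    ultimately show ?thesis unfolding scheme_total_def composition_scheme_def by simp
  qed
  have "(\<lambda>n. complex_of_real (scheme_total M G H n * (\<rho> ^ n / real n powr (- L - 1)))) \<longlonglongrightarrow>
      of_real (cM * (\<Prod>l\<in>UNIV. cG l * (- cH l / \<tau> l) powr lamG l) / Gamma (- L))"
    using singularity_transfer[OF dF L] unfolding coeff C_def by simp
  from tendsto_Re[OF this] show ?thesis by (simp only: Re_complex_of_real)
qed

end

text \<open>The form that arises as a quotient of two transfers, with exponents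
  \<open>lamG l\<close> and \<open>lamG l - s l\<close>.\<close>

lemma limit_moment_altdef:
  assumes "\<And>l. lamG l < 0"
  shows "limit_moment lamG lamH lamM s =
     Gamma (- ((\<Sum>l\<in>UNIV. lamG l * lamH l) + lamM)) /
     Gamma (- ((\<Sum>l\<in>UNIV. (lamG l - real (s l)) * lamH l) + lamM)) *
     (\<Prod>l\<in>UNIV. pochhammer (- lamG l) (s l))"
proof -
  have "- lamG l \<notin> \<int>\<^sub>\<le>\<^sub>0" for l using nonpos_Ints_nonpos[of "- lamG l"] assms[of l] by auto
  then have "Gamma (real (s l) - lamG l) / Gamma (- lamG l) = pochhammer (- lamG l) (s l)" for l
    using pochhammer_Gamma[of "- lamG l" "s l"] by (simp add: add.commute)
  moreover have "(\<Sum>l\<in>UNIV. real (s l) * lamH l) - (\<Sum>l\<in>UNIV. lamG l * lamH l) - lamM =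
     - ((\<Sum>l\<in>UNIV. (lamG l - real (s l)) * lamH l) + lamM)"
    by (simp add: left_diff_distrib sum_subtractf)
  moreover have "- (\<Sum>l\<in>UNIV. lamG l * lamH l) - lamM = - ((\<Sum>l\<in>UNIV. lamG l * lamH l) + lamM)" by simp
  ultimately show ?thesis unfolding limit_moment_def by (simp only:)
qed

locale pure_scheme = critical_scheme M H \<rho> lamM cM \<tau> lamH cH
  for M and H :: "'m::finite \<Rightarrow> real fps" and \<rho> lamM cM \<tau> lamH cH +
  fixes G :: "'m \<Rightarrow> real fps" and lamG cG \<kappa> :: "'m \<Rightarrow> real"
  assumes G: "\<And>l. cone_sing (G l) (\<tau> l) 0 (lamG l) (cG l)" and lamG: "\<And>l. lamG l < 0"
    and cG: "\<And>l. cG l \<noteq> 0" and cM: "cM \<noteq> 0" and \<kappa>: "\<And>l. \<kappa> l = \<tau> l / (- cH l)"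
begin

sublocale inner: inner_series "H l" \<rho> "\<tau> l" "lamH l" "cH l" for l by (rule inner)

lemma exponent_neg: "(\<Sum>l\<in>UNIV. (lamG l - real (s l)) * lamH l) + lamM < 0"
proof -
  have "(lamG l - real (s l)) * lamH l < 0" for l using lamG[of l] inner.lam(1)[of l] by (intro mult_neg_pos) auto
  then have "(\<Sum>l\<in>UNIV. (lamG l - real (s l)) * lamH l) < 0"
    using sum_strict_mono[of UNIV "\<lambda>l. (lamG l - real (s l)) * lamH l" "\<lambda>_. 0"] by simp
  then show ?thesis using lamM by simp
qed

lemma \<kappa>_pos: "0 < \<kappa> l"
  unfolding \<kappa> using inner.\<tau>_pos[of l] inner.c_neg[of l] by (intro divide_pos_pos) auto

lemma limit_moment_pos: "0 < limit_moment lamG lamH lamM s"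
  unfolding limit_moment_altdef[OF lamG] using exponent_neg[of s] exponent_neg[of "\<lambda>_. 0"] lamG
  by (intro mult_pos_pos divide_pos_pos Gamma_real_pos prod_pos pochhammer_pos) auto

text \<open>The constant in the asymptotics is nonzero, as neither \<open>cM\<close>, the
  \<open>cG l\<close> nor the powers of \<open>- cH l / \<tau> l\<close> vanish. This matters
  because the law of \<open>X n\<close> is prescribed only where the total is nonzero.\<close>

lemma scheme_total_nonzero: "\<forall>\<^sub>F n in sequentially. scheme_total M G H n \<noteq> 0"
proof -
  let ?L = "(\<Sum>l\<in>UNIV. lamG l * lamH l) + lamM"
  let ?C = "cM * (\<Prod>l\<in>UNIV. cG l * (- cH l / \<tau> l) powr lamG l) / Gamma (- ?L)"
  have g: "0 < Gamma (- ?L)" using exponent_neg[of "\<lambda>_. 0"] by (intro Gamma_real_pos) simp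
  have "- cH l / \<tau> l \<noteq> 0" for l using inner.\<tau>_pos[of l] inner.c_neg[of l] by simp
  then have "cG l * (- cH l / \<tau> l) powr lamG l \<noteq> 0" for l
    using cG[of l] by simp
  then have P: "(\<Prod>l\<in>UNIV. cG l * (- cH l / \<tau> l) powr lamG l) \<noteq> 0"
    unfolding prod_zero_iff[OF finite] by blast
  have "?C \<noteq> 0" using cM P less_imp_neq[OF g, THEN not_sym] by (simp only: divide_eq_0_iff mult_eq_0_iff simp_thms)
  then have "\<forall>\<^sub>F n in sequentially. scheme_total M G H n * (\<rho> ^ n / real n powr (- ?L - 1)) \<noteq> 0"
    by (rule tendsto_imp_eventually_ne[OF scheme_total_asymp[OF G lamG]])
  then show ?thesis by eventually_elim auto
qed

text \<open>In the quotient of the asymptotics for weighted and original \<open>G\<close> the powers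
  of \<open>\<rho>\<close> and the constants \<open>cM\<close>, \<open>cG l\<close> cancel. The
  lowered exponents leave the powers of \<open>n\<close>, and \<open>- cH l / \<tau> l\<close> to
  the power \<open>- s l\<close> is \<open>\<kappa> l ^ s l\<close>.\<close>

lemma moment_ratio_tendsto:
  "(\<lambda>n. scheme_total M (\<lambda>l. weighted (s l) (G l)) H n / scheme_total M G H n /
      (\<Prod>l\<in>UNIV. real n powr (real (s l) * lamH l) * \<kappa> l ^ s l))
    \<longlonglongrightarrow> limit_moment lamG lamH lamM s"
proof -
  let ?L = "(\<Sum>l\<in>UNIV. lamG l * lamH l) + lamM"
  let ?Ls = "(\<Sum>l\<in>UNIV. (lamG l - real (s l)) * lamH l) + lamM"
  let ?k = "\<lambda>l. - cH l / \<tau> l"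
  let ?C = "cM * (\<Prod>l\<in>UNIV. cG l * ?k l powr lamG l) / Gamma (- ?L)"
  let ?Cs = "cM * (\<Prod>l\<in>UNIV. pochhammer (- lamG l) (s l) * cG l * ?k l powr (lamG l - real (s l))) / Gamma (- ?Ls)"
  have g: "0 < Gamma (- ?L)" "0 < Gamma (- ?Ls)"
    using exponent_neg[of "\<lambda>_. 0"] exponent_neg[of s] by (auto intro!: Gamma_real_pos)
  have k: "0 < ?k l" for l using inner.\<tau>_pos[of l] inner.c_neg[of l] by (intro divide_pos_pos) auto
  have "cG l * ?k l powr lamG l \<noteq> 0" for l
    using cG[of l] k[of l] powr_gt_zero[of "?k l" "lamG l"] by (metis less_irrefl mult_eq_0_iff)
  then have P: "(\<Prod>l\<in>UNIV. cG l * ?k l powr lamG l) \<noteq> 0"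
    unfolding prod_zero_iff[OF finite] by blast
  have C: "?C \<noteq> 0" using cM P less_imp_neq[OF g(1), THEN not_sym] by (simp only: divide_eq_0_iff mult_eq_0_iff simp_thms)
  have 1: "(\<lambda>n. scheme_total M (\<lambda>l. weighted (s l) (G l)) H n * (\<rho> ^ n / real n powr (- ?Ls - 1))) \<longlonglongrightarrow> ?Cs"
  proof (rule scheme_total_asymp[where G="\<lambda>l. weighted (s l) (G l)" and lamG="\<lambda>l. lamG l - real (s l)"
      and cG="\<lambda>l. pochhammer (- lamG l) (s l) * cG l"])
    show "lamG l - real (s l) < 0" for l using lamG[of l] by simp
  qed (rule cone_sing_weighted[OF G])
  have 2: "(\<lambda>n. scheme_total M G H n * (\<rho> ^ n / real n powr (- ?L - 1))) \<longlonglongrightarrow> ?C"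
    by (rule scheme_total_asymp[OF G lamG])
  have "\<kappa> l ^ s l \<noteq> 0" for l using \<kappa>_pos[of l] by simp
  then have K: "(\<Prod>l\<in>UNIV. \<kappa> l ^ s l) \<noteq> 0" unfolding prod_zero_iff[OF finite] by blast
  have "(\<lambda>n. scheme_total M (\<lambda>l. weighted (s l) (G l)) H n * (\<rho> ^ n / real n powr (- ?Ls - 1)) /
      (scheme_total M G H n * (\<rho> ^ n / real n powr (- ?L - 1))) / (\<Prod>l\<in>UNIV. \<kappa> l ^ s l)) \<longlonglongrightarrow> ?Cs / ?C / (\<Prod>l\<in>UNIV. \<kappa> l ^ s l)"
    by (intro tendsto_divide[OF tendsto_divide[OF 1 2 C] tendsto_const] K)
  moreover have "?Cs / ?C / (\<Prod>l\<in>UNIV. \<kappa> l ^ s l) = limit_moment lamG lamH lamM s"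
  proof -
    have p: "pochhammer (- lamG l) (s l) * cG l * ?k l powr (lamG l - real (s l)) =
       pochhammer (- lamG l) (s l) * (cG l * ?k l powr lamG l) * \<kappa> l ^ s l" for l
    proof -
      have "q powr (a - real n) = q powr a * (1 / q) ^ n" if "0 < q" for q a :: real and n
        using that by (simp only: powr_diff powr_realpow power_one_over times_divide_eq_right mult_1_right)
      from this[OF k[of l]] have "?k l powr (lamG l - real (s l)) = ?k l powr lamG l * (1 / ?k l) ^ s l" .
      moreover have "1 / ?k l = \<kappa> l" unfolding \<kappa> by (simp only: divide_divide_eq_right mult_1)
      ultimately show ?thesis by (simp only: mult.assoc)
    qed
    have gen: "cm * (x * y * z) / u / (cm * y / v) / z = v / u * x"
      if "cm \<noteq> 0" "y \<noteq> 0" "z \<noteq> 0" for cm x y z u v :: real using that by simp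
    show ?thesis unfolding limit_moment_altdef[OF lamG] p prod.distrib
      by (rule gen[OF cM P[unfolded prod.distrib] K])
  qed
  moreover have "\<forall>\<^sub>F n in sequentially. scheme_total M (\<lambda>l. weighted (s l) (G l)) H n * (\<rho> ^ n / real n powr (- ?Ls - 1)) /
      (scheme_total M G H n * (\<rho> ^ n / real n powr (- ?L - 1))) / (\<Prod>l\<in>UNIV. \<kappa> l ^ s l) =
     scheme_total M (\<lambda>l. weighted (s l) (G l)) H n / scheme_total M G H n /
      (\<Prod>l\<in>UNIV. real n powr (real (s l) * lamH l) * \<kappa> l ^ s l)"
    using eventually_gt_at_top[of 0]
  proof eventually_elim
    case (elim n)
    have "real n powr (- ?Ls - 1) = real n powr (- ?L - 1) * (\<Prod>l\<in>UNIV. real n powr (real (s l) * lamH l))"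
    proof -
      have "(\<Prod>l\<in>UNIV. real n powr (real (s l) * lamH l)) = real n powr (\<Sum>l\<in>UNIV. real (s l) * lamH l)"
        using elim by (simp add: powr_sum)
      moreover have "- ?Ls - 1 = (- ?L - 1) + (\<Sum>l\<in>UNIV. real (s l) * lamH l)"
        by (simp add: left_diff_distrib sum_subtractf)
      ultimately show ?thesis by (simp only: powr_add)
    qed
    moreover have "x * (r / (p * q)) / (y * (r / p)) / z = x / y / (q * z)" if "r \<noteq> 0" "p \<noteq> 0" for x r p q y z :: real
      using that by simp
    from this[of "\<rho> ^ n" "real n powr (- ?L - 1)"] have "x * (\<rho> ^ n / (real n powr (- ?L - 1) * q)) / (y * (\<rho> ^ n / real n powr (- ?L - 1))) / z = x / y / (q * z)" for x q y z
      using inner.\<rho>_pos elim by simp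
    ultimately show ?case unfolding prod.distrib by (simp only:)
  qed
  ultimately show ?thesis by (simp only: Lim_transform_eventually)
qed

end

text \<open>Serves the auxiliary scheme behind the Mittag-Leffler law, for which no random vector is
  given in advance.\<close>

lemma exists_scheme_pmf:
  fixes H :: "'m::finite \<Rightarrow> real fps"
  assumes nonneg: "\<And>n. 0 \<le> fps_nth M n" "\<And>l n. 0 \<le> fps_nth (G l) n" "\<And>l n. 0 \<le> fps_nth (H l) n"
    and H0: "\<And>l. fps_nth (H l) 0 = 0" and nz: "scheme_total M G H n \<noteq> 0"
  shows "\<exists>p. \<forall>k. pmf p k = scheme_coeff M G H n k / scheme_total M G H n"
proof -
  let ?f = "\<lambda>k. scheme_coeff M G H n k / scheme_total M G H n"
  let ?A = "PiE (UNIV :: 'm set) (\<lambda>_. {..n})"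
  have fin: "finite ?A" by (intro finite_PiE) auto
  have mc: "0 \<le> multi_coeff M G H n k" for k by (rule multi_coeff_nonneg[OF nonneg])
  have T: "0 \<le> scheme_total M G H n" unfolding scheme_total_eq[OF H0] by (intro sum_nonneg mc)
  have f0: "0 \<le> ?f k" for k unfolding scheme_coeff_eq[OF H0] using mc T by simp
  have zero: "?f k = 0" if k: "k \<notin> ?A" for k
  proof -
    obtain l where "n < k l" using k by (auto simp: PiE_UNIV_domain Pi_iff not_le)
    then show ?thesis using multi_coeff_eq_0[of H n k l] H0 by (simp add: scheme_coeff_eq[OF H0])
  qed
  have "(\<integral>\<^sup>+k. ennreal (?f k) \<partial>count_space UNIV) = (\<Sum>k\<in>?A. ennreal (?f k))"
    by (rule nn_integral_count_space'[OF fin]) (use zero f0 in auto)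
  also have "\<dots> = ennreal (\<Sum>k\<in>?A. ?f k)" using f0 by (intro sum_ennreal) auto
  also have "(\<Sum>k\<in>?A. ?f k) = 1"
    using nz unfolding scheme_coeff_eq[OF H0] sum_divide_distrib[symmetric] scheme_total_eq[OF H0, symmetric] by simp
  finally have "(\<integral>\<^sup>+k. ennreal (?f k) \<partial>count_space UNIV) = 1" by simp
  from pmf_embed_pmf[of ?f, OF f0 this] show ?thesis by blast
qed

section \<open>The limit law\<close>

text \<open>With a single nonzero exponent the product factors of the other coordinates are
  \<open>1\<close>, and \<open>moment_growth\<close> applies with \<open>c\<close> the sum of the
  Dirichlet parameters.\<close>

lemma limit_moment_growth:
  fixes lamG lamH :: "'m::finite \<Rightarrow> real"
  assumes lamG: "\<And>l. lamG l < 0" and lamH: "\<And>l. 0 < lamH l \<and> lamH l < 1" and lamM: "lamM \<le> 0"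
  shows "(\<lambda>j. r ^ j * limit_moment lamG lamH lamM (\<lambda>i. if i = l then j else 0) / fact j) \<longlonglongrightarrow> 0"
proof -
  let ?c = "- (\<Sum>l\<in>UNIV. lamG l * lamH l) - lamM"
  have "(\<Sum>l\<in>UNIV. lamG l * lamH l) < 0"
    using sum_strict_mono[of UNIV "\<lambda>l. lamG l * lamH l" "\<lambda>_. 0"] lamG lamH by (simp add: mult_neg_pos)
  then have c: "0 < ?c" using lamM by simp
  have "limit_moment lamG lamH lamM (\<lambda>i. if i = l then j else 0) =
      (Gamma ?c / Gamma (- lamG l)) / Gamma (lamH l * real j + ?c) * Gamma (real j + (- lamG l))" for j
  proof -
    have s: "(\<Sum>i\<in>UNIV. real (if i = l then j else 0) * lamH i) = lamH l * real j"
    proof -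
      have "(\<Sum>i\<in>UNIV. real (if i = l then j else 0) * lamH i) = (\<Sum>i\<in>UNIV. if i = l then lamH l * real j else 0)"
        by (rule sum.cong) auto
      then show ?thesis by simp
    qed
    have G: "Gamma (- lamG i) \<noteq> 0" for i 
      by (rule less_imp_neq[THEN not_sym], rule Gamma_real_pos) (use lamG[of i] in simp)
    have p: "(\<Prod>i\<in>UNIV. Gamma (real (if i = l then j else 0) - lamG i) / Gamma (- lamG i)) =
       Gamma (real j + (- lamG l)) / Gamma (- lamG l)"
    proof -
      have "(\<Prod>i\<in>UNIV. Gamma (real (if i = l then j else 0) - lamG i) / Gamma (- lamG i)) =
        (\<Prod>i\<in>UNIV. if i = l then Gamma (real j + (- lamG l)) / Gamma (- lamG l) else 1)"
        by (rule prod.cong) (use G in auto)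
      then show ?thesis by simp
    qed
    have a: "(\<Sum>i\<in>UNIV. real (if i = l then j else 0) * lamH i) - (\<Sum>l\<in>UNIV. lamG l * lamH l) - lamM = lamH l * real j + ?c"
      unfolding s by simp
    have "x / y * (z / w) = x / w / y * z" for x y z w :: real by simp
    then show ?thesis unfolding limit_moment_def p a .
  qed
  then show ?thesis
    using moment_growth[of "lamH l" ?c "- lamG l" r "Gamma ?c / Gamma (- lamG l)"] lamG[of l] lamH[of l] c by simp
qed

text \<open>With \<open>\<beta> = \<alpha> * c\<close> the quotient
  \<open>\<beta> / \<alpha>\<close> is \<open>c\<close>, and the functional equation removes all
  shifts by \<open>1\<close>. The right-hand side is the form that cancels against Dirichlet
  moments.\<close>

lemma mittag_leffler_moment:
  assumes \<alpha>: "0 < \<alpha>" and c: "0 < c"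
  shows "Gamma (real s + \<alpha> * c / \<alpha> + 1) * Gamma (\<alpha> * c + 1) / (Gamma (\<alpha> * real s + \<alpha> * c + 1) * Gamma (\<alpha> * c / \<alpha> + 1)) =
    Gamma (\<alpha> * c) / Gamma (\<alpha> * c + \<alpha> * real s) * (Gamma (real s + c) / Gamma c)"
proof -
  have e: "\<alpha> * c / \<alpha> = c" using \<alpha> by simp
  have g1: "Gamma (real s + c + 1) = (real s + c) * Gamma (real s + c)" using c by (intro Gamma_real_plus1) simp
  have g2: "Gamma (\<alpha> * c + 1) = \<alpha> * c * Gamma (\<alpha> * c)" using \<alpha> c by (intro Gamma_real_plus1) simp
  have "\<alpha> * real s + \<alpha> * c = \<alpha> * (real s + c)" by (simp add: algebra_simps)
  moreover have "0 < \<alpha> * (real s + c)" using \<alpha> c by (intro mult_pos_pos) auto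
  ultimately have g3: "Gamma (\<alpha> * real s + \<alpha> * c + 1) = \<alpha> * (real s + c) * Gamma (\<alpha> * c + \<alpha> * real s)"
    using Gamma_real_plus1[of "\<alpha> * real s + \<alpha> * c"] by (simp add: add.commute)
  have g4: "Gamma (c + 1) = c * Gamma c" by (rule Gamma_real_plus1[OF c])
  have gen: "k * w * (\<alpha> * c * x) / (\<alpha> * k * y * (c * z)) = x / y * (w / z)" if "k \<noteq> 0" for k w x y z :: real
    using that \<alpha> c by simp
  show ?thesis unfolding e g1 g2 g3 g4 by (rule gen) (use c in simp)
qed

text \<open>The pair \<open>h\<close>, \<open>g\<close> can be taken from any coordinate of the
  given scheme, whose own data thus supply an auxiliary scheme with exactly the required
  exponents.\<close>

lemma exists_mittag_leffler:
  fixes h g :: "real fps"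
  assumes inner: "inner_series h \<rho> \<tau> lam c" and h0: "fps_nth h 0 = 0"
    and g: "cone_sing g \<tau> 0 lg cg" "lg < 0" "cg \<noteq> 0" and g_nonneg: "\<And>n. 0 \<le> fps_nth g n"
  shows "\<exists>N. mittag_leffler lam (- lg * lam) N"
proof -
  interpret h: inner_series h \<rho> \<tau> lam c by (rule inner)
  define \<kappa> where "\<kappa> = \<tau> / (- c)"
  have M1: "disc_sing (eval_fps (map_coeffs complex_of_real 1)) \<rho> 0 (of_real 1)"
  proof -
    have "map_coeffs complex_of_real 1 = 1" by (rule coeff_hom.map_coeffs_one[OF coeff_hom_complex])
    then show ?thesis using disc_sing_1[OF h.\<rho>_pos] by (simp add: eval_fps_1[abs_def])
  qed
  interpret S: pure_scheme 1 "\<lambda>_::unit. h" \<rho> 0 1 "\<lambda>_. \<tau>" "\<lambda>_. lam" "\<lambda>_. c" "\<lambda>_. g" "\<lambda>_. lg" "\<lambda>_. cg" "\<lambda>_. \<kappa>"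
    by unfold_locales (use h0 inner M1 g \<kappa>_def in auto)
  let ?T = "scheme_total 1 (\<lambda>_::unit. g) (\<lambda>_. h)"
  let ?C = "scheme_coeff 1 (\<lambda>_::unit. g) (\<lambda>_. h)"
  \<comment> \<open>The auxiliary laws start at index \<open>N0\<close>, from which on the totals
    are nonzero and the normalization is positive.\<close>
  obtain N0 where N0: "\<And>n. n \<ge> N0 \<Longrightarrow> ?T n \<noteq> 0 \<and> 0 < n"
    using eventually_conj[OF S.scheme_total_nonzero eventually_gt_at_top[of 0]] unfolding eventually_sequentially by auto
  have "\<exists>p. \<forall>k. pmf p k = ?C (n + N0) k / ?T (n + N0)" for n
    using N0[of "n + N0"] h0 h.nonneg g_nonneg by (intro exists_scheme_pmf) (auto simp: fps_one_nth)
  then obtain p where p: "\<And>n k. pmf (p n) k = ?C (n + N0) k / ?T (n + N0)" by metis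
  let ?v = "\<lambda>n. \<kappa> * real (n + N0) powr lam"
  define Y where "Y n = distr (measure_pmf (p n)) borel (\<lambda>k. real (k ()) / ?v n)" for n
  have q: "0 < real (n + N0)" for n using N0[OF le_add2[of N0 n]] unfolding of_nat_0_less_iff by blast
  have \<kappa>: "0 < \<kappa>" using S.\<kappa>_pos .
  have v: "0 < ?v n" for n using \<kappa> N0[of "n + N0"] by (intro mult_pos_pos) auto
  have fin: "finite (set_pmf (p n))" for n
    by (rule finite_subset[OF expectation_scheme(2)[OF _ _ p]]) (use h0 N0[of "n + N0"] in \<open>auto intro: finite_PiE\<close>)
  have intp: "integrable (measure_pmf (p n)) f" for n and f :: "(unit \<Rightarrow> nat) \<Rightarrow> real"
    by (rule integrable_measure_pmf_finite[OF fin])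
  define m where "m s = limit_moment (\<lambda>_::unit. lg) (\<lambda>_. lam) 0 (\<lambda>_. s)" for s
  have "\<exists>N. real_distribution N \<and> (AE x in N. 0 \<le> x) \<and>
    (\<forall>s. integrable N (\<lambda>x. x ^ s) \<and> (\<integral>x. x ^ s \<partial>N) = m s)"
  proof (rule exists_limit_distribution)
    show "real_distribution (Y n)" for n
      unfolding Y_def by (rule prob_space.real_distribution_distr) (auto intro: measure_pmf.prob_space_axioms)
    show "AE x in Y n. 0 \<le> x" for n
      unfolding Y_def using less_imp_le[OF v[of n]] by (subst AE_distr_iff) auto
    show "integrable (Y n) (\<lambda>x. x ^ s)" for n s
      unfolding Y_def by (subst integrable_distr_eq) (auto intro: intp)
    have "(\<integral>x. x ^ s \<partial>Y n) = scheme_total 1 (\<lambda>_::unit. weighted s g) (\<lambda>_. h) (n + N0) / ?T (n + N0) /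
       (\<Prod>l\<in>(UNIV::unit set). real (n + N0) powr (real s * lam) * \<kappa> ^ s)" for n s
    proof -
      have "(\<integral>x. x ^ s \<partial>Y n) = measure_pmf.expectation (p n) (\<lambda>k. (real (k ()) / ?v n) ^ s)"
        unfolding Y_def by (subst integral_distr) auto
      also have "\<dots> = measure_pmf.expectation (p n) (\<lambda>k. (\<Prod>l\<in>(UNIV::unit set). real (k l) ^ s) / ?v n ^ s)"
        by (simp add: power_divide UNIV_unit)
      also have "\<dots> = measure_pmf.expectation (p n) (\<lambda>k. \<Prod>l\<in>(UNIV::unit set). real (k l) ^ s) / ?v n ^ s"
        by simp
      also have "measure_pmf.expectation (p n) (\<lambda>k. \<Prod>l\<in>(UNIV::unit set). real (k l) ^ s) =
         scheme_total 1 (\<lambda>_::unit. weighted s g) (\<lambda>_. h) (n + N0) / ?T (n + N0)"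
        using expectation_scheme(1)[OF _ _ p, of n "\<lambda>_. s"] h0 N0[of "n + N0"] unfolding weighted_def by simp
      also have "?v n ^ s = (\<Prod>l\<in>(UNIV::unit set). real (n + N0) powr (real s * lam) * \<kappa> ^ s)"
      proof -
        have "(x powr lam) ^ s = x powr (real s * lam)" if "0 < x" for x :: real
          using that by (simp add: powr_power mult.commute)
        from this[OF q] have "(real (n + N0) powr lam) ^ s = real (n + N0) powr (real s * lam)" .
        then show ?thesis by (simp only: power_mult_distrib UNIV_unit prod.insert prod.empty finite.emptyI empty_iff simp_thms mult_1_right mult.commute)
      qed
      finally show ?thesis .
    qed
    then show "(\<lambda>n. \<integral>x. x ^ s \<partial>Y n) \<longlonglongrightarrow> m s" for s
      using LIMSEQ_ignore_initial_segment[OF S.moment_ratio_tendsto[of "\<lambda>_. s"], of N0] unfolding m_def by simp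
  qed
  then obtain N where N: "real_distribution N" "AE x in N. 0 \<le> x" "\<And>s. integrable N (\<lambda>x. x ^ s)"
    and mom: "\<And>s. (\<integral>x. x ^ s \<partial>N) = m s" by blast
  interpret N: real_distribution N by (rule N)
  \<comment> \<open>With one coordinate and \<open>lamM = 0\<close> the limit moments take the form
    of \<open>mittag_leffler_moment\<close> with \<open>c = - lg\<close>.\<close>
  have m: "m s = Gamma (lam * - lg) / Gamma (lam * - lg + lam * real s) * (Gamma (real s + - lg) / Gamma (- lg))" for s
    unfolding m_def limit_moment_def by (simp add: UNIV_unit algebra_simps)
  have pos: "AE x in N. 0 < x"
    by (rule no_atom_at_0[OF N h.lam(1), of "- lg"]) (use g(2) mom m in auto)
  have "- lg * lam = lam * - lg" by simp
  then have "mittag_leffler lam (- lg * lam) N"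
    unfolding mittag_leffler_def
    using pos N(3) N.prob_space_axioms mom m mittag_leffler_moment[OF h.lam(1), of "- lg"] g(2)
    by (auto simp: mult_ac)
  then show ?thesis by blast
qed

lemma has_moments_limit_law:
  fixes V :: "'w \<Rightarrow> real ^ 'm::finite"
  assumes lamG: "\<And>l. lamG l < 0" and lamH: "\<And>l. 0 < lamH l" and lamM: "lamM \<le> 0"
    and lim: "limit_variables lamG lamH lamM \<Omega> V W"
  shows "has_moments (limit_law lamH \<Omega> V W) (limit_moment lamG lamH lamM)"
    and "AE x in limit_law lamH \<Omega> V W. 0 \<le> x $ l"
proof -
  let ?a = "\<lambda>i. case i of None \<Rightarrow> - lamM | Some l \<Rightarrow> - lamG l * lamH l"
  have prob: "prob_space \<Omega>" and dir: "dirichlet \<Omega> ?a W" and V: "V \<in> borel_measurable \<Omega>"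
    and mitlef: "\<And>l. mittag_leffler (lamH l) (- lamG l * lamH l) (distr \<Omega> borel (\<lambda>\<omega>. V \<omega> $ l))"
    and indV: "prob_space.indep_vars \<Omega> (\<lambda>_. borel) (\<lambda>l \<omega>. V \<omega> $ l) UNIV"
    and indVW: "prob_space.indep_set \<Omega> (sets (vimage_algebra (space \<Omega>) V borel)) (sets (vimage_algebra (space \<Omega>) W borel))"
    using lim unfolding limit_variables_def by blast+
  interpret prob_space \<Omega> by (rule prob)
  have W: "W \<in> borel_measurable \<Omega>" using dir unfolding dirichlet_def by blast
  have Vl [measurable]: "(\<lambda>\<omega>. V \<omega> $ l) \<in> borel_measurable \<Omega>" for l by (rule measurable_compose[OF V]) measurable
  have Wl [measurable]: "(\<lambda>\<omega>. W \<omega> $ i) \<in> borel_measurable \<Omega>" for i by (rule measurable_compose[OF W]) measurable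
  define T where "T \<omega> = (\<chi> l. V \<omega> $ l * (W \<omega> $ Some l) powr lamH l)" for \<omega>
  have Tm: "T \<in> borel_measurable \<Omega>" unfolding T_def by (rule borel_measurable_vec_lambdaI) measurable
  have law: "limit_law lamH \<Omega> V W = distr \<Omega> borel T" unfolding limit_law_def T_def ..
  have a_pos: "0 < ?a (Some l)" for l using lamG[of l] lamH[of l] by (simp add: mult_neg_pos)
  have W_pos: "AE \<omega> in \<Omega>. \<forall>i. 0 < ?a i \<longrightarrow> 0 < W \<omega> $ i"
    using dirichlet_support_and_moments(1)[OF prob dir] by eventually_elim blast
  have V_pos: "AE \<omega> in \<Omega>. 0 < V \<omega> $ l" for l
    using mitlef[of l] unfolding mittag_leffler_def by (subst (asm) AE_distr_iff) auto
  have "AE \<omega> in \<Omega>. 0 \<le> T \<omega> $ l" using V_pos[of l] by eventually_elim (simp add: T_def)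
  then show "AE x in limit_law lamH \<Omega> V W. 0 \<le> x $ l"
    unfolding law by (subst AE_distr_iff[OF Tm]) auto
  have moment: "integrable \<Omega> (\<lambda>\<omega>. monomial s (T \<omega>)) \<and> (\<integral>\<omega>. monomial s (T \<omega>) \<partial>\<Omega>) = limit_moment lamG lamH lamM s" for s
  proof -
    define r where "r i = (case i of None \<Rightarrow> 0 | Some l \<Rightarrow> lamH l * real (s l))" for i
    have r: "0 \<le> r i" for i unfolding r_def using less_imp_le[OF lamH] by (auto split: option.split)
    define f where "f x = (\<Prod>l\<in>UNIV. (x $ l) ^ s l)" for x :: "real ^ 'm"
    define w where "w x = (\<Prod>i | 0 < ?a i. x $ i powr r i)" for x :: "real ^ 'm option"
    have fm: "f \<in> borel_measurable borel" unfolding f_def[abs_def] by measurable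
    have wm: "w \<in> borel_measurable borel" unfolding w_def[abs_def] by measurable
    \<comment> \<open>The last index has parameter \<open>- lamM\<close> and belongs to the support
      only if \<open>lamM < 0\<close>. Since \<open>r None = 0\<close>, both cases lead to the same
      sums and products over the other indices.\<close>
    have I: "{i. 0 < ?a i} = (if lamM < 0 then insert None (range Some) else range Some)"
      using a_pos lamM by (auto simp: image_iff split: option.splits)
    have prodI: "(\<Prod>i | 0 < ?a i. F i) = (\<Prod>l\<in>UNIV. F (Some l))" if "lamM < 0 \<Longrightarrow> F None = 1" for F :: "'m option \<Rightarrow> real"
      unfolding I using that by (simp add: prod.reindex)
    have sumI: "(\<Sum>i | 0 < ?a i. F i) = (\<Sum>l\<in>UNIV. F (Some l)) + F None" if "lamM = 0 \<Longrightarrow> F None = 0" for F :: "'m option \<Rightarrow> real"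
      unfolding I using that lamM by (auto simp: sum.reindex)
    \<comment> \<open>As \<open>0 powr 0 = 0\<close>, powers are evaluated where the coordinates of
      \<open>W\<close> with positive parameter are positive, that is almost everywhere.\<close>
    have split: "AE \<omega> in \<Omega>. monomial s (T \<omega>) = f (V \<omega>) * w (W \<omega>)"
      using W_pos
    proof eventually_elim
      case (elim \<omega>)
      have "w (W \<omega>) = (\<Prod>l\<in>UNIV. W \<omega> $ Some l powr r (Some l))"
        unfolding w_def by (rule prodI) (use elim[rule_format, of None] in \<open>simp add: r_def\<close>)
      also have "\<dots> = (\<Prod>l\<in>UNIV. (W \<omega> $ Some l powr lamH l) ^ s l)"
      proof (rule prod.cong[OF refl])
        fix l
        have "0 < W \<omega> $ Some l" using elim a_pos[of l] by blast
        then show "W \<omega> $ Some l powr r (Some l) = (W \<omega> $ Some l powr lamH l) ^ s l"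
          by (simp add: r_def powr_power mult.commute)
      qed
      finally show ?case by (simp add: monomial_def T_def f_def power_mult_distrib prod.distrib)
    qed
    have Vpow: "integrable \<Omega> (\<lambda>\<omega>. (V \<omega> $ l) ^ s l)"
      "(\<integral>\<omega>. (V \<omega> $ l) ^ s l \<partial>\<Omega>) = Gamma (?a (Some l)) / Gamma (?a (Some l) + r (Some l)) * (Gamma (real (s l) - lamG l) / Gamma (- lamG l))" for l
    proof -
      have 1: "integrable (distr \<Omega> borel (\<lambda>\<omega>. V \<omega> $ l)) (\<lambda>x. x ^ s l)"
        and 2: "(\<integral>x. x ^ s l \<partial>distr \<Omega> borel (\<lambda>\<omega>. V \<omega> $ l)) =
           Gamma (real (s l) + lamH l * - lamG l / lamH l + 1) * Gamma (lamH l * - lamG l + 1) /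
           (Gamma (lamH l * real (s l) + lamH l * - lamG l + 1) * Gamma (lamH l * - lamG l / lamH l + 1))"
        using mitlef[of l] unfolding mittag_leffler_def by (auto simp: mult.commute)
      show "integrable \<Omega> (\<lambda>\<omega>. (V \<omega> $ l) ^ s l)" using 1 by (subst (asm) integrable_distr_eq) auto
      have "(\<integral>\<omega>. (V \<omega> $ l) ^ s l \<partial>\<Omega>) = (\<integral>x. x ^ s l \<partial>distr \<Omega> borel (\<lambda>\<omega>. V \<omega> $ l))"
        by (subst integral_distr) auto
      also have "\<dots> = Gamma (lamH l * - lamG l) / Gamma (lamH l * - lamG l + lamH l * real (s l)) * (Gamma (real (s l) + - lamG l) / Gamma (- lamG l))"
        unfolding 2 by (rule mittag_leffler_moment) (use lamG[of l] lamH[of l] in auto)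
      finally show "(\<integral>\<omega>. (V \<omega> $ l) ^ s l \<partial>\<Omega>) = Gamma (?a (Some l)) / Gamma (?a (Some l) + r (Some l)) * (Gamma (real (s l) - lamG l) / Gamma (- lamG l))"
        by (simp add: r_def mult.commute)
    qed
    have ind_pow: "indep_vars (\<lambda>_. borel) (\<lambda>l \<omega>. (V \<omega> $ l) ^ s l) UNIV"
      by (rule indep_vars_compose2[OF indV]) auto
    have fV: "integrable \<Omega> (\<lambda>\<omega>. f (V \<omega>))" "(\<integral>\<omega>. f (V \<omega>) \<partial>\<Omega>) = (\<Prod>l\<in>UNIV. \<integral>\<omega>. (V \<omega> $ l) ^ s l \<partial>\<Omega>)"
      unfolding f_def using indep_vars_integrable[OF _ ind_pow Vpow(1)] indep_vars_lebesgue_integral[OF _ ind_pow Vpow(1)] by auto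
    let ?D = "Gamma (\<Sum>i | 0 < ?a i. ?a i) / Gamma (\<Sum>i | 0 < ?a i. ?a i + r i) * (\<Prod>i | 0 < ?a i. Gamma (?a i + r i) / Gamma (?a i))"
    have D: "?D = Gamma (- (\<Sum>l\<in>UNIV. lamG l * lamH l) - lamM) /
       Gamma ((\<Sum>l\<in>UNIV. real (s l) * lamH l) - (\<Sum>l\<in>UNIV. lamG l * lamH l) - lamM) *
       (\<Prod>l\<in>UNIV. Gamma (?a (Some l) + r (Some l)) / Gamma (?a (Some l)))"
    proof -
      have "(\<Sum>i | 0 < ?a i. ?a i) = (\<Sum>l\<in>UNIV. ?a (Some l)) + ?a None" by (rule sumI) simp
      then have 1: "(\<Sum>i | 0 < ?a i. ?a i) = - (\<Sum>l\<in>UNIV. lamG l * lamH l) - lamM" by (simp add: sum_negf)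
      have "(\<Sum>i | 0 < ?a i. ?a i + r i) = (\<Sum>l\<in>UNIV. ?a (Some l) + r (Some l)) + (?a None + r None)"
        by (rule sumI) (simp add: r_def)
      then have 2: "(\<Sum>i | 0 < ?a i. ?a i + r i) = (\<Sum>l\<in>UNIV. real (s l) * lamH l) - (\<Sum>l\<in>UNIV. lamG l * lamH l) - lamM"
        by (simp add: r_def sum_subtractf mult.commute[of "lamH _" "real _"])
      have 3: "(\<Prod>i | 0 < ?a i. Gamma (?a i + r i) / Gamma (?a i)) = (\<Prod>l\<in>UNIV. Gamma (?a (Some l) + r (Some l)) / Gamma (?a (Some l)))"
        by (rule prodI) (use less_imp_neq[OF Gamma_real_pos[of "- lamM"]] in \<open>simp add: r_def\<close>)
      show ?thesis unfolding 1 2 3 ..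
    qed
    have wW: "integrable \<Omega> (\<lambda>\<omega>. w (W \<omega>))" "(\<integral>\<omega>. w (W \<omega>) \<partial>\<Omega>) = ?D"
    proof -
      have apos: "0 < (\<Sum>i | 0 < ?a i. ?a i)" "0 < (\<Sum>i | 0 < ?a i. ?a i + r i)"
      proof -
        have "{i. 0 < ?a i} \<noteq> {}" using a_pos by blast
        then show "0 < (\<Sum>i | 0 < ?a i. ?a i)" "0 < (\<Sum>i | 0 < ?a i. ?a i + r i)"
          by (intro sum_pos add_pos_nonneg r; simp)+
      qed
      have nn: "0 \<le> ?D"
        using r apos by (intro mult_nonneg_nonneg divide_nonneg_nonneg prod_nonneg less_imp_le[OF Gamma_real_pos])
          (auto intro!: divide_nonneg_nonneg less_imp_le[OF Gamma_real_pos] add_pos_nonneg)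
      have "has_bochner_integral \<Omega> (\<lambda>\<omega>. w (W \<omega>)) ?D"
      proof (rule has_bochner_integral_nn_integral)
        show "(\<lambda>\<omega>. w (W \<omega>)) \<in> borel_measurable \<Omega>" by (rule measurable_compose[OF W wm])
        show "AE \<omega> in \<Omega>. 0 \<le> w (W \<omega>)" by (auto simp: w_def intro!: AE_I2 prod_nonneg)
        show "(\<integral>\<^sup>+\<omega>. ennreal (w (W \<omega>)) \<partial>\<Omega>) = ennreal ?D"
          unfolding w_def by (rule dirichlet_support_and_moments(2)[OF prob dir r])
      qed (rule nn)
      then show "integrable \<Omega> (\<lambda>\<omega>. w (W \<omega>))" "(\<integral>\<omega>. w (W \<omega>) \<partial>\<Omega>) = ?D" by (auto simp: has_bochner_integral_iff)
    qed
    have ind: "indep_var borel (\<lambda>\<omega>. f (V \<omega>)) borel (\<lambda>\<omega>. w (W \<omega>))"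
      unfolding indep_var_eq
    proof (intro conjI)
      show "(\<lambda>\<omega>. f (V \<omega>)) \<in> borel_measurable \<Omega>" by (rule measurable_compose[OF V fm])
      show "(\<lambda>\<omega>. w (W \<omega>)) \<in> borel_measurable \<Omega>" by (rule measurable_compose[OF W wm])
      \<comment> \<open>Functions of \<open>V\<close> and of \<open>W\<close> generate smaller
        sigma-algebras, so they inherit independence.\<close>
      have sub: "sigma_sets (space \<Omega>) {(\<lambda>\<omega>. q (X \<omega>)) -` A \<inter> space \<Omega> |A. A \<in> sets borel} \<subseteq> sets (vimage_algebra (space \<Omega>) X borel)"
        if q: "q \<in> borel_measurable borel" for q :: "real ^ 'k::finite \<Rightarrow> real" and X
      proof -
        have "{(\<lambda>\<omega>. q (X \<omega>)) -` A \<inter> space \<Omega> |A. A \<in> sets borel} \<subseteq> sets (vimage_algebra (space \<Omega>) X borel)"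
        proof safe
          fix A :: "real set" assume "A \<in> sets borel"
          then have "q -` A \<in> sets borel" using measurable_sets[OF q] by (simp add: space_borel)
          from in_vimage_algebra[OF this, of X "space \<Omega>"]
          show "(\<lambda>\<omega>. q (X \<omega>)) -` A \<inter> space \<Omega> \<in> sets (vimage_algebra (space \<Omega>) X borel)" by (simp add: vimage_comp o_def)
        qed
        from sets.sigma_sets_subset[OF this] show ?thesis by simp
      qed
      show "indep_set (sigma_sets (space \<Omega>) {(\<lambda>\<omega>. f (V \<omega>)) -` A \<inter> space \<Omega> |A. A \<in> sets borel})
         (sigma_sets (space \<Omega>) {(\<lambda>\<omega>. w (W \<omega>)) -` A \<inter> space \<Omega> |A. A \<in> sets borel})"
        using indVW sub[OF fm, of V] sub[OF wm, of W] unfolding indep_sets2_eq by blast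
    qed
    have prod_int: "integrable \<Omega> (\<lambda>\<omega>. f (V \<omega>) * w (W \<omega>))"
      by (rule indep_var_integrable[OF ind fV(1) wW(1)])
    have Ms: "(\<lambda>\<omega>. monomial s (T \<omega>)) \<in> borel_measurable \<Omega>" by (rule measurable_compose[OF Tm monomial_measurable])
    have "integrable \<Omega> (\<lambda>\<omega>. monomial s (T \<omega>))"
      using integrable_cong_AE[OF Ms borel_measurable_integrable[OF prod_int] split] prod_int by blast
    moreover have "(\<integral>\<omega>. monomial s (T \<omega>) \<partial>\<Omega>) = limit_moment lamG lamH lamM s"
    proof -
      have "(\<integral>\<omega>. monomial s (T \<omega>) \<partial>\<Omega>) = (\<integral>\<omega>. f (V \<omega>) * w (W \<omega>) \<partial>\<Omega>)"
        by (rule integral_cong_AE[OF Ms borel_measurable_integrable[OF prod_int] split])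
      also have "\<dots> = (\<Prod>l\<in>UNIV. \<integral>\<omega>. (V \<omega> $ l) ^ s l \<partial>\<Omega>) * ?D"
        unfolding indep_var_lebesgue_integral[OF ind fV(1) wW(1)] fV(2) wW(2) ..
      also have "\<dots> = limit_moment lamG lamH lamM s"
      proof -
        let ?A = "Gamma (- (\<Sum>l\<in>UNIV. lamG l * lamH l) - lamM) /
          Gamma ((\<Sum>l\<in>UNIV. real (s l) * lamH l) - (\<Sum>l\<in>UNIV. lamG l * lamH l) - lamM)"
        have "(\<Prod>l\<in>UNIV. Gamma (?a (Some l)) / Gamma (?a (Some l) + r (Some l)) * (Gamma (real (s l) - lamG l) / Gamma (- lamG l))) *
            (\<Prod>l\<in>UNIV. Gamma (?a (Some l) + r (Some l)) / Gamma (?a (Some l))) =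
            (\<Prod>l\<in>UNIV. Gamma (real (s l) - lamG l) / Gamma (- lamG l))"
          unfolding prod.distrib[symmetric]
        proof (rule prod.cong[OF refl])
          fix l
          have "0 < Gamma (?a (Some l))" by (rule Gamma_real_pos[OF a_pos])
          moreover have "0 < Gamma (?a (Some l) + r (Some l))" by (rule Gamma_real_pos[OF add_pos_nonneg[OF a_pos r]])
          moreover have "x / y * z * (y / x) = z" if "0 < x" "0 < y" for x y z :: real using that by simp
          ultimately show "Gamma (?a (Some l)) / Gamma (?a (Some l) + r (Some l)) * (Gamma (real (s l) - lamG l) / Gamma (- lamG l)) *
             (Gamma (?a (Some l) + r (Some l)) / Gamma (?a (Some l))) = Gamma (real (s l) - lamG l) / Gamma (- lamG l)" by blast
        qed
        then show ?thesis unfolding Vpow(2) D limit_moment_def by (simp only: mult.left_commute[of _ ?A])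
      qed
      finally show ?thesis .
    qed
    ultimately show ?thesis by blast
  qed
  have "prob_space (distr \<Omega> borel T)" by (rule prob_space_distr[OF Tm])
  then show "has_moments (limit_law lamH \<Omega> V W) (limit_moment lamG lamH lamM)"
    unfolding has_moments_def law monomial_def[symmetric]
    using moment by (simp add: integrable_distr_eq[OF Tm monomial_measurable] integral_distr[OF Tm monomial_measurable])
qed

text \<open>\<open>dirichlet\<close> depends on \<open>W\<close> only through its law: almost sure
  statements and densities pull back along \<open>W\<close>.\<close>

lemma dirichlet_comp:
  assumes W: "W \<in> borel_measurable \<Omega>" and D: "distr \<Omega> borel W = D" and dir: "dirichlet D a (\<lambda>x. x)"
  shows "dirichlet \<Omega> a W"
proof -
  have AE: "AE \<omega> in \<Omega>. P (W \<omega>)" if "AE x in D. P x" for P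
    by (rule AE_distrD[OF W]) (use that in \<open>simp only: D\<close>)
  have dist: "distributed \<Omega> N (\<lambda>\<omega>. X (W \<omega>)) f" if "distributed D N X f" for N f and X :: "_ \<Rightarrow> 'x"
  proof -
    have X: "X \<in> measurable borel N" using that unfolding distributed_def D[symmetric] by simp
    have "distr \<Omega> N (\<lambda>\<omega>. X (W \<omega>)) = distr D N X"
      unfolding D[symmetric] distr_distr[OF X W] by (simp add: o_def)
    then show ?thesis using that measurable_compose[OF W X] unfolding distributed_def by simp
  qed
  show ?thesis
    using W dir AE dist unfolding dirichlet_def Let_def by blast
qed

text \<open>The product of the laws of \<open>V\<close> and \<open>W\<close> with the two
  projections realizes the independence of the pair; the law of \<open>V\<close> is itself the image
  of a product of Mittag-Leffler laws.\<close>

lemma exists_limit_variables: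
  fixes lamG lamH :: "'m::finite \<Rightarrow> real"
  assumes lamG: "\<And>l. lamG l < 0" and lamH: "\<And>l. 0 < lamH l" and lamM: "lamM \<le> 0"
    and ex: "\<And>l. \<exists>N. mittag_leffler (lamH l) (- lamG l * lamH l) N"
  shows "\<exists>(\<Omega> :: ((real ^ 'm) \<times> (real ^ ('m option))) measure) V W. limit_variables lamG lamH lamM \<Omega> V W"
proof -
  let ?a = "\<lambda>i. case i of None \<Rightarrow> - lamM | Some l \<Rightarrow> - lamG l * lamH l"
  obtain N where N: "\<And>l. mittag_leffler (lamH l) (- lamG l * lamH l) (N l)" using ex by metis
  have pN: "prob_space (N l)" and sN: "sets (N l) = sets borel" for l
    using N[of l] unfolding mittag_leffler_def by auto
  have "0 < ?a (Some undefined)" using lamG[of undefined] lamH[of undefined] by (simp add: mult_neg_pos)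
  moreover have "0 \<le> ?a i" for i
    using lamM mult_nonpos_nonneg[OF less_imp_le[OF lamG] less_imp_le[OF lamH]] by (auto split: option.split)
  ultimately obtain D :: "(real ^ 'm option) measure" where D: "prob_space D" "sets D = sets borel" "dirichlet D ?a (\<lambda>x. x)"
    using exists_dirichlet[of ?a "Some undefined"] by blast
  define NP where "NP = PiM UNIV N"
  have pNP: "prob_space NP" unfolding NP_def by (rule prob_space_PiM[OF pN])
  define v :: "('m \<Rightarrow> real) \<Rightarrow> real ^ 'm" where "v f = (\<chi> l. f l)" for f
  have comp: "(\<lambda>f. f l) \<in> measurable NP (N l)" for l unfolding NP_def by measurable
  have compb: "(\<lambda>f. f l) \<in> borel_measurable NP" for l
    using comp[of l] by (simp only: measurable_cong_sets[OF refl sN])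
  have v: "v \<in> borel_measurable NP" unfolding v_def by (rule borel_measurable_vec_lambdaI[OF compb])
  define NV where "NV = distr NP borel v"
  have pNV: "prob_space NV" and sNV: "sets NV = sets borel"
    unfolding NV_def by (auto intro: prob_space.prob_space_distr[OF pNP v])
  define \<Omega> where "\<Omega> = NV \<Otimes>\<^sub>M D"
  have p\<Omega>: "prob_space \<Omega>" unfolding \<Omega>_def by (rule prob_space_pair[OF pNV D(1)])
  interpret \<Omega>: prob_space \<Omega> by (rule p\<Omega>)
  interpret NV: prob_space NV by (rule pNV)
  interpret D: prob_space D by (rule D(1))
  have spD: "space D = UNIV" and spNV: "space NV = UNIV"
    using sets_eq_imp_space_eq[OF D(2)] sets_eq_imp_space_eq[OF sNV] by auto
  have sp: "space \<Omega> = UNIV" unfolding \<Omega>_def space_pair_measure spD spNV by simp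
  have V: "fst \<in> borel_measurable \<Omega>"
    unfolding \<Omega>_def measurable_cong_sets[OF refl sNV[symmetric]] by (rule measurable_fst)
  have W: "snd \<in> borel_measurable \<Omega>"
    unfolding \<Omega>_def measurable_cong_sets[OF refl D(2)[symmetric]] by (rule measurable_snd)
  have times: "emeasure \<Omega> (A \<times> B) = emeasure NV A * emeasure D B" if "A \<in> sets borel" "B \<in> sets borel" for A B
    unfolding \<Omega>_def using that sNV D(2) by (intro D.emeasure_pair_measure_Times) auto
  have dW: "distr \<Omega> borel snd = D"
  proof (rule measure_eqI)
    fix A assume "A \<in> sets (distr \<Omega> borel snd)"
    then have A: "A \<in> sets borel" by simp
    have "emeasure (distr \<Omega> borel snd) A = emeasure \<Omega> (UNIV \<times> A)"
      unfolding emeasure_distr[OF W A] sp by (rule arg_cong2[where f=emeasure]) auto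
    also have "\<dots> = emeasure D A" using times[OF _ A, of UNIV] NV.emeasure_space_1 unfolding spNV by simp
    finally show "emeasure (distr \<Omega> borel snd) A = emeasure D A" .
  qed (simp add: D(2))
  have dV: "distr \<Omega> borel fst = NV"
  proof (rule measure_eqI)
    fix A assume "A \<in> sets (distr \<Omega> borel fst)"
    then have A: "A \<in> sets borel" by simp
    have "emeasure (distr \<Omega> borel fst) A = emeasure \<Omega> (A \<times> UNIV)"
      unfolding emeasure_distr[OF V A] sp by (rule arg_cong2[where f=emeasure]) auto
    also have "\<dots> = emeasure NV A" using times[OF A, of UNIV] D.emeasure_space_1 unfolding spD by simp
    finally show "emeasure (distr \<Omega> borel fst) A = emeasure NV A" .
  qed (simp add: sNV)
  have marginal: "distr \<Omega> L (\<lambda>\<omega>. q (fst \<omega>)) = distr NP L (\<lambda>f. q (v f))" if q: "q \<in> measurable borel L" for L :: "'x measure" and q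
  proof -
    have "distr \<Omega> L (\<lambda>\<omega>. q (fst \<omega>)) = distr NV L q"
      unfolding dV[symmetric] distr_distr[OF q V] by (simp add: o_def)
    also have "\<dots> = distr NP L (\<lambda>f. q (v f))"
      unfolding NV_def distr_distr[OF q v] by (simp add: o_def)
    finally show ?thesis .
  qed
  have dVl: "distr \<Omega> borel (\<lambda>\<omega>. fst \<omega> $ l) = N l" for l
  proof -
    have "distr \<Omega> borel (\<lambda>\<omega>. fst \<omega> $ l) = distr NP borel (\<lambda>f. v f $ l)" by (rule marginal) measurable
    also have "\<dots> = distr NP (N l) (\<lambda>f. f l)" by (rule distr_cong) (auto simp: v_def sN)
    also have "\<dots> = N l" unfolding NP_def by (rule distr_PiM_component[OF pN]) simp
    finally show ?thesis .
  qed
  have indV: "\<Omega>.indep_vars (\<lambda>_. borel) (\<lambda>l \<omega>. fst \<omega> $ l) UNIV"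
  proof (subst \<Omega>.indep_vars_iff_distr_eq_PiM)
    show "(\<lambda>\<omega>. fst \<omega> $ l) \<in> borel_measurable \<Omega>" for l by (rule measurable_compose[OF V]) measurable
    have m: "(\<lambda>x :: real ^ 'm. \<lambda>l\<in>UNIV. x $ l) \<in> measurable borel (PiM UNIV (\<lambda>_. borel))" by measurable
    have "distr \<Omega> (PiM UNIV (\<lambda>_. borel)) (\<lambda>\<omega>. \<lambda>l\<in>UNIV. fst \<omega> $ l) =
       distr NP (PiM UNIV (\<lambda>_. borel)) (\<lambda>f. \<lambda>l\<in>UNIV. v f $ l)" by (rule marginal[OF m])
    also have "\<dots> = distr NP NP (\<lambda>f. f)"
      by (rule distr_cong) (auto simp: v_def NP_def sN intro!: sets_PiM_cong)
    also have "\<dots> = PiM UNIV N" by (simp add: NP_def)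
    finally show "distr \<Omega> (PiM UNIV (\<lambda>_. borel)) (\<lambda>\<omega>. \<lambda>l\<in>UNIV. fst \<omega> $ l) =
        PiM UNIV (\<lambda>l. distr \<Omega> borel (\<lambda>\<omega>. fst \<omega> $ l))" unfolding dVl .
  qed simp
  have indVW: "\<Omega>.indep_set (sets (vimage_algebra (space \<Omega>) fst borel)) (sets (vimage_algebra (space \<Omega>) snd borel))"
  proof -
    have f: "sets (vimage_algebra (space \<Omega>) fst borel) = {fst -` A \<inter> space \<Omega> | A. A \<in> sets borel}"
      and s: "sets (vimage_algebra (space \<Omega>) snd borel) = {snd -` A \<inter> space \<Omega> | A. A \<in> sets borel}"
      by (rule sets_vimage_algebra2; simp)+
    show ?thesis unfolding \<Omega>.indep_sets2_eq f s
    proof (intro conjI ballI)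
      show "{fst -` A \<inter> space \<Omega> | A. A \<in> sets borel} \<subseteq> \<Omega>.events" using measurable_sets[OF V] by auto
      show "{snd -` A \<inter> space \<Omega> | A. A \<in> sets borel} \<subseteq> \<Omega>.events" using measurable_sets[OF W] by auto
      fix a b assume "a \<in> {fst -` A \<inter> space \<Omega> | A. A \<in> sets borel}" "b \<in> {snd -` A \<inter> space \<Omega> | A. A \<in> sets borel}"
      then obtain A B where A: "A \<in> sets borel" "a = fst -` A \<inter> space \<Omega>" and B: "B \<in> sets borel" "b = snd -` B \<inter> space \<Omega>" by blast
      have "\<Omega>.prob (a \<inter> b) = measure \<Omega> (A \<times> B)"
        unfolding A(2) B(2) sp by (rule arg_cong2[where f=measure]) auto
      also have "\<dots> = measure NV A * measure D B"
        unfolding measure_def times[OF A(1) B(1)] by (rule enn2real_mult)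
      also have "measure NV A = \<Omega>.prob a" unfolding dV[symmetric] A(2) by (rule measure_distr[OF V A(1)])
      also have "measure D B = \<Omega>.prob b" unfolding dW[symmetric] B(2) by (rule measure_distr[OF W B(1)])
      finally show "\<Omega>.prob (a \<inter> b) = \<Omega>.prob a * \<Omega>.prob b" .
    qed
  qed
  have "limit_variables lamG lamH lamM \<Omega> fst snd"
    unfolding limit_variables_def using p\<Omega> dirichlet_comp[OF W dW D(3)] V N indV indVW by (simp only: dVl simp_thms)
  then show ?thesis by blast
qed

text \<open>\<open>Q\<close> is not assumed to live on the orthant. Its one-dimensional marginals
  are determined by their moments, hence agree with those of \<open>P\<close>, and this puts
  \<open>Q\<close> on the orthant. Then the convergence theorem for the constant sequence
  \<open>P\<close> identifies the joint law.\<close>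

lemma has_moments_unique:
  fixes P Q :: "(real ^ 'm::finite) measure"
  assumes lamG: "\<And>l. lamG l < 0" and lamH: "\<And>l. 0 < lamH l \<and> lamH l < 1" and lamM: "lamM \<le> 0"
    and P: "has_moments P (limit_moment lamG lamH lamM)" "\<And>l. AE x in P. 0 \<le> x $ l"
    and Q: "has_moments Q (limit_moment lamG lamH lamM)"
  shows "Q = P"
proof -
  let ?\<mu> = "limit_moment lamG lamH lamM"
  have power: "integrable R (\<lambda>x. (x $ l) ^ k)" "(\<integral>x. (x $ l) ^ k \<partial>R) = ?\<mu> (\<lambda>i. if i = l then k else 0)"
    if "has_moments R ?\<mu>" for R :: "(real ^ 'm) measure" and l and k :: nat
  proof -
    let ?s = "\<lambda>i. if i = l then k else 0"
    have "integrable R (monomial ?s)" "(\<integral>x. monomial ?s x \<partial>R) = ?\<mu> ?s"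
      using that unfolding has_moments_def monomial_def[symmetric] by auto
    then show "integrable R (\<lambda>x. (x $ l) ^ k)" "(\<integral>x. (x $ l) ^ k \<partial>R) = ?\<mu> ?s"
      by (simp_all add: monomial_single[symmetric])
  qed
  have nth: "(\<lambda>x. x $ l) \<in> borel_measurable R" if "has_moments R ?\<mu>" for R :: "(real ^ 'm) measure" and l
  proof -
    have s: "sets R = sets borel" using that unfolding has_moments_def by simp
    show ?thesis unfolding measurable_cong_sets[OF s refl] by measurable
  qed
  have dist: "real_distribution (distr R borel (\<lambda>x. x $ l))" if "has_moments R ?\<mu>" for R :: "(real ^ 'm) measure" and l
    by (rule prob_space.real_distribution_distr[OF _ nth[OF that]]) (use that in \<open>simp add: has_moments_def\<close>)
  have pow: "integrable (distr R borel (\<lambda>x. x $ l)) (\<lambda>y. y ^ k)"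
    "(\<integral>y. y ^ k \<partial>distr R borel (\<lambda>x. x $ l)) = ?\<mu> (\<lambda>i. if i = l then k else 0)"
    if "has_moments R ?\<mu>" for R :: "(real ^ 'm) measure" and l and k :: nat
    using power[OF that] by (simp_all add: integrable_distr_eq[OF nth[OF that]] integral_distr[OF nth[OF that]])
  have "distr P borel (\<lambda>x. x $ l) = distr Q borel (\<lambda>x. x $ l)" for l
  proof (rule real_distribution_eq_if_moments_eq[OF dist[OF P(1)] dist[OF Q]])
    fix t :: real
    have "filterlim (\<lambda>n::nat. 2 * n) at_top sequentially"
      by (rule filterlim_subseq) (simp add: strict_mono_def)
    from filterlim_compose[OF limit_moment_growth[of lamG lamH lamM t l, OF lamG lamH lamM] this]
    show "(\<lambda>n. t ^ (2 * n) * (\<integral>x. x ^ (2 * n) \<partial>distr P borel (\<lambda>x. x $ l)) / fact (2 * n)) \<longlonglongrightarrow> 0"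
      unfolding pow(2)[OF P(1)] .
  qed (simp_all add: pow[OF P(1)] pow[OF Q])
  moreover have "AE y in distr P borel (\<lambda>x. x $ l). 0 \<le> y" for l
    using P(2)[of l] by (subst AE_distr_iff[OF nth[OF P(1)]]) auto
  ultimately have "AE y in distr Q borel (\<lambda>x. x $ l). 0 \<le> y" for l
    by (simp only:)
  then have orthant_Q: "AE x in Q. 0 \<le> x $ l" for l by (rule AE_distrD[OF nth[OF Q]])
  have prob: "prob_space R" "sets R = sets borel" "integrable R (monomial s)" "(\<integral>x. monomial s x \<partial>R) = ?\<mu> s"
    if "has_moments R ?\<mu>" for R :: "(real ^ 'm) measure" and s
    using that unfolding has_moments_def monomial_def[symmetric] by auto
  interpret orthant_moment_convergence "\<lambda>_. P" Q
  proof (rule orthant_moment_convergence.intro)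
    show "(\<lambda>n::nat. \<integral>x. monomial s x \<partial>P) \<longlonglongrightarrow> (\<integral>x. monomial s x \<partial>Q)" for s
      unfolding prob(4)[OF P(1)] prob(4)[OF Q] by (rule tendsto_const)
    show "(\<lambda>j. r ^ j * (\<integral>x. (x $ l) ^ j \<partial>Q) / fact j) \<longlonglongrightarrow> 0" for l r
      unfolding power(2)[OF Q] by (rule limit_moment_growth[of lamG lamH, OF lamG lamH lamM])
  qed (rule prob(1-3)[OF P(1)] prob(1-3)[OF Q] P(2) orthant_Q)+
  show ?thesis
  proof (rule measure_eq_if_continuous_integrals_eq)
    fix f :: "real ^ 'm \<Rightarrow> real" assume "continuous_on UNIV f" "bounded (range f)"
    then have "(\<lambda>n::nat. \<integral>x. f x \<partial>P) \<longlonglongrightarrow> (\<integral>x. f x \<partial>Q)" using converges unfolding converges_in_law_def by blast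
    then show "(\<integral>x. f x \<partial>Q) = (\<integral>x. f x \<partial>P)" using LIMSEQ_unique tendsto_const by blast
  qed (rule prob_Q sets_Q prob_P sets_P)+
qed

lemma eval_fps_pos:
  fixes f :: "real fps"
  assumes "\<And>n. 0 \<le> fps_nth f n" "f \<noteq> 0" and r: "0 < r" "ereal r < fps_conv_radius f"
  shows "0 < eval_fps f r"
proof -
  obtain i where i: "fps_nth f i \<noteq> 0" using assms(2) by (auto simp: fps_eq_iff)
  have s: "summable (\<lambda>n. fps_nth f n * r ^ n)" using r by (intro summable_fps) simp
  show ?thesis unfolding eval_fps_def
  proof (rule suminf_pos2[OF s])
    show "0 \<le> fps_nth f n * r ^ n" for n using assms(1) r by simp
    show "0 < fps_nth f i * r ^ i" using assms(1)[of i] i r by (intro mult_pos_pos) auto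
  qed
qed

theorem theorem7p4:
  fixes M :: "real fps"
    and G H :: "'m::finite \<Rightarrow> real fps"
    and X :: "nat \<Rightarrow> ('m \<Rightarrow> nat) pmf"
    and rhoH lamM :: real
    and rhoG lamG lamH cG cH \<kappa> :: "'m \<Rightarrow> real"
  assumes nonneg: "\<And>l n. fps_nth (G l) n \<ge> 0" "\<And>l n. fps_nth (H l) n \<ge> 0" "\<And>n. fps_nth M n \<ge> 0"
    and H_0: "\<And>l. fps_nth (H l) 0 = 0"
    and M_nonzero: "M \<noteq> 0"
    and M_analytic_0: "fps_conv_radius M > 0"
    and sing_G: "\<And>l. singular_at (G l) (rhoG l) (lamG l) (cG l)"
    and sing_H: "\<And>l. singular_at (H l) rhoH (lamH l) (cH l)"
    and critical: "\<And>l. eval_fps (H l) rhoH = rhoG l" "fps_conv_radius M \<ge> ereal rhoH"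
    and pure_H: "\<And>l. 0 < lamH l \<and> lamH l < 1"
    and pure_G: "\<And>l. lamG l < 0"
    and pure_M: "(lamM < 0 \<and> (\<exists>cM. singular_at M rhoH lamM cM)) \<or>
                 (fps_conv_radius M > ereal rhoH \<and> lamM = 0)"
    and law_X: "\<And>n k. scheme_total M G H n \<noteq> 0 \<Longrightarrow>
                  pmf (X n) k = scheme_coeff M G H n k / scheme_total M G H n"
    and kappa: "\<And>l. \<kappa> l = eval_fps (H l) rhoH / (- cH l)"
  shows "(\<forall>s :: 'm \<Rightarrow> nat.
      (\<lambda>n. measure_pmf.expectation (X n) (\<lambda>k. \<Prod>l\<in>UNIV. real (k l) ^ s l))
        \<sim>[sequentially]
      (\<lambda>n. limit_moment lamG lamH lamM s *
         (\<Prod>l\<in>UNIV. real n powr (real (s l) * lamH l) * \<kappa> l ^ s l))) \<and>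
    (\<exists>P :: (real ^ 'm) measure.
      has_moments P (limit_moment lamG lamH lamM) \<and>
      (\<forall>Q. has_moments Q (limit_moment lamG lamH lamM) \<longrightarrow> Q = P) \<and>
      converges_in_law
        (\<lambda>n. distr (measure_pmf (X n)) borel
               (\<lambda>k. \<chi> l. real (k l) / (\<kappa> l * real n powr lamH l))) P \<and>
      (\<forall>s :: 'm \<Rightarrow> nat.
        (\<lambda>n. measure_pmf.expectation (X n)
               (\<lambda>k. \<Prod>l\<in>UNIV. (real (k l) / (\<kappa> l * real n powr lamH l)) ^ s l))
          \<longlonglongrightarrow> (\<integral>x. (\<Prod>l\<in>UNIV. (x $ l) ^ s l) \<partial>P)) \<and>
      (\<exists>(\<Omega> :: ((real ^ 'm) \<times> (real ^ ('m option))) measure) V W.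
        limit_variables lamG lamH lamM \<Omega> V W \<and> limit_law lamH \<Omega> V W = P) \<and>
      (\<forall>(\<Omega> :: 'w measure) V W.
        limit_variables lamG lamH lamM \<Omega> V W \<longrightarrow> limit_law lamH \<Omega> V W = P))"
proof (intro conjI)
  let ?T = "scheme_total M G H"
  let ?\<mu> = "limit_moment lamG lamH lamM"
  let ?E = "\<lambda>n s. measure_pmf.expectation (X n) (\<lambda>k. \<Prod>l\<in>UNIV. real (k l) ^ s l)"
  let ?N = "\<lambda>n s. \<Prod>l\<in>UNIV. real n powr (real (s l) * lamH l) * \<kappa> l ^ s l"
  let ?Z = "\<lambda>n. distr (measure_pmf (X n)) borel (\<lambda>k. \<chi> l. real (k l) / (\<kappa> l * real n powr lamH l))"
  have \<rho>: "0 < rhoH" using sing_H unfolding singular_at_def by blast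
  have lamM: "lamM \<le> 0" using pure_M by auto
  have lamH: "0 < lamH l" for l using pure_H by blast
  have inner: "inner_series (H l) rhoH (rhoG l) (lamH l) (cH l)" for l
  proof
    show "cone_sing (H l) rhoH (rhoG l) (lamH l) (cH l)"
      using singular_at_imp_cone_sing[OF sing_H[of l]] lamH[of l] unfolding critical(1) by simp
    show "cH l \<noteq> 0" using sing_H[of l] unfolding singular_at_def by blast
  qed (use pure_H nonneg in auto)
  have G: "cone_sing (G l) (rhoG l) 0 (lamG l) (cG l)" for l
    using singular_at_imp_cone_sing[OF sing_G[of l]] pure_G[of l] by simp
  have cG: "cG l \<noteq> 0" for l using sing_G[of l] unfolding singular_at_def by blast
  \<comment> \<open>\<open>M\<close> enters with its singular constant if \<open>lamM < 0\<close>.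
    If it is analytic at \<open>rhoH\<close>, it enters with its value there, positive because the
    coefficients are nonnegative and not all zero.\<close>
  obtain cM where cM: "cM \<noteq> 0" "disc_sing (eval_fps (map_coeffs complex_of_real M)) rhoH lamM (of_real cM)"
  proof (cases "lamM < 0")
    case True
    then obtain c where c: "singular_at M rhoH lamM c" using pure_M by auto
    have "cone_sing M rhoH 0 lamM c" using singular_at_imp_cone_sing[OF c] True by simp
    moreover have "c \<noteq> 0" using c unfolding singular_at_def by blast
    ultimately show ?thesis using that disc_sing_cone_sing by blast
  next
    case False
    then have r: "ereal rhoH < fps_conv_radius M" and "lamM = 0" using pure_M by auto
    moreover have "eval_fps M rhoH \<noteq> 0" using eval_fps_pos[OF nonneg(3) M_nonzero \<rho> r] by simp
    ultimately show ?thesis using that disc_sing_analytic[OF \<rho> r] by blast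
  qed
  interpret S: pure_scheme M H rhoH lamM cM rhoG lamH cH G lamG cG \<kappa>
    by (intro pure_scheme.intro critical_scheme.intro pure_scheme_axioms.intro)
      (simp_all add: H_0 inner cM M_analytic_0 lamM G pure_G cG kappa critical(1))
  have good: "\<forall>\<^sub>F n in sequentially. ?T n \<noteq> 0" by (rule S.scheme_total_nonzero)
  have "?E n s = scheme_total M (\<lambda>l. weighted (s l) (G l)) H n / ?T n" if "?T n \<noteq> 0" for n s
    unfolding weighted_def by (rule expectation_scheme(1)[OF H_0 that law_X[OF that]])
  then have E: "(\<lambda>n. ?E n s / ?N n s) \<longlonglongrightarrow> ?\<mu> s" for s
    by (intro Lim_transform_eventually[OF S.moment_ratio_tendsto] eventually_mono[OF good]) simp
  \<comment> \<open>A limit of the quotient gives asymptotic equivalence only if it is nonzero; here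
    the positivity of the limit moments enters.\<close>
  show "\<forall>s. (\<lambda>n. ?E n s) \<sim>[sequentially] (\<lambda>n. ?\<mu> s * ?N n s)"
    using asymp_equivI'_const[OF E] less_imp_neq[OF S.limit_moment_pos] by (metis (no_types, lifting))
  \<comment> \<open>Index \<open>0\<close> is excluded: for \<open>s l = 0\<close> the factor
    \<open>0 powr 0 = 0\<close> differs from \<open>(\<kappa> l * 0) ^ 0 = 1\<close>.\<close>
  have scaled: "measure_pmf.expectation (X n) (\<lambda>k. \<Prod>l\<in>UNIV. (real (k l) / (\<kappa> l * real n powr lamH l)) ^ s l) = ?E n s / ?N n s"
    if "0 < n" for n s
  proof -
    have "(\<kappa> l * real n powr lamH l) ^ s l = real n powr (real (s l) * lamH l) * \<kappa> l ^ s l" for l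
      using that by (simp add: power_mult_distrib powr_power mult.commute)
    then show ?thesis by (simp only: power_divide prod_dividef integral_divide_zero)
  qed
  have scaled_lim: "(\<lambda>n. measure_pmf.expectation (X n) (\<lambda>k. \<Prod>l\<in>UNIV. (real (k l) / (\<kappa> l * real n powr lamH l)) ^ s l)) \<longlonglongrightarrow> ?\<mu> s" for s
    by (rule Lim_transform_eventually[OF E]) (use eventually_gt_at_top[of 0] in eventually_elim, simp only: scaled)
  have ex: "\<exists>N. mittag_leffler (lamH l) (- lamG l * lamH l) N" for l
    by (rule exists_mittag_leffler[OF inner H_0 G pure_G cG nonneg(1)])
  obtain \<Omega>\<^sub>0 :: "((real ^ 'm) \<times> (real ^ ('m option))) measure" and V\<^sub>0 W\<^sub>0
    where limit: "limit_variables lamG lamH lamM \<Omega>\<^sub>0 V\<^sub>0 W\<^sub>0"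
    using exists_limit_variables[of lamG lamH, OF pure_G lamH lamM ex] by blast
  define P where "P = limit_law lamH \<Omega>\<^sub>0 V\<^sub>0 W\<^sub>0"
  note law = has_moments_limit_law[of lamG lamH, OF pure_G lamH lamM]
  have P: "has_moments P ?\<mu>" "AE x in P. 0 \<le> x $ l" for l
    unfolding P_def using law[OF limit] by auto
  have unique: "Q = P" if "has_moments Q ?\<mu>" for Q
    by (rule has_moments_unique[of lamG lamH, OF pure_G pure_H lamM P that])
  have P_monomial: "integrable P (monomial s)" "(\<integral>x. monomial s x \<partial>P) = ?\<mu> s" for s
    using P(1) unfolding has_moments_def monomial_def[symmetric] by auto
  have Zm: "(\<lambda>k. \<chi> l. real (k l) / (\<kappa> l * real n powr lamH l)) \<in> borel_measurable (measure_pmf (X n))" for n by simp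
  have fin: "integrable (measure_pmf (X n)) f" if "?T n \<noteq> 0" for n and f :: "('m \<Rightarrow> nat) \<Rightarrow> real"
    by (intro integrable_measure_pmf_finite finite_subset[OF expectation_scheme(2)[OF H_0 that law_X[OF that]]] finite_PiE) auto
  \<comment> \<open>Where the total vanishes, \<open>X n\<close> is arbitrary and may lack moments.
    These finitely many laws are replaced by \<open>P\<close>, which does not affect the
    limit.\<close>
  let ?Z' = "\<lambda>n. if ?T n = 0 then P else ?Z n"
  interpret orthant_moment_convergence ?Z' P
  proof (rule orthant_moment_convergence.intro)
    have pP: "prob_space P" "sets P = sets borel" using P(1) unfolding has_moments_def by auto
    then show "prob_space P" "sets P = sets borel" by auto
    show "prob_space (?Z' n)" for n
      using pP by (auto intro!: prob_space.prob_space_distr measure_pmf.prob_space_axioms)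
    show "sets (?Z' n) = sets borel" for n using pP by simp
    show "AE x in P. 0 \<le> x $ l" for l by (rule P(2))
    have "AE x in ?Z n. 0 \<le> x $ l" for n l
      using less_imp_le[OF S.\<kappa>_pos] by (subst AE_distr_iff[OF Zm]) auto
    then show "AE x in ?Z' n. 0 \<le> x $ l" for n l using P(2) by simp
    show "integrable P (monomial s)" for s by (rule P_monomial)
    have "integrable (?Z n) (monomial s)" if "?T n \<noteq> 0" for n s
      unfolding integrable_distr_eq[OF Zm monomial_measurable] by (rule fin[OF that])
    then show "integrable (?Z' n) (monomial s)" for n s using P_monomial by simp
    show "(\<lambda>n. \<integral>x. monomial s x \<partial>?Z' n) \<longlonglongrightarrow> (\<integral>x. monomial s x \<partial>P)" for s
      unfolding P_monomial
    proof (rule Lim_transform_eventually[OF scaled_lim eventually_mono[OF good]])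
      fix n assume n: "?T n \<noteq> 0"
      have "(\<integral>x. monomial s x \<partial>?Z n) = measure_pmf.expectation (X n) (\<lambda>k. \<Prod>l\<in>UNIV. (real (k l) / (\<kappa> l * real n powr lamH l)) ^ s l)"
        unfolding integral_distr[OF Zm monomial_measurable] by (simp add: monomial_def)
      then show "measure_pmf.expectation (X n) (\<lambda>k. \<Prod>l\<in>UNIV. (real (k l) / (\<kappa> l * real n powr lamH l)) ^ s l) =
          (\<integral>x. monomial s x \<partial>?Z' n)" using n by simp
    qed
    show "(\<lambda>j. r ^ j * (\<integral>x. (x $ l) ^ j \<partial>P) / fact j) \<longlonglongrightarrow> 0" for l r
      unfolding monomial_single[symmetric] P_monomial by (rule limit_moment_growth[of lamG lamH, OF pure_G pure_H lamM])
  qed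
  have "converges_in_law ?Z P"
    unfolding converges_in_law_def
  proof (intro allI impI)
    fix f :: "real ^ 'm \<Rightarrow> real" assume "continuous_on UNIV f" "bounded (range f)"
    then have "(\<lambda>n. \<integral>x. f x \<partial>?Z' n) \<longlonglongrightarrow> (\<integral>x. f x \<partial>P)" using converges unfolding converges_in_law_def by blast
    then show "(\<lambda>n. \<integral>x. f x \<partial>?Z n) \<longlonglongrightarrow> (\<integral>x. f x \<partial>P)"
      by (rule Lim_transform_eventually) (use good in eventually_elim, simp)
  qed
  then show "\<exists>P :: (real ^ 'm) measure. has_moments P ?\<mu> \<and> (\<forall>Q. has_moments Q ?\<mu> \<longrightarrow> Q = P) \<and>
      converges_in_law ?Z P \<and>
      (\<forall>s. (\<lambda>n. measure_pmf.expectation (X n) (\<lambda>k. \<Prod>l\<in>UNIV. (real (k l) / (\<kappa> l * real n powr lamH l)) ^ s l))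
          \<longlonglongrightarrow> (\<integral>x. (\<Prod>l\<in>UNIV. (x $ l) ^ s l) \<partial>P)) \<and>
      (\<exists>(\<Omega> :: ((real ^ 'm) \<times> (real ^ ('m option))) measure) V W.
        limit_variables lamG lamH lamM \<Omega> V W \<and> limit_law lamH \<Omega> V W = P) \<and>
      (\<forall>(\<Omega> :: 'w measure) V W. limit_variables lamG lamH lamM \<Omega> V W \<longrightarrow> limit_law lamH \<Omega> V W = P)"
  proof (intro exI[of _ P] conjI allI impI)
    show "\<exists>(\<Omega> :: ((real ^ 'm) \<times> (real ^ ('m option))) measure) V W.
        limit_variables lamG lamH lamM \<Omega> V W \<and> limit_law lamH \<Omega> V W = P"
      using limit P_def by blast
    show "(\<lambda>n. measure_pmf.expectation (X n) (\<lambda>k. \<Prod>l\<in>UNIV. (real (k l) / (\<kappa> l * real n powr lamH l)) ^ s l))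
          \<longlonglongrightarrow> (\<integral>x. (\<Prod>l\<in>UNIV. (x $ l) ^ s l) \<partial>P)" for s
      unfolding P_monomial(2)[unfolded monomial_def] by (rule scaled_lim)
    \<comment> \<open>Every realization, on whatever probability space, has the same moments, so
      uniqueness identifies its law.\<close>
    show "limit_law lamH \<Omega> V W = P" if "limit_variables lamG lamH lamM \<Omega> V W" for \<Omega> :: "'w measure" and V W
      by (rule unique[OF law(1)[OF that]])
  qed (rule P(1) unique; assumption?)+
qed

end
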